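(* Let $\mathcal{C}\subset\mathbb{P}^2$ be a CL-arrangement which is free with exponents $(a,b)$, $a\le b$. Assume that all the CL-arrangements appearing below (namely $\mathcal{C}$, and the arrangements obtained from $\mathcal{C}$ by deleting or adding the line or smooth conic in question) have only quasihomogeneous singularities. (1) If $L$ is a line which is an irreducible component of $\mathcal{C}$ and $\mathcal{C}'$ is the union of the other irreducible components of $\mathcal{C}$, then either $|\mathcal{C}'\cap L|=b+1$ or $|\mathcal{C}'\cap L|\le a+1$. (2) If $L$ is a line which is not an irreducible component of $\mathcal{C}$, then $|\mathcal{C}\cap L|=a+1$ or $|\mathcal{C}\cap L|\ge b+1$. (3) Let $C$ be a smooth conic which is an irreducible component of $\mathcal{C}$, and let $k$ be the number of singular points of $\mathcal{C}$ lying on $C$. If $k=2m$, then $m=b$ or $m\le a$; if $k=2m+1$, then $m=a-1=b-1$ or $m\le a-1$. (4) Let $C$ be a smooth conic which is not an irreducible component of $\mathcal{C}$, and let $k=|\mathcal{C}\cap C|$. If $k=2m$, then $m=a$ or $m\ge b$; if $k=2m+1$, then $m=a=b$ or $m\ge b$.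
   Context: A CL-arrangement is a reduced curve in $\mathbb{P}^2=\mathbb{P}^2\mathbb{C}$ whose irreducible components are lines and smooth conics. Let $S=\mathbb{C}[x,y,z]$. For a reduced curve $\mathcal{C}$ defined by a reduced homogeneous polynomial $f$, let $D_0(\mathcal{C})=\{\theta=g_1\partial_x+g_2\partial_y+g_3\partial_z,\ g_i\in S:\theta(f)=0\}$, a graded $S$-module (a derivation has degree $e$ if its coefficients are homogeneous of degree $e$). $\mathcal{C}$ is free with exponents $(a,b)$ if $D_0(\mathcal{C})$ is a free $S$-module with a basis of homogeneous derivations of degrees $a,b$. A singular point is quasihomogeneous if the local germ is defined, in suitable local analytic coordinates, by a weighted homogeneous polynomial (equivalently, its Milnor and Tjurina numbers coincide). $|\cdot|$ denotes the number of distinct points. *)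

theory Defs
  imports Complex_Main "HOL-Library.Poly_Mapping" "HOL-Library.Extended_Nat"
begin

text \<open>Polynomials in the variables x0, x1, x2 (= x, y, z) over the complex numbers,
  represented as finitely supported maps from monomials (exponent vectors) to coefficients.
  The ring S = C[x,y,z] is the set of such polynomials involving only variables 0, 1, 2.\<close>

type_synonym mpoly = "(nat \<Rightarrow>\<^sub>0 nat) \<Rightarrow>\<^sub>0 complex"
type_synonym pt3 = "complex \<times> complex \<times> complex"
type_synonym deriv3 = "mpoly \<times> mpoly \<times> mpoly"

definition Var :: "nat \<Rightarrow> mpoly" where
  "Var i = Poly_Mapping.single (Poly_Mapping.single i 1) 1"

definition Const :: "complex \<Rightarrow> mpoly" where
  "Const c = Poly_Mapping.single 0 c"

definition inS :: "mpoly \<Rightarrow> bool" where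
  "inS p \<longleftrightarrow> (\<forall>m\<in>Poly_Mapping.keys p. Poly_Mapping.keys m \<subseteq> {0,1,2})"

definition homog :: "nat \<Rightarrow> mpoly \<Rightarrow> bool" where
  "homog d p \<longleftrightarrow> (\<forall>m\<in>Poly_Mapping.keys p. (\<Sum>i\<in>Poly_Mapping.keys m. Poly_Mapping.lookup m i) = d)"

definition coord :: "pt3 \<Rightarrow> nat \<Rightarrow> complex" where
  "coord v i = (if i = 0 then fst v else if i = 1 then fst (snd v)
               else if i = 2 then snd (snd v) else 0)"

definition mp_eval :: "mpoly \<Rightarrow> pt3 \<Rightarrow> complex" where
  "mp_eval p v = (\<Sum>m\<in>Poly_Mapping.keys p. Poly_Mapping.lookup p m * (\<Prod>i\<in>Poly_Mapping.keys m. coord v i ^ Poly_Mapping.lookup m i))"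

definition pd :: "nat \<Rightarrow> mpoly \<Rightarrow> mpoly" where
  "pd i p = (\<Sum>m\<in>Poly_Mapping.keys p. Poly_Mapping.single (m - Poly_Mapping.single i 1)
                            (of_nat (Poly_Mapping.lookup m i) * Poly_Mapping.lookup p m))"

definition proj_class :: "pt3 \<Rightarrow> pt3 set" where
  "proj_class v = {(c * fst v, c * fst (snd v), c * snd (snd v)) | c. c \<noteq> 0}"

definition proj_points :: "(pt3 \<Rightarrow> bool) \<Rightarrow> pt3 set set" where
  "proj_points P = {proj_class v | v. v \<noteq> (0,0,0) \<and> P v}"

definition npoints :: "(pt3 \<Rightarrow> bool) \<Rightarrow> nat" where
  "npoints P = card (proj_points P)"

definition is_singular_pt :: "mpoly \<Rightarrow> pt3 \<Rightarrow> bool" where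
  "is_singular_pt f v \<longleftrightarrow> v \<noteq> (0,0,0) \<and> mp_eval f v = 0 \<and> (\<forall>i<3. mp_eval (pd i f) v = 0)"

text \<open>Local algebra dimensions (Milnor / Tjurina numbers) computed algebraically
  in the affine chart x_j = 1.\<close>

definition ideal_gen :: "mpoly list \<Rightarrow> mpoly set" where
  "ideal_gen gs = {h. \<exists>cs. length cs = length gs \<and> (\<forall>c\<in>set cs. inS c) \<and>
                      h = (\<Sum>(c,g)\<leftarrow>zip cs gs. c * g)}"

definition loc_ideal :: "mpoly set \<Rightarrow> pt3 \<Rightarrow> mpoly set" where
  "loc_ideal I q = {h. inS h \<and> (\<exists>s. inS s \<and> mp_eval s q \<noteq> 0 \<and> s * h \<in> I)}"

definition quot_dim :: "mpoly set \<Rightarrow> enat" where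
  "quot_dim J = Sup {enat n | n. \<exists>vs. length vs = n \<and> (\<forall>v\<in>set vs. inS v) \<and>
      (\<forall>cs. length cs = n \<longrightarrow> (\<Sum>(c,v)\<leftarrow>zip cs vs. Const c * v) \<in> J \<longrightarrow> (\<forall>c\<in>set cs. c = 0))}"

definition chart_pt :: "pt3 \<Rightarrow> nat \<Rightarrow> pt3" where
  "chart_pt v j = (let t = 1 / coord v j in (t * fst v, t * fst (snd v), t * snd (snd v)))"

definition tjurina :: "mpoly \<Rightarrow> pt3 \<Rightarrow> nat \<Rightarrow> enat" where
  "tjurina f v j = quot_dim (loc_ideal
     (ideal_gen ([Var j - Const 1, f] @ [pd k f. k \<leftarrow> [0,1,2], k \<noteq> j])) (chart_pt v j))"

definition milnor :: "mpoly \<Rightarrow> pt3 \<Rightarrow> nat \<Rightarrow> enat" where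
  "milnor f v j = quot_dim (loc_ideal
     (ideal_gen ([Var j - Const 1] @ [pd k f. k \<leftarrow> [0,1,2], k \<noteq> j])) (chart_pt v j))"

definition qh_point :: "mpoly \<Rightarrow> pt3 \<Rightarrow> bool" where
  "qh_point f v \<longleftrightarrow> (\<forall>j<3. coord v j \<noteq> 0 \<longrightarrow> milnor f v j = tjurina f v j)"

definition only_qh :: "mpoly \<Rightarrow> bool" where
  "only_qh f \<longleftrightarrow> (\<forall>v. is_singular_pt f v \<longrightarrow> qh_point f v)"

definition D0 :: "mpoly \<Rightarrow> deriv3 set" where
  "D0 f = {(g1,g2,g3). inS g1 \<and> inS g2 \<and> inS g3 \<and>
             g1 * pd 0 f + g2 * pd 1 f + g3 * pd 2 f = 0}"

definition der_homog :: "nat \<Rightarrow> deriv3 \<Rightarrow> bool" where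
  "der_homog e t \<longleftrightarrow> homog e (fst t) \<and> homog e (fst (snd t)) \<and> homog e (snd (snd t))"

definition dlin :: "mpoly \<Rightarrow> deriv3 \<Rightarrow> mpoly \<Rightarrow> deriv3 \<Rightarrow> deriv3" where
  "dlin h1 t1 h2 t2 = (h1 * fst t1 + h2 * fst t2,
                       h1 * fst (snd t1) + h2 * fst (snd t2),
                       h1 * snd (snd t1) + h2 * snd (snd t2))"

definition free_exps :: "mpoly \<Rightarrow> nat \<Rightarrow> nat \<Rightarrow> bool" where
  "free_exps f a b \<longleftrightarrow> (\<exists>t1 t2. t1 \<in> D0 f \<and> t2 \<in> D0 f \<and> der_homog a t1 \<and> der_homog b t2 \<and>
      (\<forall>t\<in>D0 f. \<exists>h1 h2. inS h1 \<and> inS h2 \<and> t = dlin h1 t1 h2 t2) \<and>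
      (\<forall>h1 h2. inS h1 \<longrightarrow> inS h2 \<longrightarrow> dlin h1 t1 h2 t2 = (0,0,0) \<longrightarrow> h1 = 0 \<and> h2 = 0))"

definition is_line :: "mpoly \<Rightarrow> bool" where
  "is_line L \<longleftrightarrow> inS L \<and> homog 1 L \<and> L \<noteq> 0"

definition is_smooth_conic :: "mpoly \<Rightarrow> bool" where
  "is_smooth_conic Q \<longleftrightarrow> inS Q \<and> homog 2 Q \<and> Q \<noteq> 0 \<and> (\<nexists>v. is_singular_pt Q v)"

definition proportional :: "mpoly \<Rightarrow> mpoly \<Rightarrow> bool" where
  "proportional p q \<longleftrightarrow> (\<exists>c. p = Const c * q)"

definition CL_arr :: "mpoly set \<Rightarrow> bool" where
  "CL_arr A \<longleftrightarrow> finite A \<and> A \<noteq> {} \<and> (\<forall>p\<in>A. is_line p \<or> is_smooth_conic p) \<and>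
     (\<forall>p\<in>A. \<forall>q\<in>A. p \<noteq> q \<longrightarrow> \<not> proportional p q)"

end

theory Submission
  imports Defs "HOL-Computational_Algebra.Computational_Algebra"
begin

text \<open>
  Let \<open>q\<close> be the component that is deleted or added, \<open>G\<close> the product of the other components, and
  parametrize \<open>q\<close> by \<open>\<phi>\<close>, of degree \<open>r = 1\<close> or \<open>r = 2\<close>, with the point at infinity off \<open>G\<close>.
  A derivation \<open>\<theta>\<close> preserving \<open>q G\<close> is tangent to \<open>q\<close>; modulo the Euler derivation it restricts to
  a vector field \<open>w \<cdot> d/dt\<close>, where \<open>w\<close> has degree at most \<open>r e + 2 - r\<close> if \<open>\<theta>\<close> has degree \<open>e\<close>, and
  \<open>w\<close> vanishes at all points of \<open>q \<inter> G\<close>. Quasihomogeneity provides, at each of these points, some \<open>\<theta>\<close>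
  for which the zero is simple; at the other points of \<open>q\<close>, infinity included, a Koszul derivation
  has \<open>w \<noteq> 0\<close>. So the \<open>w\<close> generate the ideal of \<open>q \<inter> G\<close>.

  If \<open>q G\<close> is free with basis \<open>\<theta>1, \<theta>2\<close>, this ideal is generated by \<open>w1, w2\<close>: either \<open>w1 \<noteq> 0\<close> bounds the
  number \<open>n\<close> of points by \<open>r a + 2 - r\<close>, or \<open>w1 = 0\<close> and \<open>n = deg w2 = r b + 2 - r\<close>. If instead \<open>G\<close> is free
  with basis \<open>\<theta>1, \<theta>2\<close>, put \<open>v\<^sub>i = \<theta>\<^sub>i(q)\<close> on \<open>q\<close>; the derivations of \<open>G\<close> tangent to \<open>q\<close> restrict to
  multiples of \<open>p1 \<theta>1 + p2 \<theta>2\<close>, where \<open>(p1, p2)\<close> generates the syzygies of \<open>(v1, v2)\<close>; so the \<open>w\<close> of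
  this combination has degree \<open>n\<close>. This gives
  \<open>n = r a + 2 - r\<close> if \<open>v1 = 0\<close>, and \<open>n \<ge> r b + 2 - r\<close> otherwise.
\<close>

section \<open>Polynomials in three variables\<close>

text \<open>A derivation of degree \<open>e\<close>, modulo Euler, is a section of the tangent
  bundle of the plane twisted by e - 1; tangent to \<open>q\<close>, it restricts to the tangent
  bundle of the projective line twisted by r (e - 1), of degree 2 + r (e - 1). This is the constant
  \<open>r * e + 2 - r\<close>. Exponents see multiplicities, while the theorem counts distinct
  points; hence the need for simple zeros. Equality of Milnor and Tjurina numbers says something
  only if they are finite, so finiteness of the Tjurina number comes first; then \<open>f\<close>
  lies in the local Jacobian ideal, and some derivation multiplies \<open>f\<close> by a unit at the
  point. The exact degree of a generating \<open>w\<close> is read off at infinity: a Koszul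
  derivation reaches the maximal degree there, so a factor of it cannot be too small. Polynomials in
  three variables are nowhere factored: vanishing along the parametrization replaces divisibility by
  \<open>q\<close>, up to powers of a linear form that restricts to 1.\<close>

abbreviation mlookup :: "('a \<Rightarrow>\<^sub>0 'b::zero) \<Rightarrow> 'a \<Rightarrow> 'b" where
  "mlookup \<equiv> Poly_Mapping.lookup"
abbreviation mkeys :: "('a \<Rightarrow>\<^sub>0 'b::zero) \<Rightarrow> 'a set" where
  "mkeys \<equiv> Poly_Mapping.keys"
abbreviation msingle :: "'a \<Rightarrow> 'b \<Rightarrow> 'a \<Rightarrow>\<^sub>0 'b::zero" where
  "msingle \<equiv> Poly_Mapping.single"

definition mdeg :: "(nat \<Rightarrow>\<^sub>0 nat) \<Rightarrow> nat" where
  "mdeg m = (\<Sum>i\<in>mkeys m. mlookup m i)"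

lemma homog_mdeg: "homog d p \<longleftrightarrow> (\<forall>m\<in>mkeys p. mdeg m = d)"
  by (simp add: homog_def mdeg_def)

lemma mkeys_add_nat: "mkeys (m + m' :: nat \<Rightarrow>\<^sub>0 nat) = mkeys m \<union> mkeys m'"
  by (auto simp: in_keys_iff lookup_add)

lemma mdeg_superset: "finite K \<Longrightarrow> mkeys m \<subseteq> K \<Longrightarrow> mdeg m = (\<Sum>i\<in>K. mlookup m i)"
  unfolding mdeg_def by (intro sum.mono_neutral_left) (auto simp: in_keys_iff)

lemma mdeg_add: "mdeg (m + m') = mdeg m + mdeg m'"
  using mdeg_superset[of "mkeys m \<union> mkeys m'" m] mdeg_superset[of "mkeys m \<union> mkeys m'" m']
    mdeg_superset[of "mkeys m \<union> mkeys m'" "m + m'"]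
  by (simp add: mkeys_add_nat lookup_add sum.distrib)

lemma mdeg_single [simp]: "mdeg (msingle i k) = k"
  by (simp add: mdeg_def)

lemma mdeg_0 [simp]: "mdeg 0 = 0"
  by (simp add: mdeg_def)

text \<open>Addition can cancel terms, but since \<open>F m 0 = 0\<close> all three sums may run
  over the union of the two supports. This one fact makes evaluation, derivatives and homogeneous
  components additive.\<close>

lemma keys_sum_add:
  fixes F :: "'a \<Rightarrow> 'b::cancel_comm_monoid_add \<Rightarrow> 'c::comm_monoid_add"
  assumes "\<And>m. F m 0 = 0" "\<And>m a b. F m (a + b) = F m a + F m b"
  shows "(\<Sum>m\<in>mkeys (p + q). F m (mlookup (p + q) m)) =
         (\<Sum>m\<in>mkeys p. F m (mlookup p m)) + (\<Sum>m\<in>mkeys q. F m (mlookup q m))"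
proof -
  let ?K = "mkeys p \<union> mkeys q"
  have "(\<Sum>m\<in>mkeys r. F m (mlookup r m)) = (\<Sum>m\<in>?K. F m (mlookup r m))" if "mkeys r \<subseteq> ?K" for r
    using that by (intro sum.mono_neutral_left) (auto simp: in_keys_iff assms(1))
  from this[of p] this[of q] this[of "p + q"] show ?thesis
    by (simp add: Poly_Mapping.keys_add lookup_add assms(2) sum.distrib)
qed

lemma poly_mapping_eq_sum: "(p :: 'a \<Rightarrow>\<^sub>0 'b::comm_monoid_add) = (\<Sum>m\<in>mkeys p. msingle m (mlookup p m))"
proof (rule poly_mapping_eqI)
  fix k
  have "mlookup (\<Sum>m\<in>K. msingle m (mlookup p m)) k = (if k \<in> K then mlookup p k else 0)"
    if "finite K" for K
    using that by (induction K rule: finite_induct) (auto simp: lookup_add lookup_single when_def)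
  then show "mlookup p k = mlookup (\<Sum>m\<in>mkeys p. msingle m (mlookup p m)) k"
    by (simp add: in_keys_iff)
qed

lemma sum_closed_induct:
  assumes "finite K" "P 0" "\<And>p q. P p \<Longrightarrow> P q \<Longrightarrow> P (p + q)" "\<And>k. k \<in> K \<Longrightarrow> P (f k)"
  shows "P (sum f K)"
  using assms(1,4) by (induction K rule: finite_induct) (auto intro: assms)

lemma mp_induct [case_names single add]:
  fixes P :: "('a \<Rightarrow>\<^sub>0 'b::comm_monoid_add) \<Rightarrow> bool"
  assumes "\<And>m c. P (msingle m c)" "\<And>p q. P p \<Longrightarrow> P q \<Longrightarrow> P (p + q)"
  shows "P p"
  by (subst poly_mapping_eq_sum[of p], rule sum_closed_induct)
     (use assms(1)[of undefined 0] assms in \<open>auto\<close>)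

lemma Var_mult_single: "Var i * msingle m c = msingle (msingle i 1 + m) c"
  by (simp add: Var_def mult_single)

lemma exponent_split:
  assumes "i \<in> mkeys (m :: nat \<Rightarrow>\<^sub>0 nat)"
  shows "m = msingle i 1 + (m - msingle i 1)"
  using assms by (intro poly_mapping_eqI) (auto simp: lookup_add lookup_minus lookup_single when_def in_keys_iff)

lemma inS_0 [simp]: "inS 0" and inS_1 [simp]: "inS 1" and inS_Const [simp]: "inS (Const c)"
  and inS_Var [simp]: "i < 3 \<Longrightarrow> inS (Var i)"
  by (auto simp: inS_def Const_def Var_def simp flip: single_one)

lemma inS_add [intro, simp]: "inS p \<Longrightarrow> inS q \<Longrightarrow> inS (p + q)"
  using Poly_Mapping.keys_add[of p q] unfolding inS_def by blast

lemma inS_uminus [simp]: "inS (- p) \<longleftrightarrow> inS p"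
  by (simp add: inS_def)

lemma inS_diff [intro, simp]: "inS p \<Longrightarrow> inS q \<Longrightarrow> inS (p - q)"
  using inS_add[of p "- q"] by simp

lemma inS_mult [intro, simp]: "inS p \<Longrightarrow> inS q \<Longrightarrow> inS (p * q)"
  using Poly_Mapping.keys_mult[of p q] unfolding inS_def
  by (smt (verit, ccfv_threshold) Un_subset_iff mem_Collect_eq mkeys_add_nat subsetD)

lemma inS_power [intro, simp]: "inS p \<Longrightarrow> inS (p ^ n)"
  by (induction n) auto

lemma inS_sum [intro]: "(\<And>i. i \<in> K \<Longrightarrow> inS (f i)) \<Longrightarrow> inS (sum f K)"
  by (induction K rule: infinite_finite_induct) auto

lemma inS_of_nat [simp]: "inS (of_nat n)"
  by (induction n) auto

lemma inS_numeral [simp]: "inS (numeral n)"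
  using inS_of_nat[of "numeral n"] by simp

lemma homog_0 [simp]: "homog d 0" and homog_Const [simp]: "homog 0 (Const c)"
  and homog_Var [simp]: "homog (Suc 0) (Var i)"
  by (auto simp: homog_mdeg Const_def Var_def)

lemma homog_1 [simp]: "homog 0 1"
  by (auto simp: homog_mdeg simp flip: single_one)

lemma homog_add [intro]: "homog d p \<Longrightarrow> homog d q \<Longrightarrow> homog d (p + q)"
  using Poly_Mapping.keys_add[of p q] unfolding homog_def by blast

lemma homog_uminus [simp]: "homog d (- p) \<longleftrightarrow> homog d p"
  by (simp add: homog_def)

lemma homog_diff [intro]: "homog d p \<Longrightarrow> homog d q \<Longrightarrow> homog d (p - q)"
  using homog_add[of d p "- q"] by simp

lemma homog_mult: "homog d p \<Longrightarrow> homog e q \<Longrightarrow> homog (d + e) (p * q)"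
  using Poly_Mapping.keys_mult[of p q] unfolding homog_mdeg by (force simp: mdeg_add)

lemma homog_mult_eq: "homog d p \<Longrightarrow> homog e q \<Longrightarrow> n = d + e \<Longrightarrow> homog n (p * q)"
  by (simp add: homog_mult)

lemma homog_power: "homog d p \<Longrightarrow> homog (n * d) (p ^ n)"
  by (induction n) (auto intro: homog_mult)

lemma homog_Const_mult: "homog d p \<Longrightarrow> homog d (Const c * p)"
  using homog_mult[OF homog_Const] by simp

lemma homog_sum: "(\<And>i. i \<in> K \<Longrightarrow> homog d (f i)) \<Longrightarrow> homog d (sum f K)"
  by (induction K rule: infinite_finite_induct) auto

text \<open>A form is built up by multiplying by one variable at a time. The degree is an argument
  of \<open>P\<close> because it grows at each such step, and \<open>zero\<close> asks for all
  degrees because 0 is a form of every degree.\<close>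

lemma hom_induct [consumes 2, case_names zero Const Var add]:
  assumes "inS p" "homog d p"
    and zero: "\<And>d. P d 0" and Const: "\<And>c. P 0 (Const c)"
    and Var: "\<And>d p i. i < 3 \<Longrightarrow> inS p \<Longrightarrow> homog d p \<Longrightarrow> P d p \<Longrightarrow> P (Suc d) (Var i * p)"
    and add: "\<And>d p q. P d p \<Longrightarrow> P d q \<Longrightarrow> P d (p + q)"
  shows "P d p"
proof -
  have single: "P (mdeg m) (msingle m c)" if "mkeys m \<subseteq> {0,1,2}" for m c
    using that
  proof (induction "mdeg m" arbitrary: m)
    case 0
    then have "m = 0"
      by (intro poly_mapping_eqI) (simp add: mdeg_def in_keys_iff)
    then show ?case using Const[of c] by (simp add: Const_def)
  next
    case (Suc d)
    then obtain i where i: "i \<in> mkeys m" unfolding mdeg_def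
      by (metis Zero_not_Suc sum.empty all_not_in_conv)
    define m' where "m' = m - msingle i 1"
    have m: "m = msingle i 1 + m'" using exponent_split[OF i] by (simp add: m'_def)
    then have d: "d = mdeg m'" using Suc(2) mdeg_add[of "msingle i 1" m'] by simp
    have sub: "mkeys m' \<subseteq> {0,1,2}" using Suc(3) m mkeys_add_nat by blast
    have "P (Suc d) (Var i * msingle m' c)"
      using Suc(1)[OF d sub] d sub i Suc(3)
      by (intro Var) (auto simp: inS_def homog_mdeg)
    then have "P (Suc d) (msingle m c)" unfolding Var_mult_single m[symmetric] .
    then show ?case using Suc(2) by simp
  qed
  show ?thesis
    by (subst poly_mapping_eq_sum[of p], rule sum_closed_induct[where P = "P d"])
       (use single assms(1,2) in \<open>auto simp: inS_def homog_mdeg intro: zero add\<close>)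
qed

lemma inS_induct [consumes 1, case_names Const Var add]:
  assumes "inS p" and Const: "\<And>c. P (Const c)"
    and Var: "\<And>p i. i < 3 \<Longrightarrow> inS p \<Longrightarrow> P p \<Longrightarrow> P (Var i * p)"
    and add: "\<And>p q. inS p \<Longrightarrow> inS q \<Longrightarrow> P p \<Longrightarrow> P q \<Longrightarrow> P (p + q)"
  shows "P p"
proof -
  have P0: "P 0" using Const[of 0] by (simp add: Const_def)
  have single: "P (msingle m c) \<and> inS (msingle m c)" if m: "m \<in> mkeys p" for m c
  proof -
    have S: "inS (msingle m c)" using assms(1) m by (auto simp: inS_def)
    then have "inS (msingle m c) \<and> P (msingle m c)"
      by (rule hom_induct[where d = "mdeg m" and P = "\<lambda>_ q. inS q \<and> P q"])
         (auto simp: homog_mdeg P0 Const Var add split: if_splits)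
    then show ?thesis by blast
  qed
  have "inS p \<and> P p"
    by (subst (1 2) poly_mapping_eq_sum[of p], rule sum_closed_induct[where P = "\<lambda>q. inS q \<and> P q"])
       (use single in \<open>auto intro: P0 add\<close>)
  then show ?thesis ..
qed

lemma Const_add: "Const (a + b) = Const a + Const b" by (simp add: Const_def single_add)
lemma Const_mult: "Const (a * b) = Const a * Const b" by (simp add: Const_def mult_single)
lemma Const_0 [simp]: "Const 0 = 0" and Const_1 [simp]: "Const 1 = 1" by (simp_all add: Const_def)
lemma Const_uminus: "Const (- a) = - Const a" by (simp add: Const_def single_uminus)
lemma Const_of_nat: "Const (of_nat n) = of_nat n" by (simp add: Const_def)
lemma Const_eq_0_iff [simp]: "Const c = 0 \<longleftrightarrow> c = 0"
  by (metis Const_def Const_0 lookup_single_eq lookup_zero)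

section \<open>Evaluation at points and along polynomial curves\<close>

locale coeff_hom =
  fixes h :: "complex \<Rightarrow> 'r::comm_ring_1"
  assumes h0: "h 0 = 0" and h1: "h 1 = 1" and hadd: "h (a + b) = h a + h b"
    and hmult: "h (a * b) = h a * h b"
begin

definition aev :: "(nat \<Rightarrow> 'r) \<Rightarrow> mpoly \<Rightarrow> 'r" where
  "aev g p = (\<Sum>m\<in>mkeys p. h (mlookup p m) * (\<Prod>i\<in>mkeys m. g i ^ mlookup m i))"

lemma aev_add: "aev g (p + q) = aev g p + aev g q"
  unfolding aev_def by (rule keys_sum_add) (auto simp: h0 hadd algebra_simps)

lemma aev_single: "aev g (msingle m c) = h c * (\<Prod>i\<in>mkeys m. g i ^ mlookup m i)"
  by (simp add: aev_def h0)

lemma prod_superset: "finite K \<Longrightarrow> mkeys m \<subseteq> K \<Longrightarrow>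
    (\<Prod>i\<in>mkeys m. g i ^ mlookup m i) = (\<Prod>i\<in>K. (g i :: 'r) ^ mlookup m i)"
  by (intro prod.mono_neutral_left) (auto simp: in_keys_iff)

lemma aev_mult: "aev g (p * q) = aev g p * aev g q"
proof (induction p rule: mp_induct)
  case (single m c)
  show ?case
  proof (induction q rule: mp_induct)
    case (single m' c')
    let ?K = "mkeys m \<union> mkeys m'"
    have "(\<Prod>i\<in>mkeys m. g i ^ mlookup m i) = (\<Prod>i\<in>?K. g i ^ mlookup m i)"
      "(\<Prod>i\<in>mkeys m'. g i ^ mlookup m' i) = (\<Prod>i\<in>?K. g i ^ mlookup m' i)"
      by (rule prod_superset; simp)+
    then show ?case
      by (simp add: mult_single aev_single mkeys_add_nat lookup_add power_add prod.distrib hmult mult_ac Un_commute)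
  qed (simp add: aev_add algebra_simps)
qed (simp add: aev_add algebra_simps)

lemma aev_Const: "aev g (Const c) = h c"
  by (simp add: Const_def aev_single)

lemma aev_Var: "aev g (Var i) = g i"
  by (simp add: Var_def aev_single h1)

lemma aev_0: "aev g 0 = 0" and aev_1: "aev g 1 = 1"
  using aev_Const[of g 0] aev_Const[of g 1] by (simp_all add: h0 h1)

lemma aev_uminus: "aev g (- p) = - aev g p"
  using aev_add[of g p "- p"] by (simp add: aev_0 eq_neg_iff_add_eq_0 add.commute)

lemma aev_diff: "aev g (p - q) = aev g p - aev g q"
  using aev_add[of g p "- q"] by (simp add: aev_uminus)

lemma aev_power: "aev g (p ^ n) = aev g p ^ n"
  by (induction n) (auto simp: aev_1 aev_mult)

lemma aev_sum: "aev g (sum f K) = (\<Sum>i\<in>K. aev g (f i))"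
  by (induction K rule: infinite_finite_induct) (auto simp: aev_0 aev_add)

lemma aev_prod: "aev g (prod f K) = (\<Prod>i\<in>K. aev g (f i))"
  by (induction K rule: infinite_finite_induct) (auto simp: aev_1 aev_mult)

lemma aev_of_nat: "aev g (of_nat n) = of_nat n"
  by (induction n) (auto simp: aev_0 aev_add aev_1)

lemma aev_numeral: "aev g (numeral n) = numeral n"
  using aev_of_nat[of g "numeral n"] by simp

lemmas aev_simps = aev_numeral aev_add aev_mult aev_Const aev_Var aev_0 aev_1 aev_uminus aev_diff aev_power
  aev_sum aev_prod aev_of_nat

end

interpretation EV: coeff_hom "\<lambda>c::complex. c" by standard auto
interpretation PEV: coeff_hom "\<lambda>c::complex. [:c:]" by standard (auto simp: one_pCons)

abbreviation ev :: "(nat \<Rightarrow> complex) \<Rightarrow> mpoly \<Rightarrow> complex" where "ev \<equiv> EV.aev"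
abbreviation pev :: "(nat \<Rightarrow> complex poly) \<Rightarrow> mpoly \<Rightarrow> complex poly" where "pev \<equiv> PEV.aev"

lemmas ev_simps [simp] = EV.aev_simps
lemmas pev_simps [simp] = PEV.aev_simps

lemma mp_eval_ev: "mp_eval p v = ev (coord v) p"
  by (simp add: mp_eval_def EV.aev_def)

lemma poly_pev: "inS p \<Longrightarrow> poly (pev \<phi> p) t = ev (\<lambda>i. poly (\<phi> i) t) p"
  by (induction p rule: inS_induct) auto

lemma ev_cong: "inS p \<Longrightarrow> (\<And>i. i < 3 \<Longrightarrow> x i = y i) \<Longrightarrow> ev x p = ev y p"
  by (induction p rule: inS_induct) auto

lemma ev_scale: "inS p \<Longrightarrow> homog d p \<Longrightarrow> ev (\<lambda>i. c * x i) p = c ^ d * ev x p"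
  by (induction d p rule: hom_induct) (auto simp: algebra_simps)

lemma degree_pev:
  assumes "inS p" "homog d p" "\<And>i. i < 3 \<Longrightarrow> degree (\<phi> i) \<le> k"
  shows "degree (pev \<phi> p) \<le> k * d"
  using assms(1,2)
proof (induction d p rule: hom_induct)
  case (Var d p i)
  then have "degree (\<phi> i * pev \<phi> p) \<le> k + k * d"
    by (intro order.trans[OF degree_mult_le] add_mono assms)
  then show ?case by simp
qed (auto intro: degree_add_le)

section \<open>Partial derivatives, the Euler relation and homogeneous components\<close>

lemma pd_add: "pd i (p + q) = pd i p + pd i q"
  unfolding pd_def by (rule keys_sum_add) (auto simp: algebra_simps single_add)

lemma pd_single: "pd i (msingle m c) = msingle (m - msingle i 1) (of_nat (mlookup m i) * c)"
  by (simp add: pd_def)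

lemma pd_mult: "pd i (p * q) = pd i p * q + p * pd i q"
proof (induction p rule: mp_induct)
  case (single m c)
  show ?case
  proof (induction q rule: mp_induct)
    case (single m' c')
    \<comment> \<open>Subtraction of exponents is truncated when \<open>i\<close> does not occur in
      \<open>n\<close>; in that case the coefficient \<open>mlookup n i\<close> is 0 and the
      identity still holds.\<close>
    have *: "msingle (n + n' - msingle i 1) (of_nat (mlookup n i) * a) =
             msingle (n - msingle i 1 + n') (of_nat (mlookup n i) * a)" for n n' :: "nat \<Rightarrow>\<^sub>0 nat" and a :: complex
    proof (cases "mlookup n i = 0")
      case False
      then have "n + n' - msingle i 1 = n - msingle i 1 + n'"
        by (intro poly_mapping_eqI) (auto simp: lookup_add lookup_minus lookup_single when_def)
      then show ?thesis by simp
    qed simp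
    show ?case
      using *[of m m' "c * c'"] *[of m' m "c * c'"]
      by (simp add: mult_single pd_single lookup_add algebra_simps single_add)
  qed (simp add: pd_add algebra_simps)
qed (simp add: pd_add algebra_simps)

lemma pd_Const [simp]: "pd i (Const c) = 0"
  by (simp add: Const_def pd_single)

lemma pd_Var: "pd i (Var k) = (if i = k then 1 else 0)"
  by (auto simp: Var_def pd_single lookup_single)

lemma pd_0 [simp]: "pd i 0 = 0" and pd_1 [simp]: "pd i 1 = 0"
  using pd_Const[of i 0] pd_Const[of i 1] by (simp_all del: pd_Const)

lemma pd_numeral [simp]: "pd i (numeral n) = 0"
  using pd_Const[of i "of_nat (numeral n)"] unfolding Const_of_nat by simp

lemma pd_uminus: "pd i (- p) = - pd i p"
  using pd_add[of i p "- p"] by (simp add: eq_neg_iff_add_eq_0 add.commute)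

lemma pd_diff: "pd i (p - q) = pd i p - pd i q"
  using pd_add[of i p "- q"] by (simp add: pd_uminus)

lemma inS_pd [intro, simp]: assumes "inS p" "i < 3" shows "inS (pd i p)"
  using assms(1) by (induction p rule: inS_induct) (auto simp: pd_add pd_mult pd_Var)

lemma homog_pd: assumes "inS p" "homog d p" "i < 3" shows "homog (d - 1) (pd i p)"
proof -
  \<comment> \<open>For d = 0 the truncated degree \<open>d - 1\<close> is again 0, so the induction
    needs the stronger fact that constants have derivative 0.\<close>
  have "homog (d - 1) (pd i p) \<and> (d = 0 \<longrightarrow> pd i p = 0)"
    using assms(1,2)
  proof (induction d p rule: hom_induct)
    case (Var d p k)
    have "homog d (Var k * pd i p)"
    proof (cases d)
      case (Suc n)
      with Var show ?thesis using homog_mult[of "Suc 0" "Var k" n "pd i p"] by simp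
    qed (use Var in auto)
    with Var show ?case by (auto simp: pd_mult pd_Var)
  qed (auto simp: pd_add)
  then show ?thesis ..
qed

lemma euler: assumes "inS p" "homog d p"
  shows "(\<Sum>i<3. Var i * pd i p) = of_nat d * p"
  using assms
proof (induction d p rule: hom_induct)
  case (Var d p k)
  have "Var i * pd i (Var k * p) = (if i = k then Var i * p else 0) + Var k * (Var i * pd i p)" for i
    by (simp add: pd_mult pd_Var algebra_simps)
  then have "(\<Sum>i<3. Var i * pd i (Var k * p)) = (\<Sum>i<3. if i = k then Var i * p else 0) + Var k * (\<Sum>i<3. Var i * pd i p)"
    unfolding sum_distrib_left sum.distrib[symmetric] by (intro sum.cong) auto
  also have "\<dots> = of_nat (Suc d) * (Var k * p)"
    using Var by (simp add: algebra_simps)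
  finally show ?case .
qed (auto simp: pd_add algebra_simps sum.distrib)

lemma pderiv_pev: "inS p \<Longrightarrow> pderiv (pev \<phi> p) = (\<Sum>i<3. pev \<phi> (pd i p) * pderiv (\<phi> i))"
proof (induction p rule: inS_induct)
  case (Var p k)
  have "pev \<phi> (pd i (Var k * p)) = (if i = k then pev \<phi> p else 0) + \<phi> k * pev \<phi> (pd i p)" for i
    by (simp add: pd_mult pd_Var)
  then have "(\<Sum>i<3. pev \<phi> (pd i (Var k * p)) * pderiv (\<phi> i)) =
     (\<Sum>i<3. if i = k then pev \<phi> p * pderiv (\<phi> i) else 0) + \<phi> k * (\<Sum>i<3. pev \<phi> (pd i p) * pderiv (\<phi> i))"
    unfolding sum_distrib_left sum.distrib[symmetric] by (intro sum.cong) (auto simp: algebra_simps)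
  then show ?case using Var by (simp add: pderiv_mult algebra_simps)
qed (auto simp: pd_add pderiv_add algebra_simps sum.distrib)

definition hcomp :: "nat \<Rightarrow> mpoly \<Rightarrow> mpoly" where
  "hcomp d p = (\<Sum>m\<in>mkeys p. if mdeg m = d then msingle m (mlookup p m) else 0)"

lemma hcomp_add: "hcomp d (p + q) = hcomp d p + hcomp d q"
  unfolding hcomp_def by (rule keys_sum_add) (auto simp: single_add)

lemma hcomp_0 [simp]: "hcomp d 0 = 0" by (simp add: hcomp_def)

lemma hcomp_sum: "hcomp d (sum f K) = (\<Sum>k\<in>K. hcomp d (f k))"
  by (induction K rule: infinite_finite_induct) (auto simp: hcomp_add)

lemma homog_hcomp [simp]: "homog d (hcomp d p)"
  unfolding hcomp_def by (rule homog_sum) (auto simp: homog_mdeg)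

lemma inS_hcomp [simp]: "inS p \<Longrightarrow> inS (hcomp d p)"
  unfolding hcomp_def by (rule inS_sum) (auto simp: inS_def)

lemma hcomp_homog: "homog e p \<Longrightarrow> hcomp d p = (if d = e then p else 0)"
  unfolding hcomp_def homog_mdeg by (auto intro: sum.neutral simp flip: poly_mapping_eq_sum)

lemma hcomp_decomp: obtains N where "\<And>n. N \<le> n \<Longrightarrow> (\<Sum>d\<le>n. hcomp d p) = p"
    "\<And>n. N \<le> n \<Longrightarrow> hcomp n p = 0"
proof
  define N where "N = Suc (\<Sum>m\<in>mkeys p. mdeg m)"
  have mN: "mdeg m < N" if "m \<in> mkeys p" for m
    using that member_le_sum[of m "mkeys p" mdeg] by (auto simp: N_def less_Suc_eq_le)
  fix n assume "N \<le> n"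
  then have "(\<Sum>d\<le>n. if mdeg m = d then f else 0) = f" if "m \<in> mkeys p" for m and f :: mpoly
    using mN[OF that] by (simp add: sum.delta)
  then show "(\<Sum>d\<le>n. hcomp d p) = p"
    unfolding hcomp_def by (subst sum.swap) (simp flip: poly_mapping_eq_sum)
  show "hcomp n p = 0"
    unfolding hcomp_def using mN \<open>N \<le> n\<close> by (fastforce intro!: sum.neutral)
qed

lemma hcomp_mult: assumes "homog k q"
  shows "hcomp n (p * q) = (if k \<le> n then hcomp (n - k) p * q else 0)"
proof -
  obtain N where N: "\<And>n. N \<le> n \<Longrightarrow> (\<Sum>d\<le>n. hcomp d p) = p"
    using hcomp_decomp by blast
  define M where "M = max N n"
  have "p * q = (\<Sum>d\<le>M. hcomp d p * q)"
    using N[of M] by (simp add: M_def flip: sum_distrib_right)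
  then have "hcomp n (p * q) = (\<Sum>d\<le>M. if n = d + k then hcomp d p * q else 0)"
    by (simp add: hcomp_sum hcomp_homog[OF homog_mult[OF homog_hcomp assms]])
  also have "\<dots> = (\<Sum>d\<le>M. if d = n - k then (if k \<le> n then hcomp (n - k) p * q else 0) else 0)"
    by (intro sum.cong) auto
  also have "\<dots> = (if k \<le> n then hcomp (n - k) p * q else 0)"
    by (auto simp: M_def)
  finally show ?thesis .
qed

section \<open>Rational parametrizations of lines and conics\<close>

lemma sum_3: "sum f {..<3::nat} = f 0 + f 1 + f (2::nat)"
  by (simp add: numeral_3_eq_3 numeral_2_eq_2)

lemma less_3_cases: "i < (3::nat) \<longleftrightarrow> i = 0 \<or> i = 1 \<or> i = 2"
  by auto

definition lf :: "(nat \<Rightarrow> complex) \<Rightarrow> mpoly" where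
  "lf X = (\<Sum>i<3. Const (X i) * Var i)"

lemma inS_lf [simp]: "inS (lf X)"
  unfolding lf_def by (intro inS_sum) auto

lemma homog_lf [simp]: "homog (Suc 0) (lf X)"
  unfolding lf_def by (intro homog_sum homog_Const_mult homog_Var)

lemma pd_lf: "i < 3 \<Longrightarrow> pd i (lf X) = Const (X i)"
  by (auto simp: lf_def sum_3 pd_add pd_mult pd_Var less_3_cases)

definition dot :: "(nat \<Rightarrow> 'a::comm_ring_1) \<Rightarrow> (nat \<Rightarrow> 'a) \<Rightarrow> 'a" where
  "dot u v = (\<Sum>i<3. u i * v i)"

lemma ev_lf [simp]: "ev x (lf X) = dot X x"
  by (simp add: lf_def dot_def)

definition cr :: "(nat \<Rightarrow> 'a::comm_ring_1) \<Rightarrow> (nat \<Rightarrow> 'a) \<Rightarrow> nat \<Rightarrow> 'a" where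
  "cr u v i = (if i = 0 then u 1 * v 2 - u 2 * v 1 else if i = 1 then u 2 * v 0 - u 0 * v 2
     else u 0 * v 1 - u 1 * v 0)"

lemma coeff_mult_top:
  assumes "degree p \<le> a" "degree q \<le> b"
  shows "coeff (p * q) (a + b) = coeff p a * (coeff q b :: 'a::comm_semiring_0)"
proof -
  have "coeff (p * q) (a + b) = (\<Sum>i\<le>a + b. if i = a then coeff p a * coeff q b else 0)"
    unfolding coeff_mult
  proof (intro sum.cong refl)
    fix i assume "i \<in> {..a + b}"
    then consider "i = a" | "i < a" "b < a + b - i" | "a < i" by (auto simp: not_less) linarith
    then show "coeff p i * coeff q (a + b - i) = (if i = a then coeff p a * coeff q b else 0)"
      using assms by cases (auto simp: coeff_eq_0)
  qed
  then show ?thesis by simp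
qed

section \<open>Parametrized lines and conics in adapted coordinates\<close>

definition homogenize :: "mpoly \<Rightarrow> mpoly \<Rightarrow> nat \<Rightarrow> complex poly \<Rightarrow> mpoly" where
  "homogenize x y N g = (\<Sum>i\<le>N. Const (coeff g i) * x ^ (N - i) * y ^ i)"

lemma homogenize_add: "homogenize x y N (f + g) = homogenize x y N f + homogenize x y N g"
  by (simp add: homogenize_def Const_add algebra_simps sum.distrib)

lemma homogenize_smult: "homogenize x y N (smult c g) = Const c * homogenize x y N g"
  by (simp add: homogenize_def Const_mult sum_distrib_left algebra_simps)

lemma homogenize_0 [simp]: "homogenize x y N 0 = 0"
  by (simp add: homogenize_def)

lemma homogenize_Suc:
  assumes "degree g \<le> N"
  shows "homogenize x y (Suc N) g = x * homogenize x y N g"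
proof -
  have "coeff g (Suc N) = 0" using assms by (simp add: coeff_eq_0)
  then show ?thesis
    by (auto simp: homogenize_def sum_distrib_left Suc_diff_le algebra_simps intro!: sum.cong)
qed

lemma homogenize_pCons: "homogenize x y (Suc N) (pCons 0 g) = y * homogenize x y N g"
  unfolding homogenize_def
  by (subst sum.atMost_Suc_shift) (simp add: sum_distrib_left algebra_simps)

lemma homogenize_monom_mult:
  "homogenize x y (N + m) ([:0, 1:] ^ m * g) = y ^ m * homogenize x y N g"
  by (induction m) (simp_all add: homogenize_pCons mult.assoc)

lemma inS_homogenize [simp]: "inS x \<Longrightarrow> inS y \<Longrightarrow> inS (homogenize x y N g)"
  unfolding homogenize_def by (intro inS_sum) auto

text \<open>\<open>A\<close>, \<open>B\<close>, \<open>C\<close> is a basis of the vector space and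
  \<open>X\<close>, \<open>Y\<close>, \<open>Z\<close> the dual basis of linear forms. Both products
  of the two matrices are recorded, so that no inverse has to be computed.\<close>

locale dual_basis =
  fixes A B C X Y Z :: "nat \<Rightarrow> complex"
  assumes dual: "\<And>i k. i < 3 \<Longrightarrow> k < 3 \<Longrightarrow> A i * X k + B i * Y k + C i * Z k = (if i = k then 1 else 0)"
    and XA: "dot X A = 1" and XB: "dot X B = 0" and XC: "dot X C = 0"
    and YA: "dot Y A = 0" and YB: "dot Y B = 1" and YC: "dot Y C = 0"
    and ZA: "dot Z A = 0" and ZB: "dot Z B = 0" and ZC: "dot Z C = 1"
begin

lemma Var_eq: assumes "i < 3"
  shows "Var i = Const (A i) * lf X + Const (B i) * lf Y + Const (C i) * lf Z"
proof -
  have "Const (A i) * lf X + Const (B i) * lf Y + Const (C i) * lf Z =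
        (\<Sum>k<3. Const (A i * X k + B i * Y k + C i * Z k) * Var k)"
    by (simp add: lf_def sum_distrib_left sum.distrib algebra_simps Const_add Const_mult)
  also have "\<dots> = (\<Sum>k<3. if i = k then Var k else 0)"
    using dual[OF assms] by (intro sum.cong) auto
  finally show ?thesis using assms by simp
qed

lemma covec_eq: assumes "k < 3"
  shows "V k = dot V A * X k + dot V B * Y k + dot V C * Z k"
proof -
  have "dot V A * X k + dot V B * Y k + dot V C * Z k = (\<Sum>i<3. V i * (A i * X k + B i * Y k + C i * Z k))"
    by (simp add: dot_def sum_3 algebra_simps)
  also have "\<dots> = (\<Sum>i<3. if i = k then V i else 0)"
    using dual[OF _ assms] by (intro sum.cong) auto
  finally show ?thesis using assms by simp
qed

end

text \<open>In the coordinates \<open>X\<close>, \<open>Y\<close>, \<open>Z\<close> the component is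
  the line Z = 0 or the conic Y^2 = X Z, parametrized by (1, t, 0) or (1, t, t^2). The point t = 0
  is \<open>A\<close>; infinity is \<open>B\<close> on the line and \<open>C\<close> on the
  conic.\<close>

locale frame = dual_basis A B C X Y Z for A B C X Y Z :: "nat \<Rightarrow> complex" +
  fixes q :: mpoly and r :: nat and \<kappa> :: complex
  assumes \<kappa>: "\<kappa> \<noteq> 0"
    and q_cases: "r = 1 \<and> q = Const \<kappa> * lf Z \<or> r = 2 \<and> q = Const \<kappa> * (lf Y ^ 2 - lf X * lf Z)"
begin

definition phi :: "nat \<Rightarrow> complex poly" where
  "phi i = (if r = 1 then [:A i, B i:] else [:A i, B i, C i:])"

definition infpt :: "nat \<Rightarrow> complex" where
  "infpt = (if r = 1 then B else C)"

text \<open>Along the curve a tangent \<open>U\<close> is w phi' + b phi. The form \<open>X\<close>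
  is 1 on phi and 0 on phi', while \<open>Y\<close> is t on phi and 1 on phi'; applying the two
  forms yields \<open>b\<close> and \<open>w\<close>. The formulas make sense for every
  \<open>U\<close>.\<close>

definition wt :: "(nat \<Rightarrow> complex poly) \<Rightarrow> complex poly" where
  "wt U = dot (\<lambda>i. [:Y i:]) U - [:0, 1:] * dot (\<lambda>i. [:X i:]) U"

definition bt :: "(nat \<Rightarrow> complex poly) \<Rightarrow> complex poly" where
  "bt U = dot (\<lambda>i. [:X i:]) U"

definition tangent :: "(nat \<Rightarrow> complex poly) \<Rightarrow> bool" where
  "tangent U \<longleftrightarrow> (\<Sum>i<3. pev phi (pd i q) * U i) = 0"

lemma inS_q [simp]: "inS q" using q_cases by auto

lemma homog_q: "homog r q"
  using q_cases homog_power[OF homog_lf, of 2 Y] homog_mult[OF homog_lf homog_lf, of X Z]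
  by (auto intro!: homog_Const_mult homog_diff simp: numeral_2_eq_2)

lemma r_le: "r \<le> 2" using q_cases by auto

lemma degree_phi: "degree (phi i) \<le> r"
  using q_cases by (auto simp: phi_def degree_pCons_eq_if numeral_2_eq_2)

lemma pev_lf: "pev phi (lf V) = (if r = 1 then [:dot V A, dot V B:] else [:dot V A, dot V B, dot V C:])"
  by (simp add: lf_def phi_def dot_def sum_3 algebra_simps)

lemma pev_X [simp]: "pev phi (lf X) = 1" and pev_Y: "pev phi (lf Y) = [:0, 1:]"
  by (auto simp: pev_lf XA XB XC YA YB YC one_pCons)

lemma pev_Z: "pev phi (lf Z) = (if r = 1 then 0 else [:0, 0, 1:])"
  by (auto simp: pev_lf ZA ZB ZC)

lemma q_eq: "q = (if r = 1 then Const \<kappa> * lf Z else Const \<kappa> * (lf Y ^ 2 - lf X * lf Z))"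
  using q_cases by auto

lemma pev_q [simp]: "pev phi q = 0"
  using q_cases pev_X pev_Y pev_Z by (auto simp: power2_eq_square simp del: pev_X)

lemma pev_pd_q: assumes "i < 3"
  shows "pev phi (pd i q) = smult \<kappa> (if r = 1 then [:Z i:] else [:- Z i, 2 * Y i, - X i:])"
  using q_cases pev_X pev_Y pev_Z assms
  by (auto simp: pd_mult pd_diff pd_lf power2_eq_square numeral_poly simp del: pev_X)

lemma vec_eq: assumes "i < 3"
  shows "U i = [:A i:] * dot (\<lambda>i. [:X i:]) U + [:B i:] * dot (\<lambda>i. [:Y i:]) U + [:C i:] * dot (\<lambda>i. [:Z i:]) U"
proof -
  have "[:A i:] * dot (\<lambda>i. [:X i:]) U + [:B i:] * dot (\<lambda>i. [:Y i:]) U + [:C i:] * dot (\<lambda>i. [:Z i:]) U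
    = (\<Sum>k<3. [:A i * X k + B i * Y k + C i * Z k:] * U k)"
    by (simp add: dot_def sum_distrib_left sum.distrib algebra_simps smult_add_left)
  also have "\<dots> = (\<Sum>k<3. if i = k then U k else 0)"
    using dual[OF assms] by (intro sum.cong) auto
  finally show ?thesis using assms by simp
qed

lemma tangent_iff:
  "tangent U \<longleftrightarrow> dot (\<lambda>i. [:Z i:]) U = (if r = 1 then 0 else
     [:0, 2:] * dot (\<lambda>i. [:Y i:]) U - [:0, 0, 1:] * dot (\<lambda>i. [:X i:]) U)"
proof -
  have "(\<Sum>i<3. pev phi (pd i q) * U i) = smult \<kappa> (if r = 1 then dot (\<lambda>i. [:Z i:]) U else
     [:0, 2:] * dot (\<lambda>i. [:Y i:]) U - [:0, 0, 1:] * dot (\<lambda>i. [:X i:]) U - dot (\<lambda>i. [:Z i:]) U)"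
    by (simp add: sum_3 pev_pd_q dot_def smult_add_right smult_diff_right algebra_simps)
  then show ?thesis using \<kappa> unfolding tangent_def by (auto simp: algebra_simps)
qed

lemma tangent_decomp: assumes "tangent U" "i < 3"
  shows "U i = wt U * pderiv (phi i) + bt U * phi i"
proof -
  define x y where "x = dot (\<lambda>i. [:X i:]) U" and "y = dot (\<lambda>i. [:Y i:]) U"
  show ?thesis
    using assms(1) vec_eq[OF assms(2), of U] unfolding tangent_iff wt_def bt_def x_def[symmetric] y_def[symmetric]
    by (auto simp: phi_def pderiv_pCons poly_eq_poly_eq_iff[symmetric] fun_eq_iff algebra_simps
        simp del: poly_eq_poly_eq_iff split: if_splits)
qed

lemma degree_const_mult: "degree ([:c:] * p) \<le> degree p" for c :: complex
  by (simp add: degree_smult_le)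

lemma degree_dot: "(\<And>i. i < 3 \<Longrightarrow> degree (U i) \<le> n) \<Longrightarrow> degree (dot (\<lambda>i. [:v i:]) U) \<le> n" for v :: "nat \<Rightarrow> complex"
  unfolding dot_def by (intro degree_sum_le) (auto intro: order.trans[OF degree_const_mult])

lemma degree_wt: assumes "tangent U" "\<And>i. i < 3 \<Longrightarrow> degree (U i) \<le> n"
  shows "degree (wt U) \<le> n + 2 - r"
proof -
  define x y z where "x = dot (\<lambda>i. [:X i:]) U" and "y = dot (\<lambda>i. [:Y i:]) U" and "z = dot (\<lambda>i. [:Z i:]) U"
  have d: "degree x \<le> n" "degree y \<le> n" "degree z \<le> n"
    unfolding x_def y_def z_def by (simp_all add: degree_dot assms(2))
  have pC: "degree (pCons 0 p) \<le> Suc n" if "degree p \<le> n" for p :: "complex poly"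
    using that by (simp add: degree_pCons_eq_if)
  consider "r = 1" | "r = 2" using q_cases by auto
  then show ?thesis
  proof cases
    case 1
    then show ?thesis using d pC[OF d(1)] unfolding wt_def x_def[symmetric] y_def[symmetric]
      by (intro degree_diff_le) auto
  next
    case 2
    \<comment> \<open>The definition of \<open>wt\<close> only bounds its degree by n + 1. Tangency
      to the conic means z = 2 t y - t^2 x, hence t w = z - t y, which saves one degree.\<close>
    have "[:0, 1:] * wt U = z - [:0, 1:] * y"
      using assms(1) 2 unfolding tangent_iff wt_def x_def[symmetric] y_def[symmetric] z_def[symmetric]
      by (simp add: poly_eq_poly_eq_iff[symmetric] fun_eq_iff algebra_simps del: poly_eq_poly_eq_iff)
    moreover have "degree (z - [:0, 1:] * y) \<le> Suc n"
      using d pC[OF d(2)] by (intro degree_diff_le) auto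
    ultimately have "degree (pCons 0 (wt U)) \<le> Suc n" by simp
    then show ?thesis using 2 by (simp add: degree_pCons_eq_if split: if_splits)
  qed
qed

lemma wt_add: "wt (\<lambda>i. U i + V i) = wt U + wt V"
  by (simp add: wt_def dot_def algebra_simps sum.distrib smult_add_right)

lemma wt_mult: "wt (\<lambda>i. g * U i) = g * wt U"
  by (simp add: wt_def dot_def algebra_simps sum_distrib_left)

lemma wt_phi: "wt (\<lambda>i. g * phi i) = 0"
proof -
  have "dot (\<lambda>i. [:Y i:]) phi = [:0, 1:]" "dot (\<lambda>i. [:X i:]) phi = 1"
    using pev_X pev_Y by (simp_all add: lf_def dot_def)
  then show ?thesis by (simp add: wt_mult) (simp add: wt_def)
qed

lemma wt_pderiv_phi: "wt (\<lambda>i. pderiv (phi i)) = 1"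
proof -
  have "dot (\<lambda>i. [:V i:]) (\<lambda>i. pderiv (phi i)) = pderiv (pev phi (lf V))" for V
    by (simp add: lf_def dot_def sum_3 pderiv_add pderiv_smult)
  from this[of X] this[of Y] show ?thesis by (simp add: wt_def pev_Y pderiv_pCons one_pCons)
qed

lemma coeff_pev_top:
  assumes "inS p" "homog d p"
  shows "coeff (pev phi p) (r * d) = ev infpt p"
  using assms
proof (induction d p rule: hom_induct)
  case (Var d p i)
  have "coeff (phi i) r = infpt i"
    using q_cases by (auto simp: phi_def infpt_def numeral_2_eq_2)
  moreover have "degree (pev phi p) \<le> r * d"
    using Var by (intro degree_pev degree_phi) auto
  ultimately show ?case using coeff_mult_top[OF degree_phi[of i], of "pev phi p" "r * d"] Var by simp
qed auto

lemma degree_pev_eq: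
  assumes "inS p" "homog d p" "ev infpt p \<noteq> 0"
  shows "degree (pev phi p) = r * d"
  using coeff_pev_top[OF assms(1,2)] degree_pev[OF assms(1,2), of phi r] degree_phi assms(3)
  by (intro antisym le_degree) auto

text \<open>Modulo \<open>q\<close> every variable times \<open>X\<close> becomes a binary form in
  \<open>X\<close> and \<open>Y\<close>: X Z is Y^2 on the conic and 0 on the line. The degree
  \<open>2 * d\<close> is what the conic needs; on the line it merely produces spare factors
  \<open>X\<close>.\<close>

lemma normal_form:
  assumes "inS p" "homog d p"
  shows "\<exists>K. inS K \<and> lf X ^ d * p = homogenize (lf X) (lf Y) (2 * d) (pev phi p) + q * K"
  using assms
proof (induction d p rule: hom_induct)
  case (zero d)
  show ?case by (intro exI[of _ 0]) simp
next
  case (Const c)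
  show ?case by (intro exI[of _ 0]) (simp add: homogenize_def)
next
  case (add d p q')
  then obtain K K' where "inS K" "inS K'" "lf X ^ d * p = homogenize (lf X) (lf Y) (2 * d) (pev phi p) + q * K"
    "lf X ^ d * q' = homogenize (lf X) (lf Y) (2 * d) (pev phi q') + q * K'" by auto
  then show ?case by (intro exI[of _ "K + K'"]) (simp add: algebra_simps homogenize_add)
next
  case (Var d p i)
  let ?x = "lf X" and ?y = "lf Y" and ?z = "lf Z" and ?g = "pev phi p"
  let ?H = "homogenize ?x ?y"
  obtain K where K: "inS K" "?x ^ d * p = ?H (2 * d) ?g + q * K" using Var by auto
  have deg: "degree ?g \<le> 2 * d"
    using degree_pev[OF Var(2,3), of phi 2] degree_phi r_le by (meson le_trans)
  have \<kappa>': "Const (1 / \<kappa>) * Const \<kappa> = 1"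
    using \<kappa> by (simp flip: Const_mult)
  \<comment> \<open>The coefficient of t^2 in phi is \<open>C i\<close> on the conic and 0 on the
    line, so one formula covers both.\<close>
  define c where "c = coeff (phi i) 2"
  obtain K1 where K1: "inS K1" "?x * Var i = Const (A i) * ?x\<^sup>2 + Const (B i) * ?x * ?y + Const c * ?y\<^sup>2 + q * K1"
  proof (cases "r = 1")
    case True
    then have "q * (Const (1 / \<kappa>) * Const (C i) * ?x) = (Const (1 / \<kappa>) * Const \<kappa>) * (Const (C i) * ?x * ?z)"
      using q_cases by (auto simp: algebra_simps)
    with \<kappa>' have "q * (Const (1 / \<kappa>) * Const (C i) * ?x) = Const (C i) * ?x * ?z" by simp
    moreover have "c = 0" using True phi_def[of i] by (simp add: c_def numeral_2_eq_2)
    ultimately show ?thesis using Var_eq[OF Var(1)]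
      by (intro that[of "Const (1 / \<kappa>) * Const (C i) * ?x"]) (auto simp: algebra_simps power2_eq_square)
  next
    case False
    then have "q * (Const (1 / \<kappa>) * Const (C i)) = (Const (1 / \<kappa>) * Const \<kappa>) * (Const (C i) * (?y\<^sup>2 - ?x * ?z))"
      by (subst q_eq) (simp add: mult_ac)
    with \<kappa>' have "q * (Const (1 / \<kappa>) * Const (C i)) = Const (C i) * (?y\<^sup>2 - ?x * ?z)" by simp
    moreover have "c = C i" using False by (simp add: c_def phi_def numeral_2_eq_2)
    ultimately show ?thesis using Var_eq[OF Var(1)]
      by (intro that[of "- (Const (1 / \<kappa>) * Const (C i))"]) (auto simp: algebra_simps power2_eq_square)
  qed
  have pV: "pev phi (Var i * p) = smult (A i) ?g + (smult (B i) (pCons 0 ?g) + smult c (pCons 0 (pCons 0 ?g)))"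
    by (simp add: c_def phi_def numeral_2_eq_2 algebra_simps)
  have "?H (Suc (Suc (2 * d))) ?g = ?x * (?x * ?H (2 * d) ?g)"
    using deg by (simp add: homogenize_Suc)
  moreover have "?H (Suc (Suc (2 * d))) (pCons 0 ?g) = ?x * (?y * ?H (2 * d) ?g)"
    using deg by (subst homogenize_Suc) (auto simp: homogenize_pCons degree_pCons_eq_if)
  moreover have "?H (Suc (Suc (2 * d))) (pCons 0 (pCons 0 ?g)) = ?y * (?y * ?H (2 * d) ?g)"
    by (simp add: homogenize_pCons)
  ultimately have H: "?H (2 * Suc d) (pev phi (Var i * p)) =
     (Const (A i) * ?x\<^sup>2 + Const (B i) * ?x * ?y + Const c * ?y\<^sup>2) * ?H (2 * d) ?g"
    unfolding pV homogenize_add homogenize_smult mult_Suc_right add_2_eq_Suc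
    by (simp only:) (simp add: algebra_simps power2_eq_square)
  have "?x ^ Suc d * (Var i * p) = (?x * Var i) * (?x ^ d * p)" by (simp add: algebra_simps)
  also have "\<dots> = ?H (2 * Suc d) (pev phi (Var i * p)) + q * (K1 * (?x ^ d * p) + (?x * Var i - q * K1) * K)"
  proof -
    have "u * w = a * H + q * (K1 * w + (u - q * K1) * K)" if "u = a + q * K1" "w = H + q * K"
      for u w a H :: mpoly
      using that by (simp add: algebra_simps)
    from this[OF K1(2) K(2)] show ?thesis unfolding H .
  qed
  finally show ?case
    by (rule exI[of _ "K1 * (?x ^ d * p) + (?x * Var i - q * K1) * K", OF conjI, rotated])
       (use K(1) K1(1) Var(1,2) in simp)
qed

text \<open>The binary form in \<open>normal_form\<close> depends only on the restriction to the
  curve, so only the multiple of \<open>q\<close> survives. The factor \<open>lf X ^ d\<close> is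
  harmless, since \<open>lf X\<close> restricts to 1.\<close>

lemma local_division:
  assumes "inS p" "homog d p" "pev phi p = 0"
  obtains K where "inS K" "lf X ^ d * p = q * K"
  using normal_form[OF assms(1,2)] assms(3) by auto

lemma points_finite:
  assumes "ev v q = 0" "dot X v \<noteq> 0" "i < 3"
  shows "v i = dot X v * poly (phi i) (dot Y v / dot X v)"
proof -
  have "v i = ev v (Var i)" by simp
  also have "\<dots> = A i * dot X v + B i * dot Y v + C i * dot Z v"
    unfolding Var_eq[OF assms(3)] by simp
  finally have v: "v i = A i * dot X v + B i * dot Y v + C i * dot Z v" .
  have "dot Z v = (if r = 1 then 0 else (dot Y v)\<^sup>2 / dot X v)"
    using assms \<kappa> by (subst (asm) q_eq) (auto simp: field_simps power2_eq_square split: if_splits)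
  then show ?thesis
    using v assms(2) by (auto simp: phi_def field_simps power2_eq_square)
qed

lemma points_infinite:
  assumes "ev v q = 0" "dot X v = 0"
  obtains c where "\<And>i. i < 3 \<Longrightarrow> v i = c * infpt i"
proof -
  have "v i = A i * dot X v + B i * dot Y v + C i * dot Z v" if "i < 3" for i
  proof -
    have "v i = ev v (Var i)" by simp
    also have "\<dots> = A i * dot X v + B i * dot Y v + C i * dot Z v"
      unfolding Var_eq[OF that] by simp
    finally show ?thesis .
  qed
  then have "v i = (if r = 1 then dot Y v else dot Z v) * infpt i" if "i < 3" for i
    using q_cases assms \<kappa> that by (auto simp: infpt_def)
  then show ?thesis by (rule that)
qed

end

section \<open>Cross products, quadratic forms and the existence of adapted coordinates\<close>

lemma ex_less_3: "(\<exists>i<3::nat. P i) \<longleftrightarrow> P 0 \<or> P 1 \<or> P 2"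
  using less_3_cases by metis

definition nonpar :: "(nat \<Rightarrow> complex) \<Rightarrow> (nat \<Rightarrow> complex) \<Rightarrow> bool" where
  "nonpar u v \<longleftrightarrow> (\<exists>i<3. cr u v i \<noteq> 0)"

definition nz :: "(nat \<Rightarrow> complex) \<Rightarrow> bool" where
  "nz v \<longleftrightarrow> (\<exists>i<3. v i \<noteq> 0)"

lemma nonpar_iff: "nonpar u v \<longleftrightarrow> u 1 * v 2 \<noteq> u 2 * v 1 \<or> u 2 * v 0 \<noteq> u 0 * v 2 \<or> u 0 * v 1 \<noteq> u 1 * v 0"
  by (simp add: nonpar_def ex_less_3 cr_def)

lemma nz_iff: "nz v \<longleftrightarrow> v 0 \<noteq> 0 \<or> v 1 \<noteq> 0 \<or> v 2 \<noteq> 0"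
  by (simp add: nz_def ex_less_3)

lemma not_nonpar: assumes "nz u" "\<not> nonpar u v" obtains c where "\<And>i. i < 3 \<Longrightarrow> v i = c * u i"
proof -
  obtain k where k: "k < 3" "u k \<noteq> 0" using assms(1) by (auto simp: nz_def)
  have "u i * v k = u k * v i" if "i < 3" for i
    using assms(2) that k(1) by (auto simp: nonpar_iff less_3_cases)
  then have "v i = (v k / u k) * u i" if "i < 3" for i
    using that k by (simp add: field_simps)
  then show ?thesis by (rule that)
qed

lemma nonpar_nz: "nonpar u v \<Longrightarrow> nz u" "nonpar u v \<Longrightarrow> nz v"
  by (auto simp: nonpar_iff nz_iff)

lemma nonpar_choose: assumes "nonpar u v" "nz w" shows "nonpar w u \<or> nonpar w v"
proof (rule ccontr)
  assume "\<not> ?thesis"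
  then obtain c d where "\<And>i. i < 3 \<Longrightarrow> u i = c * w i" "\<And>i. i < 3 \<Longrightarrow> v i = d * w i"
    using not_nonpar[OF assms(2)] by metis
  then show False using assms(1) by (auto simp: nonpar_iff)
qed

lemma orthogonal_multiple:
  assumes "nonpar u v" "dot g u = 0" "dot g v = 0"
  obtains c where "\<And>i. i < 3 \<Longrightarrow> g i = c * cr u v i"
proof -
  have "nz (cr u v)" using assms(1) by (auto simp: nonpar_def nz_def)
  moreover have "\<not> nonpar (cr u v) g"
    using assms(2,3) unfolding nonpar_iff by (simp add: cr_def dot_def sum_3) algebra
  ultimately show ?thesis using that not_nonpar by metis
qed

lemma dual_basis_exists:
  assumes "dot (cr A B) C \<noteq> 0"
  obtains X Y Z where "dual_basis A B C X Y Z"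
proof -
  define d where "d = dot (cr A B) C"
  have d: "d \<noteq> 0" using assms by (simp add: d_def)
  have d': "d = (A 1 * B 2 - A 2 * B 1) * C 0 + (A 2 * B 0 - A 0 * B 2) * C 1 + (A 0 * B 1 - A 1 * B 0) * C 2"
    by (simp add: d_def dot_def sum_3 cr_def)
  \<comment> \<open>Cramer's rule: the dual forms are cross products divided by the
    determinant.\<close>
  have "dual_basis A B C (\<lambda>i. cr B C i / d) (\<lambda>i. cr C A i / d) (\<lambda>i. cr A B i / d)"
  proof
    show "A i * (cr B C k / d) + B i * (cr C A k / d) + C i * (cr A B k / d) = (if i = k then 1 else 0)"
      if "i < 3" "k < 3" for i k
    proof -
      have "A i * cr B C k + B i * cr C A k + C i * cr A B k = (if i = k then d else 0)"
        using that unfolding d' less_3_cases by (auto simp: cr_def algebra_simps)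
      then show ?thesis using d by (simp add: field_simps split: if_splits)
    qed
  qed (use d in \<open>simp_all add: dot_def sum_3 cr_def divide_simps\<close>, (simp add: d' algebra_simps)+)
  then show ?thesis by (rule that)
qed

text \<open>The three degrees are treated together because the induction reaches each degree from
  the one below.\<close>

lemma homog_low:
  assumes "inS p" "homog d p"
  shows "(d = 0 \<longrightarrow> (\<exists>c. p = Const c)) \<and> (d = 1 \<longrightarrow> (\<exists>N. p = lf N)) \<and>
         (d = 2 \<longrightarrow> (\<exists>M. p = (\<Sum>i<3. \<Sum>k<3. Const (M i k) * Var i * Var k)))"
  using assms
proof (induction d p rule: hom_induct)
  case (zero d)
  show ?case
    by (intro conjI impI exI[of _ 0] exI[of _ "\<lambda>_. 0"] exI[of _ "\<lambda>_ _. 0"]) (simp_all add: lf_def)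
next
  case (Const c)
  then show ?case by auto
next
  case (add d p q)
  have "\<exists>c. p + q = Const c" if "d = 0"
    using add that Const_add by metis
  moreover have "\<exists>N. p + q = lf N" if d: "d = 1"
  proof -
    obtain N N' where "p = lf N" "q = lf N'" using add d by auto
    then have "p + q = lf (\<lambda>i. N i + N' i)" by (simp add: lf_def Const_add algebra_simps sum.distrib)
    then show ?thesis by blast
  qed
  moreover have "\<exists>M. p + q = (\<Sum>i<3. \<Sum>k<3. Const (M i k) * Var i * Var k)" if d: "d = 2"
  proof -
    obtain M M' where "p = (\<Sum>i<3. \<Sum>k<3. Const (M i k) * Var i * Var k)"
      "q = (\<Sum>i<3. \<Sum>k<3. Const (M' i k) * Var i * Var k)" using add d by auto
    then have "p + q = (\<Sum>i<3. \<Sum>k<3. Const (M i k + M' i k) * Var i * Var k)"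
      by (simp add: Const_add algebra_simps sum.distrib)
    then show ?thesis by (rule exI[of _ "\<lambda>i k. M i k + M' i k"])
  qed
  ultimately show ?case by blast
next
  case (Var d p i)
  have "\<exists>N. Var i * p = lf N" if d: "d = 0"
  proof -
    obtain c where "p = Const c" using Var d by auto
    then have "Var i * p = (\<Sum>k<3. if k = i then Const c * Var k else 0)"
      using Var(1) by simp
    also have "\<dots> = lf (\<lambda>k. if k = i then c else 0)"
      unfolding lf_def by (intro sum.cong) auto
    finally show ?thesis by blast
  qed
  moreover have "\<exists>M. Var i * p = (\<Sum>l<3. \<Sum>k<3. Const (M l k) * Var l * Var k)" if d: "d = 1"
  proof -
    obtain N where "p = lf N" using Var d by auto
    then have "Var i * p = (\<Sum>l<3. if l = i then (\<Sum>k<3. Const (N k) * Var i * Var k) else 0)"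
      using Var(1) by (simp add: lf_def sum_distrib_left algebra_simps)
    also have "\<dots> = (\<Sum>l<3. \<Sum>k<3. Const (if l = i then N k else 0) * Var l * Var k)"
      by (intro sum.cong) auto
    finally show ?thesis by (rule exI[of _ "\<lambda>l k. if l = i then N k else 0"])
  qed
  ultimately show ?case by auto
qed

definition bil :: "(nat \<Rightarrow> nat \<Rightarrow> complex) \<Rightarrow> (nat \<Rightarrow> complex) \<Rightarrow> (nat \<Rightarrow> complex) \<Rightarrow> complex" where
  "bil S u v = (\<Sum>i<3. \<Sum>k<3. S i k * u i * v k)"

text \<open>For symmetric \<open>S\<close>, half the gradient of the quadratic form at
  \<open>u\<close>, i.e. the polar line of \<open>u\<close>.\<close>

definition pol :: "(nat \<Rightarrow> nat \<Rightarrow> complex) \<Rightarrow> (nat \<Rightarrow> complex) \<Rightarrow> nat \<Rightarrow> complex" where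
  "pol S u k = (\<Sum>i<3. S i k * u i)"

definition qform :: "(nat \<Rightarrow> nat \<Rightarrow> complex) \<Rightarrow> mpoly" where
  "qform S = (\<Sum>i<3. \<Sum>k<3. Const (S i k) * Var i * Var k)"

lemma bil_pol: "bil S u v = dot (pol S u) v"
  by (simp add: bil_def pol_def dot_def sum_3 algebra_simps)

lemma conic_qform:
  assumes "inS q" "homog 2 q"
  obtains S where "\<And>i k. S i k = S k i" "q = qform S"
proof -
  obtain M where M: "q = (\<Sum>i<3. \<Sum>k<3. Const (M i k) * Var i * Var k)"
    using homog_low[OF assms] by auto
  have half: "Const (1/2) + Const (1/2) = 1" by (simp flip: Const_add)
  define h where "h = Const (1/2)"
  have "q = (h + h) * (\<Sum>i<3. \<Sum>k<3. Const (M i k) * Var i * Var k)"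
    using M half by (simp add: h_def)
  also have "\<dots> = qform (\<lambda>i k. (1/2) * M i k + (1/2) * M k i)"
    unfolding qform_def Const_add Const_mult h_def[symmetric]
    by (simp add: sum_3 algebra_simps)
  finally have "q = qform (\<lambda>i k. (1/2) * M i k + (1/2) * M k i)" .
  then show ?thesis by (intro that) auto
qed

lemma ev_qform: "ev v (qform S) = bil S v v"
  by (simp add: qform_def bil_def)

lemma ev_pd_qform: assumes "\<And>i k. S i k = S k i" "k < 3"
  shows "ev v (pd k (qform S)) = 2 * pol S v k"
  using assms(2) assms(1)[of 0 1] assms(1)[of 0 2] assms(1)[of 1 2]
  by (auto simp: qform_def pol_def sum_3 less_3_cases pd_add pd_mult pd_Var algebra_simps)

definition nosing :: "mpoly \<Rightarrow> bool" where
  "nosing q \<longleftrightarrow> (\<forall>v. nz v \<longrightarrow> ev v q = 0 \<longrightarrow> (\<exists>i<3. ev v (pd i q) \<noteq> 0))"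

definition component :: "mpoly \<Rightarrow> nat \<Rightarrow> bool" where
  "component q r \<longleftrightarrow> inS q \<and> homog r q \<and> q \<noteq> 0 \<and> (r = 1 \<or> r = 2) \<and> nosing q"

lemma nosing_qform:
  assumes sym: "\<And>i k. S i k = S k i" and "nosing (qform S)" "nz v"
  shows "nz (pol S v)"
proof (rule ccontr)
  assume "\<not> nz (pol S v)"
  then have z: "pol S v k = 0" if "k < 3" for k using that by (auto simp: nz_def)
  then have "bil S v v = 0" unfolding bil_pol dot_def by simp
  with assms z show False unfolding nosing_def ev_qform by (auto simp: ev_pd_qform)
qed

lemma pol_comb: "pol S (\<lambda>i. c * u i + d * v i) k = c * pol S u k + d * pol S v k"
  by (simp add: pol_def sum_3 algebra_simps)

lemma bil_scale1: "bil S (\<lambda>i. c * u i) v = c * bil S u v"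
  and bil_scale2: "bil S u (\<lambda>i. c * v i) = c * bil S u v"
  by (simp_all add: bil_def sum_3 algebra_simps)

text \<open>A smooth conic contains no line. Otherwise the polars of \<open>u\<close> and
  \<open>v\<close> would both be orthogonal to \<open>u\<close> and \<open>v\<close>, hence
  multiples c and d of \<open>cr u v\<close>; then d u - c v has polar 0 and is a singular
  point.\<close>

lemma isotropic_pair:
  assumes sym: "\<And>i k. S i k = S k i" and sm: "nosing (qform S)" and np: "nonpar u v"
    and "bil S u u = 0" "bil S v v = 0"
  shows "bil S u v \<noteq> 0"
proof
  assume z: "bil S u v = 0"
  have "bil S v u = 0" using z sym by (simp add: bil_def sum_3 algebra_simps)
  then obtain c d where c: "\<And>i. i < 3 \<Longrightarrow> pol S u i = c * cr u v i"
    and d: "\<And>i. i < 3 \<Longrightarrow> pol S v i = d * cr u v i"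
    using orthogonal_multiple[OF np] assms(4,5) z unfolding bil_pol by metis
  have "c \<noteq> 0" using nosing_qform[OF sym sm nonpar_nz(1)[OF np]] c by (auto simp: nz_def)
  then have "nz (\<lambda>i. d * u i + - c * v i)"
    using np unfolding nz_iff nonpar_iff by (auto simp: field_simps) algebra+
  from nosing_qform[OF sym sm this] show False
    unfolding nz_def pol_comb by (auto simp: c d)
qed

context dual_basis
begin

lemma qform_eq:
  assumes sym: "\<And>i k. S i k = S k i"
  shows "qform S = Const (bil S A A) * lf X ^ 2 + Const (bil S B B) * lf Y ^ 2 + Const (bil S C C) * lf Z ^ 2
    + Const (2 * bil S A B) * (lf X * lf Y) + Const (2 * bil S A C) * (lf X * lf Z)
    + Const (2 * bil S B C) * (lf Y * lf Z)"
proof -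
  have comm: "bil S u v = bil S v u" for u v using sym by (simp add: bil_def sum_3 algebra_simps)
  have S: "S i k = (bil S A A * X k + bil S A B * Y k + bil S A C * Z k) * X i
     + (bil S A B * X k + bil S B B * Y k + bil S B C * Z k) * Y i
     + (bil S A C * X k + bil S B C * Y k + bil S C C * Z k) * Z i" if "i < 3" "k < 3" for i k
  proof -
    have "dot (\<lambda>i. S i k) V = pol S V k" for V by (simp add: dot_def pol_def)
    then have "S i k = pol S A k * X i + pol S B k * Y i + pol S C k * Z i"
      using covec_eq[OF that(1), of "\<lambda>i. S i k"] by simp
    moreover have "pol S V k = bil S V A * X k + bil S V B * Y k + bil S V C * Z k" for V
      using covec_eq[OF that(2), of "pol S V"] by (simp add: bil_pol)
    ultimately show ?thesis using comm by metis
  qed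
  have "qform S = (\<Sum>i<3. \<Sum>k<3. Const ((bil S A A * X k + bil S A B * Y k + bil S A C * Z k) * X i
     + (bil S A B * X k + bil S B B * Y k + bil S B C * Z k) * Y i
     + (bil S A C * X k + bil S B C * Y k + bil S C C * Z k) * Z i) * Var i * Var k)"
    unfolding qform_def by (intro sum.cong refl) (simp add: S[symmetric])
  also have "\<dots> = Const (bil S A A) * lf X ^ 2 + Const (bil S B B) * lf Y ^ 2 + Const (bil S C C) * lf Z ^ 2
    + Const (2 * bil S A B) * (lf X * lf Y) + Const (2 * bil S A C) * (lf X * lf Z)
    + Const (2 * bil S B C) * (lf Y * lf Z)"
    unfolding mult_2 Const_add Const_mult lf_def sum_3 by (simp add: power2_eq_square algebra_simps)
  finally show ?thesis .
qed

end

text \<open>Take \<open>B\<close> on the pole of the chord through \<open>u\<close> and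
  \<open>v\<close>, where the tangents at these points meet. In the basis \<open>u\<close>,
  \<open>B\<close>, \<open>v\<close> the Gram matrix has entries only for the pair \<open>B\<close>,
  \<open>B\<close> and the pair \<open>u\<close>, \<open>v\<close>, so the form combines Y^2 and X
  Z.\<close>

lemma conic_frame:
  assumes sym: "\<And>i k. S i k = S k i" and sm: "nosing (qform S)" and np: "nonpar u v"
    and z: "bil S u u = 0" "bil S v v = 0"
  obtains B X Y Z \<kappa> where "frame u B v X Y Z (qform S) 2 \<kappa>"
proof -
  define s where "s = bil S u v"
  have s: "s \<noteq> 0" unfolding s_def by (rule isotropic_pair[OF sym sm np z])
  have comm: "bil S x y = bil S y x" for x y using sym by (simp add: bil_def sum_3 algebra_simps)
  define B0 where "B0 = cr (pol S u) (pol S v)"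
  have orth: "bil S u B0 = 0" "bil S v B0 = 0"
    by (simp_all add: B0_def bil_pol dot_def sum_3 cr_def algebra_simps)
  \<comment> \<open>The triple product expands the determinant; the isotropy of \<open>u\<close> and
    \<open>v\<close> leaves only the square of \<open>s\<close>.\<close>
  have "dot (cr u B0) v = - (dot (pol S u) u * dot (pol S v) v - dot (pol S u) v * dot (pol S v) u)"
    unfolding B0_def by (simp add: dot_def sum_3 cr_def algebra_simps)
  also have "\<dots> = s * s" using z comm[of u v] by (simp add: s_def flip: bil_pol)
  finally have det: "dot (cr u B0) v \<noteq> 0" using s by simp
  then obtain X Y Z where "dual_basis u B0 v X Y Z" using dual_basis_exists by blast
  then interpret b: dual_basis u B0 v X Y Z .
  define t where "t = bil S B0 B0"
  have t: "t \<noteq> 0"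
  proof
    assume "t = 0"
    then have "pol S B0 k = 0" if "k < 3" for k
      using b.covec_eq[OF that, of "pol S B0"] orth comm by (simp add: t_def flip: bil_pol)
    moreover have "nz B0" using b.YB by (auto simp: nz_iff dot_def sum_3)
    ultimately show False using nosing_qform[OF sym sm, of B0] by (auto simp: nz_def)
  qed
  \<comment> \<open>Rescaling \<open>B\<close> makes the coefficient of Y^2 equal to -2 s, the
    negative of that of X Z.\<close>
  define \<mu> where "\<mu> = csqrt (- 2 * s / t)"
  have \<mu>2: "\<mu> * \<mu> * t = - 2 * s" using t power2_csqrt[of "- 2 * s / t"] unfolding power2_eq_square by (simp add: \<mu>_def)
  then have \<mu>: "\<mu> \<noteq> 0" using s by auto
  define B where "B = (\<lambda>i. \<mu> * B0 i)"
  have "dual_basis u B v X (\<lambda>i. Y i / \<mu>) Z"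
  proof
    show "u i * X k + B i * (Y k / \<mu>) + v i * Z k = (if i = k then 1 else 0)" if "i < 3" "k < 3" for i k
      using b.dual[OF that] \<mu> by (simp add: B_def)
  qed (use b.XA b.XB b.XC b.YA b.YB b.YC b.ZA b.ZB b.ZC \<mu> in
      \<open>simp_all add: B_def dot_def mult.left_commute flip: sum_distrib_left sum_divide_distrib\<close>)
  then interpret c: dual_basis u B v X "\<lambda>i. Y i / \<mu>" Z .
  have "bil S B B = \<mu> * \<mu> * t" "bil S u B = 0" "bil S B v = 0"
    using orth comm[of v B0] by (simp_all add: B_def t_def bil_def sum_3 algebra_simps) (algebra+)?
  then have "qform S = Const (- 2 * s) * lf (\<lambda>i. Y i / \<mu>) ^ 2 + Const (2 * s) * (lf X * lf Z)"
    using c.qform_eq[OF sym] z \<mu>2 by (simp add: s_def)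
  then have "qform S = Const (- 2 * s) * (lf (\<lambda>i. Y i / \<mu>) ^ 2 - lf X * lf Z)"
    by (simp add: Const_uminus algebra_simps)
  then have "frame u B v X (\<lambda>i. Y i / \<mu>) Z (qform S) 2 (- 2 * s)"
    using s by unfold_locales auto
  then show ?thesis by (rule that)
qed

lemma line_frame:
  assumes "nonpar u v" "lf N \<noteq> 0" "dot N u = 0" "dot N v = 0"
  obtains C X Y Z \<kappa> where "frame u v C X Y Z (lf N) 1 \<kappa>"
proof -
  obtain k where k: "k < 3" "cr u v k \<noteq> 0" using assms(1) by (auto simp: nonpar_def)
  define C :: "nat \<Rightarrow> complex" where "C = (\<lambda>i. if i = k then 1 else 0)"
  have "dot (cr u v) C = (\<Sum>i<3. if i = k then cr u v i else 0)"
    unfolding dot_def C_def by (intro sum.cong) auto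
  then have "dot (cr u v) C \<noteq> 0" using k by simp
  then obtain X Y Z where "dual_basis u v C X Y Z" using dual_basis_exists by blast
  then interpret b: dual_basis u v C X Y Z .
  have "lf N = Const (dot N C) * lf Z"
    unfolding lf_def sum_distrib_left
    by (intro sum.cong refl) (use b.covec_eq[of _ N] assms in \<open>auto simp: Const_mult mult.assoc\<close>)
  moreover from this have "dot N C \<noteq> 0" using assms(2) by auto
  ultimately have "frame u v C X Y Z (lf N) 1 (dot N C)" by unfold_locales auto
  then show ?thesis by (rule that)
qed

text \<open>Two points can be prescribed: one at parameter 0, where local computations take place,
  and one at infinity, which is to be kept off the other components.\<close>

lemma frame_through:
  assumes q: "component q r" and z: "ev u q = 0" "ev v q = 0" and np: "nonpar u v"
  obtains A B C X Y Z \<kappa> where "frame A B C X Y Z q r \<kappa>" "A = u" "frame.infpt B C r = v"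
proof (cases "r = 1")
  case True
  then obtain N where N: "q = lf N" using q homog_low[of q r] by (auto simp: component_def)
  obtain C X Y Z \<kappa> where f: "frame u v C X Y Z (lf N) 1 \<kappa>"
    by (rule line_frame[OF np, of N]) (use q z in \<open>auto simp: N component_def\<close>)
  show ?thesis
    by (rule that[of u v C X Y Z \<kappa>]) (use f True frame.infpt_def[OF f] in \<open>simp_all add: N\<close>)
next
  case False
  then have r: "r = 2" using q by (auto simp: component_def)
  obtain S where S: "\<And>i k. S i k = S k i" "q = qform S" using conic_qform q r by (auto simp: component_def)
  obtain B X Y Z \<kappa> where f: "frame u B v X Y Z (qform S) 2 \<kappa>"
    by (rule conic_frame[where S = S, OF _ _ np]) (use q z S(1) in \<open>auto simp: S(2) component_def ev_qform\<close>)
  show ?thesis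
    by (rule that[of u B v X Y Z \<kappa>]) (use f r frame.infpt_def[OF f] in \<open>simp_all add: S(2)\<close>)
qed

lemma quadratic_zero: obtains s t :: complex where "s \<noteq> 0 \<or> t \<noteq> 0" "a * s\<^sup>2 + b * s * t + c * t\<^sup>2 = 0"
proof (cases "a = 0")
  case True
  then show ?thesis using that[of 1 0] by simp
next
  case False
  define w where "w = csqrt (b\<^sup>2 - 4 * a * c)"
  have w: "w * w = b * b - 4 * a * c" using power2_csqrt unfolding w_def power2_eq_square by blast
  have "a * ((w - b) / (2 * a))\<^sup>2 + b * ((w - b) / (2 * a)) * 1 + c * 1\<^sup>2 = (w * w - b * b + 4 * a * c) / (4 * a)"
    using False by (simp add: power2_eq_square field_simps)
  then show ?thesis using that[of "(w - b) / (2 * a)" 1] w by simp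
qed

lemma two_points:
  assumes "component q r"
  obtains u v where "nonpar u v" "ev u q = 0" "ev v q = 0"
proof (cases "r = 1")
  case True
  then obtain N where N: "q = lf N" using assms homog_low[of q r] by (auto simp: component_def)
  have "nz N" using assms unfolding component_def N nz_iff by (auto simp: lf_def sum_3)
  \<comment> \<open>Cross products of \<open>N\<close> with unit vectors lie on the line; if the
    coordinate \<open>N i\<close> is nonzero, the two with index other than \<open>i\<close> are
    independent.\<close>
  define w where "w = (\<lambda>j k. cr N (\<lambda>i. if i = j then 1 else if i = k then (0::complex) else 0))"
  have "nonpar (w 1 2) (w 2 1) \<or> nonpar (w 2 0) (w 0 2) \<or> nonpar (w 0 1) (w 1 0)"
    using \<open>nz N\<close> unfolding nz_iff nonpar_iff w_def by (auto simp: cr_def)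
  moreover have "ev (w j k) q = 0" for j k
    by (simp add: N w_def dot_def sum_3 cr_def algebra_simps)
  ultimately show ?thesis using that by blast
next
  case False
  then obtain S where S: "\<And>i k. S i k = S k i" "q = qform S"
    using conic_qform assms by (auto simp: component_def)
  define tr where "tr = (\<lambda>(a::complex) (b::complex) (c::complex) i. if i = (0::nat) then a else if i = 1 then b else c)"
  have ev: "ev (tr a b c) q = S 0 0 * a\<^sup>2 + S 1 1 * b\<^sup>2 + S 2 2 * c\<^sup>2 + 2 * S 0 1 * a * b
      + 2 * S 0 2 * a * c + 2 * S 1 2 * b * c" for a b c
    using S(1)[of 1 0] S(1)[of 2 0] S(1)[of 2 1]
    by (simp add: S(2) ev_qform bil_def sum_3 tr_def power2_eq_square algebra_simps)
  \<comment> \<open>Each coordinate line meets the conic. The points on x2 = 0 and on x0 = 0 can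
    coincide only in (0, 1, 0), which is not on x1 = 0.\<close>
  obtain s t where st: "s \<noteq> 0 \<or> t \<noteq> 0" "S 0 0 * s\<^sup>2 + (2 * S 0 1) * s * t + S 1 1 * t\<^sup>2 = 0"
    using quadratic_zero by blast
  obtain s' t' where st': "s' \<noteq> 0 \<or> t' \<noteq> 0" "S 1 1 * s'\<^sup>2 + (2 * S 1 2) * s' * t' + S 2 2 * t'\<^sup>2 = 0"
    using quadratic_zero by blast
  obtain s'' t'' where st'': "s'' \<noteq> 0 \<or> t'' \<noteq> 0" "S 0 0 * s''\<^sup>2 + (2 * S 0 2) * s'' * t'' + S 2 2 * t''\<^sup>2 = 0"
    using quadratic_zero by blast
  have "nonpar (tr s t 0) (tr 0 s' t') \<or> nonpar (tr s t 0) (tr s'' 0 t'')"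
    using st(1) st'(1) st''(1) unfolding nonpar_iff tr_def by auto
  moreover have "ev (tr s t 0) q = 0" "ev (tr 0 s' t') q = 0" "ev (tr s'' 0 t'') q = 0"
    using st(2) st'(2) st''(2) by (simp_all add: ev algebra_simps)
  ultimately show ?thesis using that by blast
qed

lemma frame_at:
  assumes "component q r" "nz p" "ev p q = 0"
  obtains A B C X Y Z \<kappa> where "frame A B C X Y Z q r \<kappa>" "A = p"
proof -
  obtain u v where uv: "nonpar u v" "ev u q = 0" "ev v q = 0" using two_points[OF assms(1)] .
  from nonpar_choose[OF uv(1) assms(2)] obtain w where "nonpar p w" "ev w q = 0"
    using uv by blast
  then show ?thesis using frame_through[OF assms(1,3)] that by metis
qed

context frame
begin

lemma nonpar_AB: "nonpar A B"
proof (rule ccontr)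
  assume "\<not> nonpar A B"
  moreover have "nz A" using XA by (auto simp: nz_iff dot_def sum_3)
  ultimately obtain c where c: "\<And>i. i < 3 \<Longrightarrow> B i = c * A i" using not_nonpar by blast
  then have "dot Y B = c * dot Y A" by (simp add: dot_def sum_3 algebra_simps)
  then show False using YA YB by simp
qed

text \<open>This stands in for unique factorization: \<open>q'\<close> is expanded in adapted
  coordinates and the coefficients of its restriction are compared. A conic containing a line is
  excluded by \<open>isotropic_pair\<close>, and a line containing a conic would have the zero
  form.\<close>

lemma proportional_of_pev_0:
  assumes q': "component q' r'" and z: "pev phi q' = 0"
  shows "proportional q' q"
proof (cases "r' = 1")
  case True
  then obtain N where N: "q' = lf N" using q' homog_low[of q' r'] by (auto simp: component_def)
  have "(if r = 1 then [:dot N A, dot N B:] else [:dot N A, dot N B, dot N C:]) = 0"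
    using z pev_lf[of N] by (simp add: N)
  then have AB: "dot N A = 0" "dot N B = 0" "r \<noteq> 1 \<longrightarrow> dot N C = 0" by (auto split: if_splits)
  have N': "N k = dot N C * Z k" if "k < 3" for k using covec_eq[OF that, of N] AB by simp
  have "lf N = Const (dot N C) * lf Z"
    unfolding lf_def sum_distrib_left by (intro sum.cong refl) (simp add: N' Const_mult mult.assoc)
  moreover have "lf N \<noteq> 0" using q' by (simp add: component_def N)
  ultimately have r: "r = 1" using AB(3) by auto
  then have "q = Const \<kappa> * lf Z" using q_cases by auto
  then have "q' = Const (dot N C / \<kappa>) * q"
    using \<open>lf N = _\<close> \<kappa> by (simp add: N flip: mult.assoc Const_mult)
  then show ?thesis unfolding proportional_def by blast
next
  case False
  then obtain S where S: "\<And>i k. S i k = S k i" "q' = qform S"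
    using conic_qform q' by (auto simp: component_def)
  have sm: "nosing (qform S)" using q' S by (simp add: component_def)
  have pz: "[:bil S A A:] + [:bil S B B:] * [:0, 1:] ^ 2 + [:bil S C C:] * pev phi (lf Z) ^ 2
    + [:2 * bil S A B:] * [:0, 1:] + [:2 * bil S A C:] * pev phi (lf Z)
    + [:2 * bil S B C:] * ([:0, 1:] * pev phi (lf Z)) = 0"
    using z unfolding S(2) qform_eq[OF S(1)] by (simp add: pev_Y)
  show ?thesis
  proof (cases "r = 1")
    case True
    then have "pev phi (lf Z) = 0" using pev_Z by simp
    then have "bil S A A = 0" "bil S B B = 0" "bil S A B = 0"
      using pz by (auto simp: power2_eq_square)
    then show ?thesis using isotropic_pair[OF S(1) sm nonpar_AB] by blast
  next
    case False
    then have pZ: "pev phi (lf Z) = [:0, 0, 1:]" using pev_Z by simp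
    have b0: "bil S A A = 0" "bil S B B + 2 * bil S A C = 0" "bil S C C = 0" "bil S A B = 0" "bil S B C = 0"
      using pz unfolding pZ by (auto simp: power2_eq_square)
    have "2 * bil S A C = - bil S B B"
      using b0(2) by (simp add: eq_neg_iff_add_eq_0 add.commute)
    then have "q' = Const (bil S B B) * lf Y ^ 2 + Const (- bil S B B) * (lf X * lf Z)"
      unfolding S(2) qform_eq[OF S(1)] using b0 by simp
    then have "q' = Const (bil S B B) * (lf Y ^ 2 - lf X * lf Z)"
      by (simp add: Const_uminus algebra_simps)
    moreover have "q = Const \<kappa> * (lf Y ^ 2 - lf X * lf Z)" using q_cases False by auto
    ultimately have "q' = Const (bil S B B / \<kappa>) * q"
      using \<kappa> by (simp flip: mult.assoc Const_mult)
    then show ?thesis unfolding proportional_def by blast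
  qed
qed

end

section \<open>Finiteness of the Tjurina number and the Euler derivation of a quasihomogeneous point\<close>

definition arr :: "mpoly set \<Rightarrow> bool" where
  "arr A \<longleftrightarrow> finite A \<and> A \<noteq> {} \<and> (\<forall>p\<in>A. \<exists>r. component p r) \<and>
     (\<forall>p\<in>A. \<forall>q\<in>A. p \<noteq> q \<longrightarrow> \<not> proportional p q)"

lemma arr_prod_homog: assumes "arr A" "B \<subseteq> A" shows "\<exists>d. homog d (\<Prod>B)" "inS (\<Prod>B)"
proof -
  have "finite B" using assms by (auto simp: arr_def intro: finite_subset)
  from this assms(2) have "inS (\<Prod>B) \<and> (\<exists>d. homog d (\<Prod>B))"
  proof (induction B rule: finite_induct)
    case empty
    show ?case by (auto intro: exI[of _ 0])
  next
    case (insert q B)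
    then obtain r where "component q r" using assms unfolding arr_def by blast
    with insert show ?case by (auto simp: component_def intro: homog_mult)
  qed
  then show "\<exists>d. homog d (\<Prod>B)" "inS (\<Prod>B)" by auto
qed

lemma arr_degree_pos: assumes "arr A" "homog d (\<Prod>A)" shows "d > 0"
proof -
  obtain q where q: "q \<in> A" using assms by (auto simp: arr_def)
  then obtain r where r: "component q r" using assms unfolding arr_def by blast
  obtain e where "homog e (\<Prod>(A - {q}))" using arr_prod_homog(1)[OF assms(1), of "A - {q}"] by auto
  then have h: "homog (r + e) (\<Prod>A)"
    using homog_mult[of r q e "\<Prod>(A - {q})"] r q assms(1) prod.remove[of A q "\<lambda>x. x"]
    by (simp add: component_def arr_def)
  have "\<Prod>A \<noteq> 0" using assms(1) by (auto simp: arr_def component_def)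
  then obtain m where "m \<in> mkeys (\<Prod>A)" by (metis all_not_in_conv keys_eq_empty)
  then have "d = r + e" using assms(2) h homog_mdeg by metis
  then show ?thesis using r by (auto simp: component_def)
qed

lemma (in frame) pev_prod_nonzero:
  assumes "arr F" "q \<in> F" "E \<subseteq> F - {q}"
  shows "pev phi (\<Prod>E) \<noteq> 0"
proof -
  have "finite E" using assms by (auto simp: arr_def intro: finite_subset)
  moreover have "pev phi p \<noteq> 0" if "p \<in> E" for p
    using that assms proportional_of_pev_0[of p] unfolding arr_def by blast
  ultimately show ?thesis by simp
qed

text \<open>An ideal of the local ring at \<open>x\<close>, represented by its preimage in S:
  \<open>J_cancel\<close> says that polynomials not vanishing at \<open>x\<close> act as
  units.\<close>

locale loc_id =
  fixes J :: "mpoly set" and x :: "nat \<Rightarrow> complex"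
  assumes J_inS: "h \<in> J \<Longrightarrow> inS h" and J_0: "0 \<in> J"
    and J_add: "h \<in> J \<Longrightarrow> h' \<in> J \<Longrightarrow> h + h' \<in> J"
    and J_mult: "inS c \<Longrightarrow> h \<in> J \<Longrightarrow> c * h \<in> J"
    and J_cancel: "inS h \<Longrightarrow> inS s \<Longrightarrow> ev x s \<noteq> 0 \<Longrightarrow> s * h \<in> J \<Longrightarrow> h \<in> J"
begin

lemma J_uminus: "h \<in> J \<Longrightarrow> - h \<in> J"
  using J_mult[of "- 1" h] by simp

lemma J_diff: "h \<in> J \<Longrightarrow> h' \<in> J \<Longrightarrow> h - h' \<in> J"
  using J_add[OF _ J_uminus, of h h'] by simp

lemma J_sum: "(\<And>i. i \<in> I \<Longrightarrow> f i \<in> J) \<Longrightarrow> sum f I \<in> J"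
  by (induction I rule: infinite_finite_induct) (auto intro: J_0 J_add)

end

section \<open>Dimensions of quotients by localized ideals\<close>

lemma linear_dependence:
  fixes c :: "'i \<Rightarrow> 'b \<Rightarrow> 'f::field"
  assumes "finite B" "finite I" "card B < card I"
  shows "\<exists>\<alpha>. (\<exists>i\<in>I. \<alpha> i \<noteq> 0) \<and> (\<forall>b\<in>B. (\<Sum>i\<in>I. \<alpha> i * c i b) = 0)"
  using assms
proof (induction B arbitrary: I c rule: finite_induct)
  case empty
  then show ?case by (intro exI[of _ "\<lambda>_. 1"]) (auto simp: card_gt_0_iff)
next
  case (insert b B)
  show ?case
  proof (cases "\<forall>i\<in>I. c i b = 0")
    case True
    then show ?thesis using insert.IH[of I c] insert by auto
  next
    case False
    then obtain i0 where i0: "i0 \<in> I" "c i0 b \<noteq> 0" by auto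
    define I' where "I' = I - {i0}"
    have I: "I = insert i0 I'" "i0 \<notin> I'" "finite I'" using i0 insert by (auto simp: I'_def)
    \<comment> \<open>Gaussian elimination of the coordinate \<open>b\<close> with pivot
      \<open>i0\<close>; the coefficient of \<open>i0\<close> is chosen afterwards so that
      coordinate \<open>b\<close> vanishes.\<close>
    define c' where "c' = (\<lambda>i b'. c i b' - c i b / c i0 b * c i0 b')"
    have "card B < card I'" using insert I by simp
    then obtain \<alpha> where \<alpha>: "\<exists>i\<in>I'. \<alpha> i \<noteq> 0" "\<forall>b'\<in>B. (\<Sum>i\<in>I'. \<alpha> i * c' i b') = 0"
      using insert.IH[of I' c'] I by blast
    define \<beta> where "\<beta> = \<alpha>(i0 := - (\<Sum>i\<in>I'. \<alpha> i * c i b) / c i0 b)"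
    have \<beta>: "(\<Sum>i\<in>I. \<beta> i * c i b') = (\<Sum>i\<in>I'. \<alpha> i * c' i b')" for b'
    proof -
      have "(\<Sum>i\<in>I'. \<beta> i * c i b') = (\<Sum>i\<in>I'. \<alpha> i * c i b')"
        using I by (intro sum.cong) (auto simp: \<beta>_def)
      then show ?thesis
        using I by (simp add: \<beta>_def c'_def algebra_simps sum_subtractf sum_distrib_left sum_distrib_right sum_divide_distrib)
    qed
    have "(\<Sum>i\<in>I. \<beta> i * c i b) = 0"
      unfolding \<beta> c'_def using i0 by (intro sum.neutral) simp
    moreover have "\<exists>i\<in>I. \<beta> i \<noteq> 0" using \<alpha>(1) I by (auto simp: \<beta>_def)
    ultimately show ?thesis using \<alpha>(2) \<beta> by (intro exI[of _ \<beta>]) auto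
  qed
qed

definition lin_indep :: "mpoly set \<Rightarrow> mpoly list \<Rightarrow> bool" where
  "lin_indep J vs \<longleftrightarrow> (\<forall>v\<in>set vs. inS v) \<and> (\<forall>cs. length cs = length vs \<longrightarrow>
     (\<Sum>(c,v)\<leftarrow>zip cs vs. Const c * v) \<in> J \<longrightarrow> (\<forall>c\<in>set cs. c = 0))"

lemma quot_dim_alt: "quot_dim J = Sup {enat (length vs) | vs. lin_indep J vs}"
  unfolding quot_dim_def lin_indep_def by (rule arg_cong[of _ _ Sup]) auto

lemma (in loc_id) lin_indep_length_le:
  assumes "finite B" and span: "\<And>h. inS h \<Longrightarrow> \<exists>c. h - (\<Sum>b\<in>B. Const (c b) * E b) \<in> J"
    and vs: "lin_indep J vs"
  shows "length vs \<le> card B"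
proof (rule ccontr)
  assume "\<not> ?thesis"
  then have lt: "card B < card {..<length vs}" by simp
  have "\<forall>i\<in>{..<length vs}. \<exists>c. vs ! i - (\<Sum>b\<in>B. Const (c b) * E b) \<in> J"
    using span vs by (auto simp: lin_indep_def)
  from bchoice[OF this] obtain c where c: "\<And>i. i < length vs \<Longrightarrow> vs ! i - (\<Sum>b\<in>B. Const (c i b) * E b) \<in> J"
    by auto
  obtain \<alpha> where \<alpha>: "\<exists>i<length vs. \<alpha> i \<noteq> 0" "\<forall>b\<in>B. (\<Sum>i<length vs. \<alpha> i * c i b) = 0"
    using linear_dependence[OF assms(1) _ lt, of c] by auto
  define cs where "cs = map \<alpha> [0..<length vs]"
  have "(\<Sum>(c,v)\<leftarrow>zip cs vs. Const c * v) = (\<Sum>i<length vs. Const (\<alpha> i) * vs ! i)"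
    by (simp add: cs_def sum_list_sum_nth case_prod_beta atLeast0LessThan)
  also have "\<dots> = (\<Sum>i<length vs. Const (\<alpha> i) * (vs ! i - (\<Sum>b\<in>B. Const (c i b) * E b)))
       + (\<Sum>i<length vs. \<Sum>b\<in>B. Const (\<alpha> i * c i b) * E b)"
    by (simp add: algebra_simps sum_subtractf sum_distrib_left Const_mult)
  also have "(\<Sum>i<length vs. \<Sum>b\<in>B. Const (\<alpha> i * c i b) * E b) = (\<Sum>b\<in>B. Const (\<Sum>i<length vs. \<alpha> i * c i b) * E b)"
  proof -
    have "Const (\<Sum>i\<in>I. f i) = (\<Sum>i\<in>I. Const (f i))" for I and f :: "nat \<Rightarrow> complex"
      by (induction I rule: infinite_finite_induct) (auto simp: Const_add)
    then show ?thesis by (subst sum.swap) (simp add: sum_distrib_right)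
  qed
  also have "\<dots> = 0" using \<alpha>(2) by simp
  finally have "(\<Sum>(c,v)\<leftarrow>zip cs vs. Const c * v) \<in> J"
    using c by (auto intro!: J_sum J_mult)
  moreover have "length cs = length vs" by (simp add: cs_def)
  ultimately have "\<forall>c\<in>set cs. c = 0" using vs unfolding lin_indep_def by blast
  then show False using \<alpha>(1) by (auto simp: cs_def)
qed

text \<open>If \<open>f\<close> were outside \<open>M\<close>, prepending it to a list independent
  modulo \<open>T\<close> would give one independent modulo \<open>M\<close>: modulo
  \<open>T\<close> the term with \<open>f\<close> disappears, which kills the other coefficients,
  and then the coefficient of \<open>f\<close> must be 0 too. So the dimension of the quotient by
  \<open>M\<close> would be larger, a contradiction because \<open>bound\<close> makes the one for
  \<open>T\<close> finite.\<close>

lemma mem_of_quot_dim_eq: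
  assumes M: "loc_id M x" and T: "loc_id T x" and MT: "M \<subseteq> T" and f: "f \<in> T"
    and eq: "quot_dim M = quot_dim T"
    and bound: "\<And>vs. lin_indep T vs \<Longrightarrow> length vs \<le> n"
  shows "f \<in> M"
proof (rule ccontr)
  assume nf: "f \<notin> M"
  interpret M: loc_id M x by fact
  interpret T: loc_id T x by fact
  have step: "lin_indep M (f # vs)" if vs: "lin_indep T vs" for vs
    unfolding lin_indep_def
  proof (intro conjI allI impI)
    show "\<forall>v\<in>set (f # vs). inS v" using vs T.J_inS[OF f] by (simp add: lin_indep_def)
    fix cs' assume len: "length cs' = length (f # vs)" and m: "(\<Sum>(c, v)\<leftarrow>zip cs' (f # vs). Const c * v) \<in> M"
    then obtain c cs where cs: "cs' = c # cs" "length cs = length vs" by (cases cs') auto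
    define w where "w = (\<Sum>(c, v)\<leftarrow>zip cs vs. Const c * v)"
    have m': "Const c * f + w \<in> M" using m by (simp add: cs w_def)
    then have "(Const c * f + w) - Const c * f \<in> T" using MT f by (intro T.J_diff T.J_mult) auto
    then have z: "\<forall>c\<in>set cs. c = 0" using vs cs(2) by (simp add: lin_indep_def w_def)
    have "w = 0" unfolding w_def
      using z cs(2)[symmetric] by (auto simp: sum_list_sum_nth case_prod_beta intro!: sum.neutral)
    then have cf: "Const c * f \<in> M" using m' by simp
    have "c = 0"
    proof (rule ccontr)
      assume "c \<noteq> 0"
      then have "Const (1 / c) * Const c = 1" by (simp flip: Const_mult)
      then have e: "Const (1 / c) * (Const c * f) = f" by (simp only: mult.assoc[symmetric] mult_1)
      show False using nf M.J_mult[OF inS_Const cf, of "1 / c"] unfolding e by blast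
    qed
    then show "\<forall>c\<in>set cs'. c = 0" using z cs by simp
  qed
  define S where "S = {length vs | vs. lin_indep T vs}"
  have "lin_indep T []" by (simp add: lin_indep_def)
  then have ne: "S \<noteq> {}" by (auto simp: S_def)
  have fin: "finite S" using bound by (auto simp: S_def intro!: finite_subset[of _ "{..n}"])
  define k where "k = Max S"
  have "k \<in> S" unfolding k_def by (rule Max_in[OF fin ne])
  then obtain vs where vs: "lin_indep T vs" "length vs = k" by (auto simp: S_def)
  have "quot_dim T \<le> enat k"
    unfolding quot_dim_alt k_def by (rule Sup_least) (use fin in \<open>auto simp: S_def intro!: Max_ge\<close>)
  moreover have "enat (Suc k) \<le> quot_dim M"
    unfolding quot_dim_alt by (rule Sup_upper) (use step[OF vs(1)] vs(2) in force)
  ultimately show False using eq order.trans by fastforce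
qed

lemma ideal_gen_iff:
  "h \<in> ideal_gen gs \<longleftrightarrow> (\<exists>c. (\<forall>i<length gs. inS (c i)) \<and> h = (\<Sum>i<length gs. c i * gs ! i))"
proof
  assume "h \<in> ideal_gen gs"
  then obtain cs where "length cs = length gs" "\<forall>c\<in>set cs. inS c" "h = (\<Sum>(c,g)\<leftarrow>zip cs gs. c * g)"
    by (auto simp: ideal_gen_def)
  then show "\<exists>c. (\<forall>i<length gs. inS (c i)) \<and> h = (\<Sum>i<length gs. c i * gs ! i)"
    by (intro exI[of _ "\<lambda>i. cs ! i"]) (simp add: sum_list_sum_nth case_prod_beta atLeast0LessThan)
next
  assume "\<exists>c. (\<forall>i<length gs. inS (c i)) \<and> h = (\<Sum>i<length gs. c i * gs ! i)"
  then obtain c where "\<forall>i<length gs. inS (c i)" "h = (\<Sum>i<length gs. c i * gs ! i)" by auto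
  then show "h \<in> ideal_gen gs" unfolding ideal_gen_def
    by (intro CollectI exI[of _ "map c [0..<length gs]"])
       (auto simp: sum_list_sum_nth case_prod_beta atLeast0LessThan)
qed

lemma loc_id_loc_ideal: "loc_id (loc_ideal (ideal_gen gs) v) (coord v)"
proof
  have add: "h + h' \<in> ideal_gen gs" if hh: "h \<in> ideal_gen gs" "h' \<in> ideal_gen gs" for h h'
  proof -
    obtain c c' where "\<forall>i<length gs. inS (c i)" "h = (\<Sum>i<length gs. c i * gs ! i)"
      "\<forall>i<length gs. inS (c' i)" "h' = (\<Sum>i<length gs. c' i * gs ! i)"
      using hh unfolding ideal_gen_iff by auto
    then show ?thesis unfolding ideal_gen_iff
      by (intro exI[of _ "\<lambda>i. c i + c' i"]) (simp add: algebra_simps sum.distrib)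
  qed
  have mult: "s * h \<in> ideal_gen gs" if hh: "h \<in> ideal_gen gs" "inS s" for s h
  proof -
    obtain c where "\<forall>i<length gs. inS (c i)" "h = (\<Sum>i<length gs. c i * gs ! i)"
      using hh unfolding ideal_gen_iff by auto
    then show ?thesis unfolding ideal_gen_iff using hh(2)
      by (intro exI[of _ "\<lambda>i. s * c i"]) (simp add: sum_distrib_left algebra_simps)
  qed
  let ?J = "loc_ideal (ideal_gen gs) v"
  show "inS h" if "h \<in> ?J" for h using that by (simp add: loc_ideal_def)
  have "0 \<in> ideal_gen gs" unfolding ideal_gen_iff by (intro exI[of _ "\<lambda>_. 0"]) simp
  then show "0 \<in> ?J" by (auto simp: loc_ideal_def mp_eval_ev intro!: exI[of _ 1])
  show "h + h' \<in> ?J" if hh: "h \<in> ?J" "h' \<in> ?J" for h h'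
  proof -
    obtain s s' where s: "inS h" "inS h'" "inS s" "inS s'" "ev (coord v) s \<noteq> 0" "ev (coord v) s' \<noteq> 0"
      "s * h \<in> ideal_gen gs" "s' * h' \<in> ideal_gen gs"
      using hh by (auto simp: loc_ideal_def mp_eval_ev)
    have "s' * (s * h) + s * (s' * h') \<in> ideal_gen gs" by (rule add[OF mult mult]) (use s in auto)
    then have "(s * s') * (h + h') \<in> ideal_gen gs" by (simp add: algebra_simps)
    then show ?thesis using s by (auto simp: loc_ideal_def mp_eval_ev intro!: exI[of _ "s * s'"])
  qed
  show "c * h \<in> ?J" if hh: "inS c" "h \<in> ?J" for c h
  proof -
    obtain s where s: "inS h" "inS s" "ev (coord v) s \<noteq> 0" "s * h \<in> ideal_gen gs"
      using hh by (auto simp: loc_ideal_def mp_eval_ev)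
    have "c * (s * h) \<in> ideal_gen gs" by (rule mult) (use s hh in auto)
    then show ?thesis using s hh by (auto simp: loc_ideal_def mp_eval_ev algebra_simps intro!: exI[of _ s])
  qed
  show "h \<in> ?J" if hh: "inS h" "inS s" "ev (coord v) s \<noteq> 0" "s * h \<in> ?J" for h s
  proof -
    obtain s' where s: "inS s'" "ev (coord v) s' \<noteq> 0" "s' * (s * h) \<in> ideal_gen gs"
      using hh by (auto simp: loc_ideal_def mp_eval_ev)
    then show ?thesis using hh by (auto simp: loc_ideal_def mp_eval_ev mult.assoc intro!: exI[of _ "s' * s"])
  qed
qed

lemma gen_in_loc_ideal: assumes "g \<in> set gs" "inS g" shows "g \<in> loc_ideal (ideal_gen gs) v"
proof -
  obtain k where k: "k < length gs" "gs ! k = g" using assms by (auto simp: in_set_conv_nth)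
  then have "g = (\<Sum>i<length gs. (if i = k then 1 else 0) * gs ! i)"
    by (simp add: if_distrib[of "\<lambda>a. a * _"] cong: if_cong)
  then have "g \<in> ideal_gen gs" unfolding ideal_gen_iff
    by (intro exI[of _ "\<lambda>i. if i = k then 1 else 0"]) simp
  then show ?thesis using assms by (auto simp: loc_ideal_def mp_eval_ev intro!: exI[of _ 1])
qed

lemma loc_ideal_mono:
  assumes "set gs \<subseteq> set gs'" "\<And>g. g \<in> set gs' \<Longrightarrow> inS g"
  shows "loc_ideal (ideal_gen gs) v \<subseteq> loc_ideal (ideal_gen gs') v"
proof
  interpret T: loc_id "loc_ideal (ideal_gen gs') v" "coord v" by (rule loc_id_loc_ideal)
  fix h assume "h \<in> loc_ideal (ideal_gen gs) v"
  then obtain s c where s: "inS h" "inS s" "ev (coord v) s \<noteq> 0" "\<forall>i<length gs. inS (c i)"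
    "s * h = (\<Sum>i<length gs. c i * gs ! i)"
    unfolding loc_ideal_def mp_eval_ev ideal_gen_iff by auto
  have "s * h \<in> loc_ideal (ideal_gen gs') v" unfolding s(5)
    using assms s(4) by (intro T.J_sum T.J_mult gen_in_loc_ideal) (auto simp: subset_iff)
  then show "h \<in> loc_ideal (ideal_gen gs') v" using s T.J_cancel by blast
qed

section \<open>Finite dimension of the quotient by the Tjurina ideal\<close>

lemma power_add_multiple:
  assumes "inS a" "inS b" "inS q"
  shows "\<exists>K. inS K \<and> (a + q * b) ^ m = a ^ m + q * K"
proof (induction m)
  case 0
  show ?case by (intro exI[of _ 0]) simp
next
  case (Suc m)
  then obtain K where "inS K" "(a + q * b) ^ m = a ^ m + q * K" by auto
  then show ?case using assms
    by (intro exI[of _ "a * K + b * (a ^ m + q * K)"]) (auto simp: algebra_simps)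
qed

lemma factor_root: fixes g :: "complex poly" assumes "g \<noteq> 0"
  obtains m h where "g = [:0, 1:] ^ m * h" "coeff h 0 \<noteq> 0"
proof -
  obtain h where "g = [:- 0, 1:] ^ order 0 g * h" "\<not> [:- 0, 1:] dvd h"
    using order_decomp[OF assms, of 0] by blast
  then show ?thesis using that[of "order 0 g" h] poly_eq_0_iff_dvd[of h 0] by (simp add: poly_0_coeff_0)
qed

context loc_id
begin

text \<open>Locally along a component \<open>q\<close>, the function \<open>l\<close> is a multiple of the uniformizer \<open>Y / X\<close>
  and \<open>G\<close> a unit times a power of it; since \<open>G\<^sup>2\<close> lies in the ideal by the smoothness
  of \<open>q\<close>, so does a power of \<open>l\<close>, up to a multiple of \<open>q\<close>.\<close>

lemma power_mod_component:
  assumes q: "component q r" and G: "inS G" "homog d G" and x: "nz x"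
    and nv: "\<And>A B C X Y Z \<kappa>. frame A B C X Y Z q r \<kappa> \<Longrightarrow> pev (frame.phi A B C r) G \<noteq> 0"
    and fJ: "q * G \<in> J" and pJ: "\<And>k. k < 3 \<Longrightarrow> pd k (q * G) \<in> J"
    and l: "inS l" "homog 1 l" "ev x l = 0"
  shows "\<exists>s M e. inS s \<and> inS e \<and> ev x s \<noteq> 0 \<and> s * l ^ M - e * q \<in> J"
proof (cases "ev x q = 0")
  case False
  then show ?thesis using q J_0 by (intro exI[of _ q] exI[of _ 0] exI[of _ 1]) (simp add: component_def)
next
  case True
  have qS: "inS q" using q by (simp add: component_def)
  obtain k where k: "k < 3" "ev x (pd k q) \<noteq> 0" using q True x by (auto simp: component_def nosing_def)
  have "pd k q * G ^ 2 = G * pd k (q * G) - pd k G * (q * G)"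
    by (simp add: pd_mult power2_eq_square algebra_simps)
  also have "\<dots> \<in> J" by (rule J_diff[OF J_mult J_mult]) (use fJ pJ G k in auto)
  finally have G2: "G ^ 2 \<in> J" using k G qS by (intro J_cancel[of "G ^ 2" "pd k q"]) auto
  obtain A B C X Y Z \<kappa> where fr: "frame A B C X Y Z q r \<kappa>" and A: "A = x"
    using frame_at[OF q x True] by blast
  interpret frame A B C X Y Z q r \<kappa> by (rule fr)
  have phi0: "poly (phi i) 0 = x i" for i unfolding A[symmetric] by (simp add: phi_def)
  obtain m g where g: "pev phi G = [:0, 1:] ^ m * g" "coeff g 0 \<noteq> 0" using factor_root[OF nv[OF fr]] by blast
  have "g \<noteq> 0" using g by auto
  then have "m \<le> degree (pev phi G)" unfolding g(1) by (subst degree_mult_eq) (auto simp: degree_power_eq)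
  also have "\<dots> \<le> 2 * d" using degree_pev[OF G, of phi 2] degree_phi r_le by (meson le_trans)
  finally have m: "2 * d = (2 * d - m) + m" by simp
  define U where "U = homogenize (lf X) (lf Y) (2 * d - m) g"
  obtain K where K: "inS K" "lf X ^ d * G = lf Y ^ m * U + q * K"
    using normal_form[OF G] unfolding g(1) U_def by (subst (asm) (2) m) (auto simp: homogenize_monom_mult)
  have "poly (pev phi l) 0 = 0" using l by (simp add: poly_pev phi0)
  then obtain h where h: "pev phi l = [:0, 1:] ^ 1 * h" by (auto simp: poly_eq_0_iff_dvd dvd_def)
  define V where "V = homogenize (lf X) (lf Y) 1 h"
  obtain K1 where K1: "inS K1" "lf X * l = lf Y * V + q * K1"
    using normal_form[OF l(1,2)] homogenize_monom_mult[of "lf X" "lf Y" 1 1 h] unfolding h V_def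
    by (auto simp: numeral_2_eq_2)
  have UV: "inS U" "inS V" by (simp_all add: U_def V_def)
  obtain K2 where K2: "inS K2" "(lf X * l) ^ m = (lf Y * V) ^ m + q * K2"
    using power_add_multiple[of "lf Y * V" K1 q m] K1 UV qS by auto
  define W where "W = V ^ m * lf X ^ d"
  define K3 where "K3 = U * K2 - V ^ m * K"
  have "(lf X * l) ^ m * U = V ^ m * (lf Y ^ m * U) + q * (U * K2)"
    unfolding K2(2) by (simp add: algebra_simps power_mult_distrib)
  also have "lf Y ^ m * U = lf X ^ d * G - q * K" using K(2) by simp
  finally have e: "(lf X * l) ^ m * U = W * G + q * K3"
    by (simp add: W_def K3_def algebra_simps)
  have WK: "inS W" "inS K3" using UV K K2 by (auto simp: W_def K3_def)
  \<comment> \<open>Squaring is needed because it is \<open>G ^ 2\<close> that is known to lie in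
    the ideal; the remaining terms are multiples of \<open>q\<close>.\<close>
  have "((lf X * l) ^ m * U) ^ 2 = W ^ 2 * G ^ 2 + (2 * W * G * K3 + q * K3 ^ 2) * q"
    unfolding e by (simp add: power2_eq_square algebra_simps)
  moreover have "((lf X * l) ^ m * U) ^ 2 = (lf X ^ m * U) ^ 2 * l ^ (m * 2)"
    by (simp add: power_mult_distrib power_mult)
  ultimately have "(lf X ^ m * U) ^ 2 * l ^ (m * 2) - (2 * W * G * K3 + q * K3 ^ 2) * q = W ^ 2 * G ^ 2"
    by (simp add: algebra_simps)
  also have "\<dots> \<in> J" using G2 WK by (intro J_mult) auto
  finally have fin: "(lf X ^ m * U) ^ 2 * l ^ (m * 2) - (2 * W * G * K3 + q * K3 ^ 2) * q \<in> J" .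
  \<comment> \<open>The point is \<open>A\<close>, where X = 1 and Y = 0, so only the pure power of
    \<open>X\<close> in \<open>U\<close> contributes; its coefficient is the nonzero constant term
    of \<open>g\<close>.\<close>
  have "ev x U = (\<Sum>i\<le>2 * d - m. if i = 0 then coeff g 0 else 0)"
    unfolding U_def homogenize_def using XA YA
    by (simp add: A[symmetric] power_0_left if_distrib[of "\<lambda>a. _ * a"] cong: if_cong)
  then have "ev x ((lf X ^ m * U) ^ 2) \<noteq> 0" using g(2) XA by (simp add: A)
  moreover have "inS (2 * W * G * K3 + q * K3 ^ 2)" "inS ((lf X ^ m * U) ^ 2)"
    using WK UV G qS inS_Const[of 2] Const_of_nat[of 2] by auto
  ultimately show ?thesis using fin by blast
qed

text \<open>Each component contributes a relation by which, up to a unit and modulo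
  \<open>J\<close>, a power of \<open>l\<close> is a multiple of that component. Multiplied
  together, these make a power of \<open>l\<close> a multiple of the whole curve, which lies in
  \<open>J\<close>: a local Nullstellensatz by hand.\<close>

lemma power_in_J:
  assumes A: "arr A" and x: "nz x" and fJ: "\<Prod>A \<in> J" and pJ: "\<And>k. k < 3 \<Longrightarrow> pd k (\<Prod>A) \<in> J"
    and l: "inS l" "homog 1 l" "ev x l = 0"
  shows "\<exists>M. l ^ M \<in> J"
proof -
  have one: "\<exists>s M e. inS s \<and> inS e \<and> ev x s \<noteq> 0 \<and> s * l ^ M - e * q \<in> J" if q: "q \<in> A" for q
  proof -
    obtain r where r: "component q r" using A q unfolding arr_def by blast
    obtain d where d: "homog d (\<Prod>(A - {q}))" using arr_prod_homog(1)[OF A] by blast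
    have "\<Prod>A = q * \<Prod>(A - {q})" using A q prod.remove[of A q "\<lambda>x. x"] by (simp add: arr_def)
    then show ?thesis
      using power_mod_component[OF r arr_prod_homog(2)[OF A] d x frame.pev_prod_nonzero[OF _ A q] _ _ l] fJ pJ
      by auto
  qed
  have "\<exists>s M e. inS s \<and> inS e \<and> ev x s \<noteq> 0 \<and> s * l ^ M - e * \<Prod>B \<in> J" if "finite B" "B \<subseteq> A" for B
    using that
  proof (induction B rule: finite_induct)
    case empty
    show ?case using J_0 by (intro exI[of _ 1] exI[of _ 0]) simp
  next
    case (insert q B)
    obtain s M e where a: "inS s" "inS e" "ev x s \<noteq> 0" "s * l ^ M - e * q \<in> J"
      using one[of q] insert by blast
    obtain s' M' e' where b: "inS s'" "inS e'" "ev x s' \<noteq> 0" "s' * l ^ M' - e' * \<Prod>B \<in> J"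
      using insert by blast
    have "s * l ^ M * (s' * l ^ M' - e' * \<Prod>B) + e' * \<Prod>B * (s * l ^ M - e * q) \<in> J"
      using a b l insert.prems arr_prod_homog(2)[OF A, of B] by (intro J_add J_mult) auto
    moreover have "s * l ^ M * (s' * l ^ M' - e' * \<Prod>B) + e' * \<Prod>B * (s * l ^ M - e * q) =
        (s * s') * l ^ (M + M') - (e * e') * \<Prod>(insert q B)"
      using insert by (simp add: algebra_simps power_add)
    ultimately show ?case using a b
      by (intro exI[of _ "s * s'"] exI[of _ "M + M'"] exI[of _ "e * e'"]) auto
  qed
  from this[of A] obtain s M e where s: "inS s" "inS e" "ev x s \<noteq> 0" "s * l ^ M - e * \<Prod>A \<in> J"
    using A by (auto simp: arr_def)
  then have "(s * l ^ M - e * \<Prod>A) + e * \<Prod>A \<in> J" using fJ by (intro J_add J_mult) auto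
  then have "s * l ^ M \<in> J" by simp
  then have "l ^ M \<in> J" using s l J_cancel[of "l ^ M" s] by auto
  then show ?thesis by blast
qed

text \<open>The set \<open>W\<close> of polynomials congruent to such a combination contains the
  constants and is closed under multiplication by variables: modulo \<open>J\<close> a variable is
  an affine function of \<open>l1\<close> and \<open>l2\<close>, and monomials outside the box lie
  in \<open>J\<close>.\<close>

lemma finite_span:
  assumes lin: "\<And>k. k < 3 \<Longrightarrow> \<exists>c c1 c2. Var k - (Const c + Const c1 * l1 + Const c2 * l2) \<in> J"
    and l: "inS l1" "inS l2" and M: "l1 ^ M \<in> J" "l2 ^ M \<in> J" and h: "inS h"
  shows "\<exists>c. h - (\<Sum>b\<in>{..<M} \<times> {..<M}. Const (c b) * (l1 ^ fst b * l2 ^ snd b)) \<in> J"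
proof -
  define B where "B = {..<M} \<times> {..<M}"
  define E where "E = (\<lambda>b. l1 ^ fst b * l2 ^ snd b)"
  define W where "W = {h. inS h \<and> (\<exists>c. h - (\<Sum>b\<in>B. Const (c b) * E b) \<in> J)}"
  have ES: "inS (E b)" for b using l by (auto simp: E_def)
  have W_J: "h \<in> W" if "h \<in> J" for h
    using that J_inS unfolding W_def by (intro CollectI conjI exI[of _ "\<lambda>_. 0"]) auto
  have W_add: "h + h' \<in> W" if hh: "h \<in> W" "h' \<in> W" for h h'
  proof -
    obtain c c' where c: "inS h" "inS h'" "h - (\<Sum>b\<in>B. Const (c b) * E b) \<in> J"
      "h' - (\<Sum>b\<in>B. Const (c' b) * E b) \<in> J" using hh by (auto simp: W_def)
    have e: "(h + h') - (\<Sum>b\<in>B. Const (c b + c' b) * E b) =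
      (h - (\<Sum>b\<in>B. Const (c b) * E b)) + (h' - (\<Sum>b\<in>B. Const (c' b) * E b))"
      by (simp add: Const_add algebra_simps sum.distrib)
    have "(h + h') - (\<Sum>b\<in>B. Const (c b + c' b) * E b) \<in> J" unfolding e by (rule J_add[OF c(3,4)])
    then show ?thesis unfolding W_def using c by (intro CollectI conjI exI[of _ "\<lambda>b. c b + c' b"]) auto
  qed
  have W_Const: "Const a * h \<in> W" if hh: "h \<in> W" for h a
  proof -
    obtain c where c: "inS h" "h - (\<Sum>b\<in>B. Const (c b) * E b) \<in> J" using hh by (auto simp: W_def)
    have e: "Const a * h - (\<Sum>b\<in>B. Const (a * c b) * E b) = Const a * (h - (\<Sum>b\<in>B. Const (c b) * E b))"
      by (simp add: Const_mult algebra_simps sum_distrib_left)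
    have "Const a * h - (\<Sum>b\<in>B. Const (a * c b) * E b) \<in> J" unfolding e using c by (intro J_mult) auto
    then show ?thesis unfolding W_def using c by (intro CollectI conjI exI[of _ "\<lambda>b. a * c b"]) auto
  qed
  have W_sum: "sum f I \<in> W" if "\<And>i. i \<in> I \<Longrightarrow> f i \<in> W" for I and f :: "nat \<times> nat \<Rightarrow> mpoly"
    using that by (induction I rule: infinite_finite_induct) (auto intro: W_add W_J J_0)
  have W_E: "E b \<in> W" for b
  proof (cases "b \<in> B")
    case True
    have "finite B" by (simp add: B_def)
    then have "E b - (\<Sum>b'\<in>B. Const (if b' = b then 1 else 0) * E b') = 0"
      using True by (simp add: if_distrib[of Const] if_distrib[of "\<lambda>a. a * _"] cong: if_cong)
    then have "E b - (\<Sum>b'\<in>B. Const (if b' = b then 1 else 0) * E b') \<in> J" using J_0 by simp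
    then show ?thesis unfolding W_def using ES by (intro CollectI conjI exI[of _ "\<lambda>b'. if b' = b then 1 else 0"])
  next
    case False
    then have "M \<le> fst b \<or> M \<le> snd b" by (cases b) (auto simp: B_def)
    then have "E b \<in> J"
    proof
      assume "M \<le> fst b"
      then have "l1 ^ fst b = l1 ^ (fst b - M) * l1 ^ M" by (simp flip: power_add)
      then have "E b = (l1 ^ (fst b - M) * l2 ^ snd b) * l1 ^ M" by (simp add: E_def)
      then show ?thesis using M l J_mult by auto
    next
      assume "M \<le> snd b"
      then have "E b = (l1 ^ fst b * l2 ^ (snd b - M)) * l2 ^ M"
        by (simp add: E_def mult.assoc flip: power_add)
      then show ?thesis using M l J_mult by auto
    qed
    then show ?thesis by (rule W_J)
  qed
  have W_Var: "Var k * h \<in> W" if hh: "h \<in> W" "k < 3" for h k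
  proof -
    obtain c where c: "inS h" "h - (\<Sum>b\<in>B. Const (c b) * E b) \<in> J" using hh by (auto simp: W_def)
    have VE: "Var k * E b \<in> W" for b
    proof -
      obtain a a1 a2 where a: "Var k - (Const a + Const a1 * l1 + Const a2 * l2) \<in> J"
        using lin hh(2) by blast
      have "Var k * E b = E b * (Var k - (Const a + Const a1 * l1 + Const a2 * l2)) + (Const a * E b
         + (Const a1 * E (Suc (fst b), snd b) + Const a2 * E (fst b, Suc (snd b))))"
        by (simp add: E_def algebra_simps)
      also have "\<dots> \<in> W" using a by (intro W_add W_Const W_E W_J J_mult ES)
      finally show ?thesis .
    qed
    have "Var k * h = Var k * (h - (\<Sum>b\<in>B. Const (c b) * E b)) + (\<Sum>b\<in>B. Const (c b) * (Var k * E b))"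
      by (simp add: algebra_simps sum_distrib_left)
    also have "\<dots> \<in> W" using c hh(2) by (intro W_add W_sum W_Const VE W_J J_mult) auto
    finally show ?thesis .
  qed
  have "h \<in> W" using h
  proof (induction h rule: inS_induct)
    case (Const c)
    then show ?case using W_Const[OF W_E[of "(0,0)"], of c] by (simp add: E_def)
  qed (auto intro: W_Var W_add)
  then show ?thesis by (simp add: W_def B_def E_def)
qed

end

section \<open>Homogenization in an affine chart\<close>

definition hg :: "nat \<Rightarrow> nat \<Rightarrow> mpoly \<Rightarrow> mpoly" where
  "hg j N p = (\<Sum>d\<le>N. Var j ^ (N - d) * hcomp d p)"

lemma hg_add: "hg j N (p + q) = hg j N p + hg j N q"
  by (simp add: hg_def hcomp_add algebra_simps sum.distrib)

lemma hg_0 [simp]: "hg j N 0 = 0"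
  by (simp add: hg_def)

lemma hg_sum: "hg j N (sum f I) = (\<Sum>i\<in>I. hg j N (f i))"
  by (induction I rule: infinite_finite_induct) (auto simp: hg_add)

lemma inS_hg [simp]: "inS p \<Longrightarrow> j < 3 \<Longrightarrow> inS (hg j N p)"
  unfolding hg_def by (intro inS_sum) auto

lemma homog_hg [simp]: "homog N (hg j N p)"
proof -
  have "homog N (Var j ^ (N - d) * hcomp d p)" if "d \<le> N" for d
    using that homog_power[OF homog_Var, of "N - d" j] by (intro homog_mult_eq[OF _ homog_hcomp]) auto
  then show ?thesis unfolding hg_def by (intro homog_sum) auto
qed

lemma hg_mult: assumes "homog k q" shows "hg j (N + k) (p * q) = hg j N p * q"
proof -
  have "hg j (N + k) (p * q) = (\<Sum>d\<in>{k..N + k}. Var j ^ (N + k - d) * (hcomp (d - k) p * q))"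
    unfolding hg_def hcomp_mult[OF assms] by (rule sum.mono_neutral_cong_right) auto
  also have "\<dots> = (\<Sum>d\<in>{0..N}. Var j ^ (N - d) * (hcomp d p * q))"
    using sum.shift_bounds_cl_nat_ivl[of "\<lambda>d. Var j ^ (N + k - d) * (hcomp (d - k) p * q)" 0 k N] by simp
  finally show ?thesis by (simp add: hg_def sum_distrib_right mult.assoc atLeast0AtMost)
qed

text \<open>Homogenizing turns x_j - 1 into 0. Because \<open>hg\<close> truncates, the two parts of
  the product cancel except for the component of \<open>c\<close> in degree N + 1, which therefore
  has to vanish.\<close>

lemma hg_Var_minus_1: assumes "hcomp (Suc N) c = 0" shows "hg j (Suc N) (c * (Var j - Const 1)) = 0"
proof -
  have "hg j (Suc N) (c * (Var j - Const 1)) + hg j (Suc N) c = hg j (N + 1) (c * Var j)"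
    by (simp add: algebra_simps flip: hg_add)
  also have "\<dots> = hg j N c * Var j" by (rule hg_mult) simp
  also have "hg j (Suc N) c = hg j N c * Var j"
    using assms by (simp add: hg_def sum_distrib_left sum_distrib_right Suc_diff_le algebra_simps)
  finally show ?thesis by simp
qed

lemma ev_hg: assumes "x j = 1" shows "ev x (hg j N p) = ev x (\<Sum>d\<le>N. hcomp d p)"
  using assms by (simp add: hg_def)

text \<open>The derivation \<open>X\<close> is the homogenization of a local relation \<open>f \<in> (\<partial>\<^sub>a f, \<partial>\<^sub>b f)\<close>
  in the chart \<open>x\<^sub>j = 1\<close>.\<close>

lemma qh_derivation:
  assumes A: "arr A" and v: "v \<noteq> (0,0,0)" and qh: "qh_point (\<Prod>A) v"
  obtains j N X S where "j < 3" "coord v j \<noteq> 0" "X j = 0"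
    "\<And>k. k < 3 \<Longrightarrow> inS (X k) \<and> homog (Suc N) (X k)" "inS S" "homog N S"
    "(\<Sum>k<3. X k * pd k (\<Prod>A)) = S * \<Prod>A" "ev (coord v) S \<noteq> 0"
proof -
  define f where "f = \<Prod>A"
  obtain D where D: "homog D f" using arr_prod_homog(1)[OF A] unfolding f_def by blast
  have D0: "D > 0" using arr_degree_pos[OF A] D by (simp add: f_def)
  have fS: "inS f" using arr_prod_homog(2)[OF A] by (simp add: f_def)
  obtain j where j: "j < 3" "coord v j \<noteq> 0"
  proof -
    have "coord v 0 \<noteq> 0 \<or> coord v 1 \<noteq> 0 \<or> coord v 2 \<noteq> 0"
      using v by (cases v) (auto simp: coord_def)
    then show ?thesis using that[of 0] that[of 1] that[of 2] by auto
  qed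
  define w where "w = chart_pt v j"
  have cw: "coord w k = 1 / coord v j * coord v k" for k
    by (simp add: w_def chart_pt_def Let_def coord_def)
  have wj: "coord w j = 1" using j by (simp add: cw)
  have nzw: "nz (coord w)" using j wj by (auto simp: nz_def)
  define gsM where "gsM = [Var j - Const 1] @ [pd k f. k \<leftarrow> [0,1,2], k \<noteq> j]"
  define gsT where "gsT = [Var j - Const 1, f] @ [pd k f. k \<leftarrow> [0,1,2], k \<noteq> j]"
  define M where "M = loc_ideal (ideal_gen gsM) w"
  define T where "T = loc_ideal (ideal_gen gsT) w"
  have eq: "quot_dim M = quot_dim T"
    using qh j unfolding qh_point_def milnor_def tjurina_def M_def T_def gsM_def gsT_def w_def f_def by blast
  have gS: "inS g" if "g \<in> set gsT" for g
    using that fS j by (auto simp: gsT_def split: if_splits)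
  interpret T: loc_id T "coord w" unfolding T_def by (rule loc_id_loc_ideal)
  have MT: "M \<subseteq> T" unfolding M_def T_def by (rule loc_ideal_mono[OF _ gS]) (auto simp: gsM_def gsT_def)
  have gT: "g \<in> T" if "g \<in> set gsT" for g
    unfolding T_def using gen_in_loc_ideal[OF that gS[OF that]] .
  have fT: "f \<in> T" and jT: "Var j - Const 1 \<in> T" by (auto intro!: gT simp: gsT_def)
  have pT': "pd k f \<in> T" if "k < 3" "k \<noteq> j" for k
    using that by (intro gT) (auto simp: gsT_def less_3_cases)
  \<comment> \<open>The ideal is generated without the derivative in direction \<open>j\<close>; the
    Euler relation recovers it, because x_j is a unit at the chart point.\<close>
  have pT: "pd k f \<in> T" if "k < 3" for k
  proof (cases "k = j")
    case True
    have "Var j * pd j f = of_nat D * f - (\<Sum>i\<in>{..<3} - {j}. Var i * pd i f)"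
      using euler[OF fS D] j by (simp add: sum.remove[of "{..<3}" j] eq_diff_eq)
    also have "\<dots> \<in> T" using fT pT' by (intro T.J_diff T.J_mult T.J_sum) auto
    finally show ?thesis using True T.J_cancel[of "pd j f" "Var j"] wj j fS by auto
  qed (use that pT' in auto)
  define l where "l = (\<lambda>k. Var k - Const (coord w k) * Var j)"
  have lS: "inS (l k)" "homog 1 (l k)" "ev (coord w) (l k) = 0" if "k < 3" for k
    using that j wj by (auto simp: l_def intro!: homog_diff homog_Const_mult)
  have "\<exists>M. l k ^ M \<in> T" if "k < 3" for k
    using T.power_in_J[OF A nzw _ _ lS[OF that]] fT pT by (auto simp: f_def)
  then obtain m where m: "\<And>k. k < 3 \<Longrightarrow> l k ^ m k \<in> T" by metis
  obtain a b where ab: "a < 3" "b < 3" "\<And>k. k < 3 \<Longrightarrow> k = a \<or> k = b \<or> k = j"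
  proof (cases "j = 0")
    case True then show ?thesis by (intro that[of 1 2]) auto
  next
    case False
    then show ?thesis using j by (intro that[of 0 "3 - j"]) auto
  qed
  define n where "n = max (m a) (m b)"
  have pw: "l a ^ n \<in> T" "l b ^ n \<in> T"
  proof -
    have "l k ^ (m k + i) \<in> T" if "k < 3" for k i
      using T.J_mult[OF _ m[OF that], of "l k ^ i"] lS[OF that] by (simp add: power_add mult.commute)
    from this[OF ab(1), of "n - m a"] this[OF ab(2), of "n - m b"] show "l a ^ n \<in> T" "l b ^ n \<in> T"
      by (simp_all add: n_def)
  qed
  have lin: "\<exists>c c1 c2. Var k - (Const c + Const c1 * l a + Const c2 * l b) \<in> T" if k: "k < 3" for k
  proof -
    have e: "Var k - (Const (coord w k) + l k) \<in> T"
      using T.J_mult[OF _ jT, of "Const (coord w k)"] by (simp add: l_def algebra_simps)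
    consider "k = a" | "k = b" | "k = j" using ab(3)[OF k] by blast
    then show ?thesis
    proof cases
      case 1 then show ?thesis using e by (intro exI[of _ "coord w k"] exI[of _ 1] exI[of _ 0]) simp
    next
      case 2 then show ?thesis using e by (intro exI[of _ "coord w k"] exI[of _ 0] exI[of _ 1]) simp
    next
      case 3 then show ?thesis using jT by (intro exI[of _ 1] exI[of _ 0]) simp
    qed
  qed
  have bound: "length vs \<le> card ({..<n} \<times> {..<n})" if "lin_indep T vs" for vs
    by (rule T.lin_indep_length_le[OF _ _ that], simp)
       (rule T.finite_span[OF lin _ _ pw], use lS ab in auto)
  have fM: "f \<in> M"
    by (rule mem_of_quot_dim_eq[OF _ _ MT fT eq bound])
       (auto simp: M_def T_def intro: loc_id_loc_ideal)
  then obtain s c' where s: "inS s" "ev (coord w) s \<noteq> 0" "\<forall>i<length gsM. inS (c' i)"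
    "s * f = (\<Sum>i<length gsM. c' i * gsM ! i)"
    unfolding M_def loc_ideal_def mp_eval_ev ideal_gen_iff by auto
  \<comment> \<open>The generators skip direction \<open>j\<close>, so the coefficients are
    renumbered by direction and \<open>c j\<close> is set to 0. The derivation then has no component
    in direction \<open>j\<close>, which later removes its Euler part at the point.\<close>
  obtain c0 c where c: "\<And>k. k < 3 \<Longrightarrow> inS (c k)" "c j = 0" "s * f = c0 * (Var j - Const 1) + (\<Sum>k<3. c k * pd k f)"
  proof -
    have len: "length gsM = 3" using j by (auto simp: gsM_def less_3_cases)
    consider "j = 0" | "j = 1" | "j = 2" using j by linarith
    then show ?thesis
    proof cases
      case 1 then show ?thesis
        using s(3,4) unfolding len by (intro that[of "\<lambda>k. if k = 0 then 0 else if k = 1 then c' 1 else c' 2" "c' 0"])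
          (auto simp: gsM_def sum_3)
    next
      case 2 then show ?thesis
        using s(3,4) unfolding len by (intro that[of "\<lambda>k. if k = 0 then c' 1 else if k = 1 then 0 else c' 2" "c' 0"])
          (auto simp: gsM_def sum_3)
    next
      case 3 then show ?thesis
        using s(3,4) unfolding len by (intro that[of "\<lambda>k. if k = 0 then c' 1 else if k = 1 then c' 2 else 0" "c' 0"])
          (auto simp: gsM_def sum_3)
    qed
  qed
  obtain N1 where N1: "\<And>n. N1 \<le> n \<Longrightarrow> (\<Sum>d\<le>n. hcomp d s) = s" using hcomp_decomp[of s] by blast
  obtain N2 where N2: "\<And>n. N2 \<le> n \<Longrightarrow> hcomp n c0 = 0" using hcomp_decomp[of c0] by blast
  \<comment> \<open>Large enough for \<open>S\<close> to retain all of \<open>s\<close> and for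
    \<open>c0\<close> to have no component in the critical degree of
    \<open>hg_Var_minus_1\<close>.\<close>
  define N where "N = max N1 N2"
  define S where "S = hg j N s"
  define X where "X = (\<lambda>k. hg j (Suc N) (c k))"
  have "S * f = hg j (N + D) (s * f)" unfolding S_def by (rule hg_mult[OF D, symmetric])
  also have "\<dots> = hg j (N + D) (c0 * (Var j - Const 1)) + (\<Sum>k<3. hg j (N + D) (c k * pd k f))"
    unfolding c(3) by (simp add: hg_add hg_sum)
  also have "hg j (N + D) (c0 * (Var j - Const 1)) = 0"
    using hg_Var_minus_1[of "N + D - 1" c0 j] N2[of "N + D"] D0 by (simp add: N_def)
  also have "(\<Sum>k<3. hg j (N + D) (c k * pd k f)) = (\<Sum>k<3. X k * pd k f)"
    using D0 hg_mult[OF homog_pd[OF fS D], of _ j "Suc N"] by (intro sum.cong) (auto simp: X_def)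
  finally have rel: "(\<Sum>k<3. X k * pd k f) = S * f" by simp
  have SS: "inS S" "homog N S" using s j by (auto simp: S_def)
  have "ev (coord w) S = ev (coord w) s"
    unfolding S_def ev_hg[of "coord w", OF wj] using N1[of N] by (simp add: N_def)
  \<comment> \<open>\<open>S\<close> is a form, so its nonvanishing passes from the chart point back
    to \<open>v\<close>.\<close>
  moreover have "ev (coord w) S = (1 / coord v j) ^ N * ev (coord v) S"
    using ev_scale[OF SS, of "1 / coord v j" "coord v"] by (simp add: cw[abs_def])
  ultimately have "ev (coord v) S \<noteq> 0" using s by auto
  then show ?thesis
    using rel SS c j by (intro that[of j X N S]) (auto simp: X_def f_def)
qed

section \<open>Derivations along a component\<close>

definition act :: "(nat \<Rightarrow> mpoly) \<Rightarrow> mpoly \<Rightarrow> mpoly" where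
  "act \<theta> p = (\<Sum>k<3. \<theta> k * pd k p)"

lemma act_mult: "act \<theta> (p * q) = act \<theta> p * q + p * act \<theta> q"
  by (simp add: act_def sum_3 pd_mult algebra_simps)

lemma inS_act: "(\<And>k. k < 3 \<Longrightarrow> inS (\<theta> k)) \<Longrightarrow> inS p \<Longrightarrow> inS (act \<theta> p)"
  unfolding act_def by (intro inS_sum) auto

lemma homog_act:
  assumes "\<And>k. k < 3 \<Longrightarrow> homog e (\<theta> k)" "inS p" "homog d p"
  shows "homog (e + (d - 1)) (act \<theta> p)"
  unfolding act_def using assms by (intro homog_sum homog_mult homog_pd) auto

text \<open>Differentiating the relation at a common zero of \<open>c\<close> and
  \<open>\<theta>\<close> shows that the gradient of \<open>c\<close> is an eigenvector of the
  linear part of \<open>\<theta>\<close>; up to the factor \<open>u\<close>, the value of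
  \<open>K\<close> is its eigenvalue.\<close>

lemma act_grad:
  assumes "u * act \<theta> c = c * K" "ev x c = 0" "\<And>k. k < 3 \<Longrightarrow> ev x (\<theta> k) = 0"
  shows "ev x u * (\<Sum>k<3. ev x (pd l (\<theta> k)) * ev x (pd k c)) = ev x K * ev x (pd l c)"
proof -
  have "ev x (pd l (u * act \<theta> c)) = ev x (pd l (c * K))" using assms(1) by simp
  then show ?thesis using assms(2,3) by (simp add: act_def sum_3 pd_mult pd_add algebra_simps)
qed

text \<open>At a zero of order m of \<open>g\<close> the logarithmic derivative g'/g has a simple
  pole with residue m. Since w g'/g is the polynomial \<open>k\<close>, the pole must be cancelled
  by a zero of \<open>w\<close>, and comparing values gives the second claim.\<close>

lemma root_residue:
  fixes w g k :: "complex poly"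
  assumes "w * pderiv g = k * g" "g \<noteq> 0" "poly g t = 0"
  shows "poly w t = 0" "\<exists>m>0. of_nat m * poly (pderiv w) t = poly k t"
proof -
  define m where "m = order t g"
  obtain h where h: "g = [:- t, 1:] ^ m * h" "\<not> [:- t, 1:] dvd h"
    using order_decomp[OF assms(2), of t] by (auto simp: m_def)
  have ht: "poly h t \<noteq> 0" using h(2) poly_eq_0_iff_dvd by blast
  have m: "m > 0" using assms(2,3) order_root[of g t] by (auto simp: m_def)
  then obtain n where n: "m = Suc n" by (cases m) auto
  let ?l = "[:- t, 1:]"
  have "pderiv g = ?l ^ n * (of_nat m * h + ?l * pderiv h)"
    unfolding h(1) n by (simp only: pderiv_mult pderiv_power_Suc) (simp add: pderiv_pCons algebra_simps of_nat_poly)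
  then have "?l ^ n * (w * (of_nat m * h + ?l * pderiv h)) = w * pderiv g"
    by (simp only: mult_ac)
  also have "\<dots> = k * g" by (rule assms(1))
  also have "\<dots> = ?l ^ n * (k * (?l * h))"
    by (subst h(1)) (simp only: n power_Suc mult_ac)
  finally have "?l ^ n * (w * (of_nat m * h + ?l * pderiv h)) = ?l ^ n * (k * (?l * h))" .
  then have e: "w * (of_nat m * h + ?l * pderiv h) = k * (?l * h)" by simp
  from arg_cong[OF this, of "\<lambda>p. poly p t"] show w: "poly w t = 0" using ht m by simp
  then obtain w1 where w1: "w = ?l * w1" by (auto simp: poly_eq_0_iff_dvd dvd_def)
  have "?l * (w1 * (of_nat m * h + ?l * pderiv h)) = ?l * (k * h)"
    using e unfolding w1 by (simp only: mult_ac)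
  then have "w1 * (of_nat m * h + ?l * pderiv h) = k * h"
    by (simp only: mult_cancel_left) simp
  from arg_cong[OF this, of "\<lambda>p. poly p t"] have "of_nat m * poly w1 t = poly k t" using ht by (simp add: mult.commute)
  moreover have "poly (pderiv w) t = poly w1 t" unfolding w1 pderiv_mult by (simp add: pderiv_pCons)
  ultimately show "\<exists>m>0. of_nat m * poly (pderiv w) t = poly k t" using m by auto
qed

lemma cr_dot_self: "(\<Sum>k<3. cr u v k * v k) = 0" for u v :: "nat \<Rightarrow> 'a::comm_ring_1"
  by (simp add: cr_def sum_3 algebra_simps)

context frame
begin

lemma component_q: assumes "component q r'" shows "r' = r"
proof -
  obtain m where "m \<in> mkeys q" using assms by (metis all_not_in_conv component_def keys_eq_empty)
  moreover have "homog r' q" using assms by (simp add: component_def)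
  ultimately show ?thesis using homog_q homog_mdeg by metis
qed

lemma pev_act: "pev phi (act \<theta> p) = (\<Sum>k<3. pev phi (pd k p) * pev phi (\<theta> k))"
  by (simp add: act_def mult.commute)

text \<open>By the chain rule the part along phi' differentiates the restriction of
  \<open>p\<close>; by the Euler relation the part along phi multiplies it by the degree.\<close>

lemma tangent_chain:
  assumes "tangent U" "inS p" "homog d p"
  shows "(\<Sum>k<3. pev phi (pd k p) * U k) = wt U * pderiv (pev phi p) + of_nat d * bt U * pev phi p"
proof -
  have "(\<Sum>k<3. pev phi (pd k p) * U k) =
      (\<Sum>k<3. wt U * (pev phi (pd k p) * pderiv (phi k)) + bt U * pev phi (Var k * pd k p))"
    by (intro sum.cong refl) (subst tangent_decomp[OF assms(1)], auto simp: algebra_simps)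
  also have "\<dots> = wt U * pderiv (pev phi p) + bt U * pev phi (\<Sum>k<3. Var k * pd k p)"
    unfolding pderiv_pev[OF assms(2)] sum.distrib by (simp add: sum_distrib_left)
  finally show ?thesis unfolding euler[OF assms(2,3)] by (simp add: algebra_simps)
qed

lemma nonpar_phi: "nonpar (\<lambda>i. poly (phi i) t) (\<lambda>i. poly (pderiv (phi i)) t)"
proof (rule ccontr)
  let ?u = "\<lambda>i. poly (phi i) t" and ?v = "\<lambda>i. poly (pderiv (phi i)) t"
  have e: "dot V ?u = poly (pev phi (lf V)) t" "dot V ?v = poly (pderiv (pev phi (lf V))) t" for V
    by (simp_all add: lf_def dot_def sum_3 pderiv_add pderiv_smult)
  assume "\<not> nonpar ?u ?v"
  moreover have "nz ?u" using e(1)[of X] by (auto simp: nz_iff dot_def sum_3)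
  ultimately obtain c where "\<And>i. i < 3 \<Longrightarrow> ?v i = c * ?u i" using not_nonpar by blast
  then have d: "dot V ?v = c * dot V ?u" for V by (simp add: dot_def sum_3 algebra_simps)
  from d[of X] d[of Y] show False by (simp add: e pev_Y pderiv_pCons)
qed

text \<open>The cross product with the gradient kills \<open>q\<close>, and the factor
  \<open>G\<close> makes the derivation preserve \<open>G\<close>. The constant vector
  \<open>n\<close> decides where on the curve it vanishes in addition.\<close>

definition koszul :: "(nat \<Rightarrow> complex) \<Rightarrow> mpoly \<Rightarrow> nat \<Rightarrow> mpoly" where
  "koszul n G k = G * cr (\<lambda>i. Const (n i)) (\<lambda>i. pd i q) k"

lemma koszul_q: "act (koszul n G) q = 0"
proof -
  have "act (koszul n G) q = G * (\<Sum>k<3. cr (\<lambda>i. Const (n i)) (\<lambda>i. pd i q) k * pd k q)"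
    by (simp add: act_def koszul_def sum_distrib_left mult.assoc)
  then show ?thesis by (simp add: cr_dot_self)
qed

lemma inS_cr: "k < 3 \<Longrightarrow> inS (cr (\<lambda>i. Const (n i)) (\<lambda>i. pd i q) k)"
  by (auto simp: cr_def)

lemma homog_cr: "k < 3 \<Longrightarrow> homog (r - 1) (cr (\<lambda>i. Const (n i)) (\<lambda>i. pd i q) k)"
  using homog_pd[OF inS_q homog_q] by (auto simp: cr_def intro!: homog_diff homog_Const_mult)

lemma koszul_G: "act (koszul n G) G = act (cr (\<lambda>i. Const (n i)) (\<lambda>i. pd i q)) G * G"
  by (simp add: act_def koszul_def sum_3 algebra_simps)

text \<open>Expansion of the triple product (a x b) x grad q.\<close>

lemma pev_koszul: assumes "k < 3"
  shows "pev phi (koszul (cr a b) G k) = pev phi G *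
    ([:b k:] * dot (\<lambda>i. [:a i:]) (\<lambda>i. pev phi (pd i q)) - [:a k:] * dot (\<lambda>i. [:b i:]) (\<lambda>i. pev phi (pd i q)))"
  using assms by (auto simp: less_3_cases koszul_def cr_def dot_def sum_3 algebra_simps
      smult_diff_left smult_diff_right smult_add_right)

lemma dot_grad:
  "dot (\<lambda>i. [:V i:]) (\<lambda>i. pev phi (pd i q)) =
     smult \<kappa> (if r = 1 then [:dot Z V:] else [:- dot Z V, 2 * dot Y V, - dot X V:])"
  by (simp add: dot_def sum_3 pev_pd_q algebra_simps)

text \<open>For the witness \<open>cr C B\<close> the triple product is a constant times phi', on
  the line as on the conic. The vector field is thus G d/dt up to a constant, and at finite
  parameters it vanishes only where \<open>G\<close> does.\<close>

lemma koszul_wt_finite: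
  "\<exists>c n. c \<noteq> 0 \<and> wt (\<lambda>i. pev phi (koszul n G i)) = smult c (pev phi G)"
proof -
  define c where "c = (if r = 1 then \<kappa> else - \<kappa>)"
  have "pev phi (koszul (cr C B) G k) = (pev phi G * [:c:]) * pderiv (phi k)" if "k < 3" for k
    unfolding pev_koszul[OF that] dot_grad
    by (simp add: XB XC YB YC ZB ZC c_def phi_def pderiv_pCons algebra_simps numeral_poly smult_add_right)
  then have "wt (\<lambda>i. pev phi (koszul (cr C B) G i)) = wt (\<lambda>i. (pev phi G * [:c:]) * pderiv (phi i))"
    by (simp add: wt_def dot_def sum_3)
  then show ?thesis using \<kappa> unfolding wt_mult wt_pderiv_phi
    by (intro exI[of _ c] exI[of _ "cr C B"]) (auto simp: c_def)
qed

text \<open>The mirror image, with the points 0 and infinity exchanged. The additional zeros now sit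
  at t = 0, and the degree is maximal whenever \<open>G\<close> does not vanish at infinity.\<close>

lemma koszul_wt_infinite:
  "\<exists>c n. c \<noteq> 0 \<and> wt (\<lambda>i. pev phi (koszul n G i)) = smult c ([:0, 1:] ^ r * pev phi G)"
proof -
  have w: "wt (\<lambda>i. pev phi (koszul (cr a b) G i)) = pev phi G * ((smult (dot Y b) 1 - [:0, dot X b:]) *
     dot (\<lambda>i. [:a i:]) (\<lambda>i. pev phi (pd i q)) - (smult (dot Y a) 1 - [:0, dot X a:]) *
     dot (\<lambda>i. [:b i:]) (\<lambda>i. pev phi (pd i q)))" for a b
  proof -
    define s t where "s = dot (\<lambda>i. [:a i:]) (\<lambda>i. pev phi (pd i q))" and "t = dot (\<lambda>i. [:b i:]) (\<lambda>i. pev phi (pd i q))"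
    have dk: "dot (\<lambda>i. [:V i:]) (\<lambda>i. pev phi (koszul (cr a b) G i)) = pev phi G * (smult (dot V b) s - smult (dot V a) t)" for V
    proof -
      have "dot (\<lambda>i. [:V i:]) (\<lambda>i. pev phi (koszul (cr a b) G i)) =
        dot (\<lambda>i. [:V i:]) (\<lambda>i. pev phi G * ([:b i:] * s - [:a i:] * t))"
        unfolding dot_def s_def[unfolded dot_def] t_def[unfolded dot_def]
        by (intro sum.cong refl) (subst pev_koszul, auto simp: dot_def)
      then show ?thesis by (simp add: dot_def sum_3 algebra_simps smult_add_left smult_add_right smult_diff_right)
    qed
    show ?thesis unfolding wt_def s_def[symmetric] t_def[symmetric] dk
      by (simp add: algebra_simps smult_add_left smult_diff_right)
  qed
  show ?thesis
  proof (cases "r = 1")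
    case True
    then show ?thesis using \<kappa> w[of C A] unfolding dot_grad
      by (intro exI[of _ "- \<kappa>"] exI[of _ "cr C A"]) (simp add: XA XB XC YA YB YC ZA ZB ZC algebra_simps)
  next
    case False
    then have "r = 2" using q_cases by auto
    then show ?thesis using \<kappa> w[of A B] unfolding dot_grad
      by (intro exI[of _ \<kappa>] exI[of _ "cr A B"])
         (simp add: XA XB XC YA YB YC ZA ZB ZC algebra_simps power2_eq_square flip: smult_add_left)
  qed
qed

end

section \<open>A component together with the rest of the arrangement\<close>

locale arr_frame = frame +
  fixes F :: "mpoly set"
  assumes F: "arr F" and qF: "q \<in> F"
begin

definition G where "G = \<Prod>(F - {q})"
definition gam where "gam = pev phi G"
definition dG where "dG = (SOME d. homog d G)"

abbreviation Wt :: "(nat \<Rightarrow> mpoly) \<Rightarrow> complex poly" where "Wt \<theta> \<equiv> wt (\<lambda>i. pev phi (\<theta> i))"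
abbreviation tang :: "(nat \<Rightarrow> mpoly) \<Rightarrow> bool" where "tang \<theta> \<equiv> tangent (\<lambda>i. pev phi (\<theta> i))"

lemma f_eq: "\<Prod>F = q * G"
  using F qF prod.remove[of F q "\<lambda>x. x"] by (simp add: arr_def G_def)

lemma G_inS [simp]: "inS G" and G_homog: "homog dG G"
  using arr_prod_homog[OF F, of "F - {q}"] unfolding dG_def G_def by (auto intro: someI)

lemma gam_nz: "gam \<noteq> 0"
  unfolding gam_def G_def using pev_prod_nonzero[OF F qF] by blast

lemma comp: "component q r"
  using F qF component_q unfolding arr_def by blast

lemma q_nz: "q \<noteq> 0" using comp by (simp add: component_def)

lemma tang_of_log: assumes "act \<theta> (\<Prod>F) = K * \<Prod>F" shows "tang \<theta>"
proof -
  have "pev phi (act \<theta> q) * gam = 0"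
    using arg_cong[OF assms, of "pev phi"] unfolding f_eq act_mult by (simp add: gam_def)
  then show ?thesis using gam_nz unfolding tangent_def pev_act by simp
qed

text \<open>Tangency makes \<theta>(q) divisible by \<open>q\<close> up to a power of
  \<open>lf X\<close>; cancelling \<open>q\<close> in the product rule shows that \<theta>(G) is
  divisible by \<open>G\<close> with the same denominator. On the curve the denominator is 1, and
  \<open>tangent_chain\<close> gives a relation to which \<open>root_residue\<close>
  applies.\<close>

lemma log_relation:
  assumes \<theta>: "\<And>k. k < 3 \<Longrightarrow> inS (\<theta> k)" "\<And>k. k < 3 \<Longrightarrow> homog e (\<theta> k)"
    and K: "act \<theta> (\<Prod>F) = K * \<Prod>F"
  obtains K1 n where "inS K1" "lf X ^ n * act \<theta> q = q * K1"
    "Wt \<theta> * pderiv gam = (pev phi K - pev phi K1 - of_nat dG * bt (\<lambda>i. pev phi (\<theta> i))) * gam"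
    "lf X ^ n * act \<theta> G = (lf X ^ n * K - K1) * G"
proof -
  have t: "tang \<theta>" by (rule tang_of_log[OF K])
  then have "pev phi (act \<theta> q) = 0" unfolding pev_act tangent_def .
  then obtain K1 where K1: "inS K1" "lf X ^ (e + (r - 1)) * act \<theta> q = q * K1"
    using local_division[OF inS_act homog_act, of \<theta> q e r] \<theta> homog_q by auto
  define u where "u = lf X ^ (e + (r - 1))"
  have "q * (K1 * G + u * act \<theta> G) = u * act \<theta> q * G + q * (u * act \<theta> G)"
    using K1(2) by (simp add: u_def algebra_simps)
  also have "\<dots> = u * act \<theta> (\<Prod>F)" by (simp add: f_eq act_mult algebra_simps)
  also have "\<dots> = q * (u * K * G)" unfolding K by (simp add: f_eq algebra_simps)
  finally have "K1 * G + u * act \<theta> G = u * K * G"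
    using q_nz by (simp only: mult_cancel_left) simp
  then have e: "u * act \<theta> G = (u * K - K1) * G"
    by (simp add: algebra_simps eq_diff_eq)
  have "pev phi (act \<theta> G) = (pev phi K - pev phi K1) * gam"
    using arg_cong[OF e, of "pev phi"] by (simp add: u_def gam_def)
  then have "Wt \<theta> * pderiv gam + of_nat dG * bt (\<lambda>i. pev phi (\<theta> i)) * gam = (pev phi K - pev phi K1) * gam"
    using tangent_chain[OF t G_inS G_homog] unfolding pev_act gam_def by simp
  then show ?thesis using that[OF K1] e by (simp add: algebra_simps u_def)
qed

lemma Wt_root:
  assumes "\<And>k. k < 3 \<Longrightarrow> inS (\<theta> k)" "\<And>k. k < 3 \<Longrightarrow> homog e (\<theta> k)" "act \<theta> (\<Prod>F) = K * \<Prod>F"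
    "poly gam t = 0"
  shows "poly (Wt \<theta>) t = 0"
  using log_relation[OF assms(1-3)] root_residue(1)[OF _ gam_nz assms(4)] by metis

text \<open>Along the component, the derivation \<open>\<theta>\<close> has eigenvalue \<open>poly (pderiv (Wt \<theta>)) t\<close> at a zero;
  for another component \<open>c\<close> through that point, \<open>K\<close> (normalized by \<open>u\<close>) is the conormal eigenvalue,
  and the two differ by the intersection multiplicity.\<close>

lemma eigenvalue_relation:
  assumes "tang \<theta>" "poly (Wt \<theta>) t = 0" "poly (bt (\<lambda>i. pev phi (\<theta> i))) t = 0"
    and c: "inS c" "homog d c" "pev phi c \<noteq> 0" "poly (pev phi c) t = 0"
    and u: "u * act \<theta> c = c * K"
  shows "\<exists>m>0. of_nat m * (poly (pev phi u) t * poly (pderiv (Wt \<theta>)) t) = poly (pev phi K) t"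
proof -
  have "pev phi u * pev phi (act \<theta> c) = pev phi c * pev phi K"
    using arg_cong[OF u, of "pev phi"] by simp
  then have "(pev phi u * Wt \<theta>) * pderiv (pev phi c) =
      (pev phi K - of_nat d * bt (\<lambda>i. pev phi (\<theta> i)) * pev phi u) * pev phi c"
    using tangent_chain[OF assms(1) c(1,2)] unfolding pev_act by (simp add: algebra_simps)
  from root_residue(2)[OF this c(3,4)] show ?thesis
    using assms(2,3) by (simp add: pderiv_mult)
qed

text \<open>Start from the \<open>\<theta>\<close> of \<open>qh_derivation\<close>, which vanishes at the point \<open>x\<close>. If its eigenvalue along \<open>q\<close>
  is zero, then so are the conormal eigenvalues of all other components through \<open>x\<close>, while that of \<open>q\<close>
  is \<open>S(x) \<noteq> 0\<close>. By \<open>eigenvalue_relation\<close> along another component \<open>c\<close>, there is no third component,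
  and comparing gradients, \<open>c\<close> is transversal to \<open>q\<close>. At such a node a Koszul derivation does the job.\<close>

lemma local_generator:
  assumes qh: "\<And>v. is_singular_pt (\<Prod>F) v \<Longrightarrow> qh_point (\<Prod>F) v"
  shows "\<exists>\<theta> K e. (\<forall>k<3. inS (\<theta> k) \<and> homog e (\<theta> k)) \<and> inS K \<and> act \<theta> (\<Prod>F) = K * \<Prod>F \<and>
    (if poly gam t = 0 then poly (pderiv (Wt \<theta>)) t \<noteq> 0 else poly (Wt \<theta>) t \<noteq> 0)"
proof -
  have koszul: ?thesis if simple: "poly gam t = 0 \<Longrightarrow> poly (pderiv gam) t \<noteq> 0"
  proof -
    obtain c n where cn: "c \<noteq> 0" "wt (\<lambda>i. pev phi (koszul n G i)) = smult c (pev phi G)"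
      using koszul_wt_finite by blast
    define K where "K = act (cr (\<lambda>i. Const (n i)) (\<lambda>i. pd i q)) G"
    have "act (koszul n G) (\<Prod>F) = K * \<Prod>F"
      by (simp add: f_eq act_mult koszul_q koszul_G K_def algebra_simps)
    moreover have "inS K" unfolding K_def by (intro inS_act inS_cr) auto
    moreover have "\<forall>k<3. inS (koszul n G k) \<and> homog (dG + (r - 1)) (koszul n G k)"
      unfolding koszul_def using inS_cr homog_cr G_homog by (auto intro!: homog_mult)
    moreover have "if poly gam t = 0 then poly (pderiv (Wt (koszul n G))) t \<noteq> 0 else poly (Wt (koszul n G)) t \<noteq> 0"
      unfolding cn(2) using cn(1) simple by (simp add: gam_def[symmetric] pderiv_smult)
    ultimately show ?thesis by blast
  qed
  show ?thesis
  proof (cases "poly gam t = 0")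
    case False
    then show ?thesis using koszul by blast
  next
    case g0: True
    define x where "x = (\<lambda>i. poly (phi i) t)"
    define v where "v = (x 0, x 1, x 2)"
    have cv: "coord v i = x i" if "i < 3" for i using that by (auto simp: v_def coord_def less_3_cases)
    have evv: "ev (coord v) p = ev x p" if "inS p" for p using ev_cong[OF that cv] by simp
    have evx: "poly (pev phi p) t = ev x p" if "inS p" for p using poly_pev[OF that, of phi t] by (simp add: x_def)
    have x_np: "nonpar x (\<lambda>i. poly (pderiv (phi i)) t)" using nonpar_phi by (simp add: x_def)
    have nzx: "nz x" using nonpar_nz(1)[OF x_np] .
    have v0: "v \<noteq> (0,0,0)" using nzx by (auto simp: v_def nz_iff)
    have qx: "ev x q = 0" using evx[OF inS_q] by simp
    have Gx: "ev x G = 0" using evx[OF G_inS] g0 by (simp add: gam_def)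
    have fS: "inS (\<Prod>F)" by (simp add: f_eq)
    have "ev x (\<Prod>F) = 0" "ev x (pd i (\<Prod>F)) = 0" for i
      unfolding f_eq pd_mult using qx Gx by simp_all
    then have sing: "is_singular_pt (\<Prod>F) v"
      unfolding is_singular_pt_def mp_eval_ev using v0 evv[OF fS] evv[OF inS_pd[OF fS]] by simp
    obtain j N \<theta> S where \<theta>: "j < 3" "coord v j \<noteq> 0" "\<theta> j = 0"
      "\<And>k. k < 3 \<Longrightarrow> inS (\<theta> k) \<and> homog (Suc N) (\<theta> k)" "inS S" "homog N S"
      "(\<Sum>k<3. \<theta> k * pd k (\<Prod>F)) = S * \<Prod>F" "ev (coord v) S \<noteq> 0"
      by (rule qh_derivation[OF F v0 qh[OF sing]]) (rule that)
    have \<theta>S: "inS (\<theta> k)" "homog (Suc N) (\<theta> k)" if "k < 3" for k using \<theta>(4)[OF that] by auto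
    have act: "act \<theta> (\<Prod>F) = S * \<Prod>F" using \<theta>(7) by (simp add: act_def)
    have Sx: "ev x S \<noteq> 0" using \<theta>(5,8) evv by simp
    have xj: "x j \<noteq> 0" using \<theta>(1,2) cv by simp
    show ?thesis
    proof (cases "poly (pderiv (Wt \<theta>)) t = 0")
      case False
      then show ?thesis using \<theta>(4,5) act g0 by auto
    next
      case l0: True
      \<comment> \<open>At such a point \<open>Wt\<close> vanishes, so \<open>\<theta>\<close> there
        is \<open>bt\<close> times the point. Its component \<open>j\<close> is 0, while
        \<open>x j\<close> is not. The frame is arbitrary because a second component will be used as
        well.\<close>
      have bt0: "poly (frame.bt X' (\<lambda>i. pev (frame.phi A' B' C' r') (\<theta> i))) t' = 0"
        if fr: "arr_frame A' B' C' X' Y' Z' q' r' \<kappa>' F"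
          and x': "\<And>i. i < 3 \<Longrightarrow> poly (frame.phi A' B' C' r' i) t' = x i"
          and g': "poly (arr_frame.gam A' B' C' q' r' F) t' = 0" for A' B' C' X' Y' Z' q' r' \<kappa>' t'
      proof -
        interpret a: arr_frame A' B' C' X' Y' Z' q' r' \<kappa>' F by (rule fr)
        have "poly (pev a.phi (\<theta> j)) t' = poly (a.Wt \<theta>) t' * poly (pderiv (a.phi j)) t' + poly (a.bt (\<lambda>i. pev a.phi (\<theta> i))) t' * x j"
          using a.tangent_decomp[OF a.tang_of_log[OF act] \<theta>(1)] x'[OF \<theta>(1)] by simp
        then show ?thesis using a.Wt_root[OF \<theta>S act g'] \<theta>(3) xj by simp
      qed
      have w0: "poly (Wt \<theta>) t = 0" by (rule Wt_root[OF \<theta>S act g0])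
      have b0: "poly (bt (\<lambda>i. pev phi (\<theta> i))) t = 0"
        by (rule bt0[OF arr_frame_axioms _ g0]) (simp add: x_def)
      have \<theta>x: "ev x (\<theta> k) = 0" if "k < 3" for k
        using tangent_decomp[OF tang_of_log[OF act] that] w0 b0 evx[of "\<theta> k"] \<theta>S[OF that] by simp
      obtain K1 n where K1: "inS K1" "lf X ^ n * act \<theta> q = q * K1"
        "Wt \<theta> * pderiv gam = (pev phi S - pev phi K1 - of_nat dG * bt (\<lambda>i. pev phi (\<theta> i))) * gam"
        using log_relation[OF \<theta>S act] by metis
      \<comment> \<open>The derivative of \<open>Wt\<close> is 0 in this case, so the residue
        formula forces \<open>K1\<close> and \<open>S\<close> to agree at \<open>x\<close>, the
        Euler part being 0.\<close>
      have "poly (pev phi S - pev phi K1 - of_nat dG * bt (\<lambda>i. pev phi (\<theta> i))) t = 0"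
        using root_residue(2)[OF K1(3) gam_nz g0] l0 by auto
      then have K1x: "ev x K1 \<noteq> 0" using Sx b0 evx[OF K1(1)] evx[OF \<theta>(5)] by simp
      have u1: "ev x (lf X ^ n) = 1" using evx[of "lf X ^ n"] by simp
      \<comment> \<open>The same relation for any component through \<open>x\<close>, in a frame
        with \<open>x\<close> at parameter 0, where the denominator takes the value 1.\<close>
      have data: "\<exists>A' B' C' X' Y' Z' r' \<kappa>' K' n'. arr_frame A' B' C' X' Y' Z' c r' \<kappa>' F \<and> A' = x \<and>
          lf X' ^ n' * act \<theta> c = c * K' \<and> inS K' \<and> ev x (lf X' ^ n') = 1" if c: "c \<in> F" "ev x c = 0" for c
      proof -
        obtain r' where "component c r'" using c F unfolding arr_def by blast
        then obtain A' B' C' X' Y' Z' \<kappa>' where fr: "frame A' B' C' X' Y' Z' c r' \<kappa>'" "A' = x"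
          using frame_at[OF _ nzx c(2)] by metis
        then have af: "arr_frame A' B' C' X' Y' Z' c r' \<kappa>' F"
          using F c by (simp add: arr_frame_def arr_frame_axioms_def)
        interpret a: arr_frame A' B' C' X' Y' Z' c r' \<kappa>' F by (rule af)
        obtain K' n' where "inS K'" "lf X' ^ n' * act \<theta> c = c * K'"
          using a.log_relation[OF \<theta>S act] by metis
        moreover have "ev x (lf X' ^ n') = 1" using a.XA fr(2) by simp
        ultimately show ?thesis using af fr(2) by blast
      qed
      have nu0: "ev x K' = 0"
        if c: "c \<in> F" "c \<noteq> q" "ev x c = 0" and u: "u * act \<theta> c = c * K'" "inS K'" for c u K'
      proof -
        obtain r' where "component c r'" using c F unfolding arr_def by blast
        moreover have "pev phi c \<noteq> 0" using pev_prod_nonzero[OF F qF, of "{c}"] c by simp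
        ultimately have "\<exists>m>0. of_nat m * (poly (pev phi u) t * poly (pderiv (Wt \<theta>)) t) = poly (pev phi K') t"
          using c evx[of c] by (intro eigenvalue_relation[where d = r', OF tang_of_log[OF act] w0 b0 _ _ _ _ u(1)])
            (auto simp: component_def)
        then show ?thesis using l0 evx[OF u(2)] by auto
      qed
      obtain c where c: "c \<in> F" "c \<noteq> q" "ev x c = 0"
        using Gx F unfolding G_def by (auto simp: arr_def)
      obtain A' B' C' X' Y' Z' r' \<kappa>' K' n' where af: "arr_frame A' B' C' X' Y' Z' c r' \<kappa>' F" "A' = x"
          "lf X' ^ n' * act \<theta> c = c * K'" "inS K'" "ev x (lf X' ^ n') = 1"
        using data[OF c(1,3)] by blast
      interpret c: arr_frame A' B' C' X' Y' Z' c r' \<kappa>' F by (rule af)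
      have phic: "poly (c.phi i) 0 = x i" for i unfolding af(2)[symmetric] by (simp add: c.phi_def)
      have evc: "poly (pev c.phi p) 0 = ev x p" if "inS p" for p using poly_pev[OF that, of c.phi 0] by (simp add: phic)
      have cg: "poly c.gam 0 = 0"
      proof -
        have "ev x c.G = 0" using qx qF c(2) F unfolding c.G_def by (auto simp: arr_def)
        then show ?thesis using evc[OF c.G_inS] by (simp add: c.gam_def)
      qed
      have cw0: "poly (c.Wt \<theta>) 0 = 0" by (rule c.Wt_root[OF \<theta>S act cg])
      have cb0: "poly (c.bt (\<lambda>i. pev c.phi (\<theta> i))) 0 = 0"
        by (rule bt0[OF af(1) _ cg]) (simp add: phic)
      have rel_c: "\<exists>m>0. of_nat m * (ev x u * poly (pderiv (c.Wt \<theta>)) 0) = ev x K"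
        if b: "b \<in> F" "b \<noteq> c" "ev x b = 0" and u: "u * act \<theta> b = b * K" "inS K" "inS u" for b u K
      proof -
        obtain r'' where "component b r''" using b F unfolding arr_def by blast
        moreover have "pev c.phi b \<noteq> 0" using c.pev_prod_nonzero[OF F c(1), of "{b}"] b by simp
        ultimately have "\<exists>m>0. of_nat m * (poly (pev c.phi u) 0 * poly (pderiv (c.Wt \<theta>)) 0) = poly (pev c.phi K) 0"
          using b evc[of b] by (intro c.eigenvalue_relation[where d = r'', OF c.tang_of_log[OF act] cw0 cb0 _ _ _ _ u(1)])
            (auto simp: component_def)
        then show ?thesis using evc[OF u(2)] evc[OF u(3)] by simp
      qed
      \<comment> \<open>Seen from \<open>c\<close>, the nonzero conormal eigenvalue of
        \<open>q\<close> is a multiple of the eigenvalue along \<open>c\<close>.\<close>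
      have cl: "poly (pderiv (c.Wt \<theta>)) 0 \<noteq> 0"
        using rel_c[OF qF _ qx K1(2,1)] c(2) K1x u1 by auto
      have unique: "b = c" if b: "b \<in> F" "b \<noteq> q" "ev x b = 0" for b
      proof (rule ccontr)
        assume "b \<noteq> c"
        obtain X'' K'' n'' where u: "lf X'' ^ n'' * act \<theta> b = b * K''" "inS K''" "ev x (lf X'' ^ n'') = 1"
          using data[OF b(1,3)] by blast
        have "ev x K'' = 0" by (rule nu0[OF b u(1,2)])
        then show False using rel_c[OF b(1) \<open>b \<noteq> c\<close> b(3) u(1,2)] cl unfolding u(3) by auto
      qed
      have transversal: "poly (pderiv (pev phi c)) t \<noteq> 0"
      proof
        assume z: "poly (pderiv (pev phi c)) t = 0"
        have grad: "dot (\<lambda>k. ev x (pd k p)) x = of_nat d * ev x p"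
            "dot (\<lambda>k. ev x (pd k p)) (\<lambda>i. poly (pderiv (phi i)) t) = poly (pderiv (pev phi p)) t"
          if p: "inS p" "homog d p" for p d
        proof -
          show "dot (\<lambda>k. ev x (pd k p)) x = of_nat d * ev x p"
            using arg_cong[OF euler[OF p], of "ev x"] by (simp add: dot_def mult.commute)
          show "dot (\<lambda>k. ev x (pd k p)) (\<lambda>i. poly (pderiv (phi i)) t) = poly (pderiv (pev phi p)) t"
            unfolding pderiv_pev[OF p(1)] dot_def using evx[OF inS_pd[OF p(1)]] by (simp add: poly_sum)
        qed
        \<comment> \<open>If \<open>c\<close> touches \<open>q\<close> at \<open>x\<close>, both
          gradients are orthogonal to the point and to the common tangent vector, hence multiples of
          one covector. As eigenvectors they would belong to a nonzero eigenvalue and to 0, which is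
          impossible.\<close>
        obtain a where a: "\<And>k. k < 3 \<Longrightarrow> ev x (pd k q) = a * cr x (\<lambda>i. poly (pderiv (phi i)) t) k"
          using orthogonal_multiple[OF x_np, of "\<lambda>k. ev x (pd k q)"] grad[OF inS_q homog_q] qx by auto
        obtain b where b: "\<And>k. k < 3 \<Longrightarrow> ev x (pd k c) = b * cr x (\<lambda>i. poly (pderiv (phi i)) t) k"
          using orthogonal_multiple[OF x_np, of "\<lambda>k. ev x (pd k c)"] grad[OF c.inS_q c.homog_q] c(3) z by auto
        obtain l where l: "l < 3" "ev x (pd l q) \<noteq> 0" using comp nzx qx by (auto simp: component_def nosing_def)
        obtain l' where l': "l' < 3" "ev x (pd l' c) \<noteq> 0" using c.comp nzx c(3) by (auto simp: component_def nosing_def)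
        have b0: "b \<noteq> 0" using b[OF l'(1)] l'(2) by auto
        have "(\<Sum>k<3. ev x (pd l (\<theta> k)) * ev x (pd k q)) = ev x K1 * ev x (pd l q)"
          using act_grad[OF K1(2) qx \<theta>x] u1 by simp
        moreover have "(\<Sum>k<3. ev x (pd l (\<theta> k)) * ev x (pd k c)) = 0"
          using act_grad[OF af(3) c(3) \<theta>x, where l = l] unfolding af(5) nu0[OF c af(3,4)] by simp
        moreover have "(\<Sum>k<3. ev x (pd l (\<theta> k)) * ev x (pd k q)) * b = a * (\<Sum>k<3. ev x (pd l (\<theta> k)) * ev x (pd k c))"
          by (simp add: sum_3 a b algebra_simps)
        ultimately show False using K1x l b0 by simp
      qed
      \<comment> \<open>Only \<open>c\<close> passes through \<open>x\<close>, and transversally, so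
        \<open>gam\<close> has a simple zero and the Koszul derivation applies.\<close>
      have "gam = pev phi c * pev phi (\<Prod>(F - {q} - {c}))"
        unfolding gam_def G_def using F c prod.remove[of "F - {q}" c "\<lambda>x. x"] by (simp add: arr_def)
      then have "poly (pderiv gam) t = poly (pderiv (pev phi c)) t * poly (pev phi (\<Prod>(F - {q} - {c}))) t"
        using c(3) evx[of c] by (simp add: pderiv_mult)
      moreover have "poly (pev phi (\<Prod>(F - {q} - {c}))) t \<noteq> 0"
      proof
        assume z: "poly (pev phi (\<Prod>(F - {q} - {c}))) t = 0"
        have S: "inS (\<Prod>(F - {q} - {c}))" by (rule arr_prod_homog(2)[OF F]) blast
        have "ev x (\<Prod>(F - {q} - {c})) = 0" using z unfolding evx[OF S] .
        then obtain b where "b \<in> F - {q} - {c}" "ev x b = 0" using F by (auto simp: arr_def)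
        then show False using unique by blast
      qed
      ultimately show ?thesis using koszul transversal by simp
    qed
  qed
qed

end

section \<open>Counting intersection points\<close>

lemma card_simple_roots:
  fixes w :: "complex poly"
  assumes "w \<noteq> 0" "\<And>t. poly w t = 0 \<Longrightarrow> poly (pderiv w) t \<noteq> 0"
  shows "card {t. poly w t = 0} = degree w"
proof -
  have o: "order t w = 1" if t: "poly w t = 0" for t
  proof -
    have "order t w \<noteq> 0" using t assms(1) by (simp add: order_root)
    moreover have "pderiv w \<noteq> 0" "order t (pderiv w) = 0" using assms(2)[OF t] by (auto simp: order_root)
    ultimately show ?thesis using order_pderiv[of w t] assms(1) by (simp add: pderiv_eq_0_iff order_root t)
  qed
  have "degree w = size (proots w)" by (simp add: size_proots_complex)
  also have "\<dots> = (\<Sum>t\<in>{t. poly w t = 0}. order t w)"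
    using assms(1) by (simp add: size_multiset_overloaded_eq)
  also have "\<dots> = card {t. poly w t = 0}" using o by simp
  finally show ?thesis by simp
qed

definition free_gens :: "mpoly \<Rightarrow> nat \<Rightarrow> nat \<Rightarrow> (nat \<Rightarrow> mpoly) \<Rightarrow> (nat \<Rightarrow> mpoly) \<Rightarrow> bool" where
  "free_gens f a b \<theta>1 \<theta>2 \<longleftrightarrow> (\<forall>k<3. inS (\<theta>1 k) \<and> homog a (\<theta>1 k)) \<and> (\<forall>k<3. inS (\<theta>2 k) \<and> homog b (\<theta>2 k)) \<and>
     act \<theta>1 f = 0 \<and> act \<theta>2 f = 0 \<and>
     (\<forall>\<theta>. (\<forall>k<3. inS (\<theta> k)) \<longrightarrow> act \<theta> f = 0 \<longrightarrow>
        (\<exists>h1 h2. inS h1 \<and> inS h2 \<and> (\<forall>k<3. \<theta> k = h1 * \<theta>1 k + h2 * \<theta>2 k)))"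

lemma free_exps_gens: assumes "free_exps f a b" obtains \<theta>1 \<theta>2 where "free_gens f a b \<theta>1 \<theta>2"
proof -
  define tr where "tr = (\<lambda>(t::deriv3) i. if i = (0::nat) then fst t else if i = 1 then fst (snd t) else snd (snd t))"
  have D0: "t \<in> D0 f \<longleftrightarrow> (\<forall>k<3. inS (tr t k)) \<and> act (tr t) f = 0" for t
    by (cases t) (auto simp: D0_def tr_def act_def sum_3 less_3_cases)
  obtain t1 t2 where t: "t1 \<in> D0 f" "t2 \<in> D0 f" "der_homog a t1" "der_homog b t2"
    "\<forall>t\<in>D0 f. \<exists>h1 h2. inS h1 \<and> inS h2 \<and> t = dlin h1 t1 h2 t2"
    using assms unfolding free_exps_def by blast
  have "free_gens f a b (tr t1) (tr t2)"
    unfolding free_gens_def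
  proof (intro conjI allI impI)
    show "act (tr t1) f = 0" "act (tr t2) f = 0" "k < 3 \<Longrightarrow> inS (tr t1 k)" "k < 3 \<Longrightarrow> inS (tr t2 k)" for k
      using t(1,2) D0 by auto
    show "k < 3 \<Longrightarrow> homog a (tr t1 k)" "k < 3 \<Longrightarrow> homog b (tr t2 k)" for k
      using t(3,4) by (auto simp: der_homog_def tr_def)
    fix \<theta> assume "\<forall>k<3. inS (\<theta> k)" "act \<theta> f = 0"
    then have "(\<theta> 0, \<theta> 1, \<theta> 2) \<in> D0 f" by (auto simp: D0_def act_def sum_3)
    then obtain h1 h2 where "inS h1" "inS h2" "(\<theta> 0, \<theta> 1, \<theta> 2) = dlin h1 t1 h2 t2"
      using t(5) by blast
    then show "\<exists>h1 h2. inS h1 \<and> inS h2 \<and> (\<forall>k<3. \<theta> k = h1 * tr t1 k + h2 * tr t2 k)"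
      by (intro exI[of _ h1] exI[of _ h2]) (auto simp: dlin_def tr_def less_3_cases)
  qed
  then show ?thesis by (rule that)
qed

text \<open>Adding a multiple of the Euler derivation moves any \<open>\<theta>\<close> with \<open>\<theta>(f) \<in> (f)\<close> into \<open>D0 f\<close>.\<close>

lemma free_gens_log:
  assumes fg: "free_gens f a b \<theta>1 \<theta>2" and f: "inS f" "homog d f" "d > 0"
    and \<theta>: "\<And>k. k < 3 \<Longrightarrow> inS (\<theta> k)" "\<And>k. k < 3 \<Longrightarrow> homog e (\<theta> k)" and K: "inS K" "act \<theta> f = K * f"
  obtains h1 h2 l where "inS h1" "inS h2" "\<And>k. k < 3 \<Longrightarrow> \<theta> k = h1 * \<theta>1 k + h2 * \<theta>2 k + l * Var k"
    "h1 = 0 \<or> a \<le> e \<and> homog (e - a) h1" "h2 = 0 \<or> b \<le> e \<and> homog (e - b) h2"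
proof -
  define l where "l = Const (1 / of_nat d) * K"
  have lS: "inS l" using K by (simp add: l_def)
  have "of_nat d * l = K"
  proof -
    have "of_nat d * Const (1 / of_nat d) = 1" using f(3) by (simp flip: Const_of_nat Const_mult)
    then show ?thesis by (simp add: l_def flip: mult.assoc)
  qed
  have "act (\<lambda>k. \<theta> k - l * Var k) f = act \<theta> f - l * (\<Sum>k<3. Var k * pd k f)"
    by (simp add: act_def sum_subtractf sum_distrib_left algebra_simps)
  also have "\<dots> = act \<theta> f - (of_nat d * l) * f" unfolding euler[OF f(1,2)] by (simp add: algebra_simps)
  also have "\<dots> = 0" unfolding \<open>of_nat d * l = K\<close> K by simp
  finally have "\<exists>h1 h2. inS h1 \<and> inS h2 \<and> (\<forall>k<3. \<theta> k - l * Var k = h1 * \<theta>1 k + h2 * \<theta>2 k)"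
    using fg \<theta>(1) lS unfolding free_gens_def by auto
  then obtain h1 h2 where h: "inS h1" "inS h2" "\<And>k. k < 3 \<Longrightarrow> \<theta> k = h1 * \<theta>1 k + h2 * \<theta>2 k + l * Var k"
    by (auto simp: algebra_simps eq_diff_eq diff_eq_eq)
  \<comment> \<open>Only the degree \<open>e\<close> part of the relation matters: the coefficient
    of a generator of degree n is replaced by its component of degree e - n, and by 0 when e <
    n.\<close>
  define cut where "cut = (\<lambda>n p. if n \<le> e then hcomp (e - n) p else 0)"
  have cut: "hcomp e (p * g) = cut n p * g" if "homog n g" for n p g
    using hcomp_mult[OF that, of e p] by (simp add: cut_def)
  have "\<theta> k = cut a h1 * \<theta>1 k + cut b h2 * \<theta>2 k + cut 1 l * Var k" if k: "k < 3" for k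
  proof -
    have "\<theta> k = hcomp e (\<theta> k)" using \<theta>(2)[OF k] by (simp add: hcomp_homog)
    then show ?thesis
      using h(3)[OF k] fg k cut[of a "\<theta>1 k" h1] cut[of b "\<theta>2 k" h2] cut[of 1 "Var k" l]
      by (simp add: hcomp_add free_gens_def)
  qed
  then show ?thesis using h(1,2)
    by (intro that[of "cut a h1" "cut b h2" "cut 1 l"]) (auto simp: cut_def)
qed

section \<open>Projective points and their parameters\<close>

definition trip :: "(nat \<Rightarrow> complex) \<Rightarrow> pt3" where "trip x = (x 0, x 1, x 2)"

lemma coord_trip [simp]: "i < 3 \<Longrightarrow> coord (trip x) i = x i"
  by (auto simp: trip_def coord_def less_3_cases)

lemma trip_coord: "trip (coord v) = v"
  by (simp add: trip_def coord_def)

lemma trip_nz: "trip x \<noteq> (0,0,0) \<longleftrightarrow> nz x"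
  by (auto simp: trip_def nz_iff)

lemma ev_coord_trip: "inS p \<Longrightarrow> ev (coord (trip x)) p = ev x p"
  by (rule ev_cong) auto

lemma proj_class_scale:
  assumes "a \<noteq> 0" "\<And>i. i < 3 \<Longrightarrow> x i = a * y i"
  shows "proj_class (trip x) = proj_class (trip y)"
proof -
  have x: "x 0 = a * y 0" "x 1 = a * y 1" "x 2 = a * y 2" using assms(2) by auto
  show ?thesis
  proof (intro equalityI subsetI)
    fix z assume "z \<in> proj_class (trip x)"
    then obtain c where c: "c \<noteq> 0" "z = (c * x 0, c * x 1, c * x 2)" by (auto simp: proj_class_def trip_def)
    then show "z \<in> proj_class (trip y)" using assms(1) unfolding proj_class_def trip_def
      by (intro CollectI exI[of _ "c * a"]) (simp add: x[simplified] algebra_simps)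
  next
    fix z assume "z \<in> proj_class (trip y)"
    then obtain c where c: "c \<noteq> 0" "z = (c * y 0, c * y 1, c * y 2)" by (auto simp: proj_class_def trip_def)
    then show "z \<in> proj_class (trip x)" using assms(1) unfolding proj_class_def trip_def
      by (intro CollectI exI[of _ "c / a"]) (simp add: x[simplified])
  qed
qed

lemma proj_class_eqD:
  assumes "proj_class (trip x) = proj_class (trip y)"
  obtains c where "\<And>i. i < 3 \<Longrightarrow> x i = c * y i"
proof -
  have "trip x \<in> proj_class (trip x)" by (auto simp: proj_class_def trip_def intro!: exI[of _ 1])
  then obtain c where "x 0 = c * y 0" "x 1 = c * y 1" "x 2 = c * y 2"
    unfolding assms by (auto simp: proj_class_def trip_def)
  then show ?thesis by (intro that[of c]) (auto simp: less_3_cases)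
qed

lemma (in frame) phi_proportional_eq:
  assumes "\<And>i. i < 3 \<Longrightarrow> poly (phi i) s = c * poly (phi i) t"
  shows "s = t"
proof -
  have e: "dot V (\<lambda>i. poly (phi i) t) = poly (pev phi (lf V)) t" for V t
    by (simp add: lf_def dot_def sum_3)
  have d: "dot V (\<lambda>i. poly (phi i) s) = c * dot V (\<lambda>i. poly (phi i) t)" for V
    using assms by (simp add: dot_def sum_3 algebra_simps)
  from d[of X] d[of Y] show ?thesis by (simp add: e pev_Y)
qed

lemma (in frame) nz_phi: "nz (\<lambda>i. poly (phi i) t)"
  using nonpar_nz(1)[OF nonpar_phi] .

text \<open>Only finitely many parameters give points of the other components. A point avoiding them
  is moved to infinity; the point of parameter \<open>t + 1\<close> is an arbitrary second point
  that fixes the new frame.\<close>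

lemma good_frame:
  assumes F: "arr F" and q: "q \<in> F"
  obtains A B C X Y Z r \<kappa> where "arr_frame A B C X Y Z q r \<kappa> F"
    "ev (frame.infpt B C r) (\<Prod>(F - {q})) \<noteq> 0"
proof -
  obtain r where r: "component q r" using F q unfolding arr_def by blast
  obtain u v where uv: "nonpar u v" "ev u q = 0" "ev v q = 0" using two_points[OF r] .
  obtain A B C X Y Z \<kappa> where fr: "frame A B C X Y Z q r \<kappa>" using frame_at[OF r nonpar_nz(1)[OF uv(1)] uv(2)] by metis
  interpret frame A B C X Y Z q r \<kappa> by (rule fr)
  have GS: "inS (\<Prod>(F - {q}))" by (rule arr_prod_homog(2)[OF F]) blast
  define g where "g = pev phi (\<Prod>(F - {q}))"
  have "g \<noteq> 0" unfolding g_def by (rule pev_prod_nonzero[OF F q]) simp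
  then have "finite {t. poly g t = 0}" by (rule poly_roots_finite)
  then obtain t where "t \<notin> {t. poly g t = 0}" using ex_new_if_finite[OF infinite_UNIV_char_0] by blast
  then have t: "poly g t \<noteq> 0" by simp
  define p where "p = (\<lambda>s i. poly (phi i) s)"
  have z: "ev (p s) q = 0" for s using poly_pev[OF inS_q, of phi s] by (simp add: p_def)
  have "nonpar (p (t + 1)) (p t)"
  proof (rule ccontr)
    assume "\<not> ?thesis"
    then obtain c where "\<And>i. i < 3 \<Longrightarrow> p t i = c * p (t + 1) i"
      using not_nonpar nz_phi unfolding p_def by metis
    then have "t = t + 1" unfolding p_def by (rule phi_proportional_eq)
    then show False by simp
  qed
  then obtain A' B' C' X' Y' Z' \<kappa>' where "frame A' B' C' X' Y' Z' q r \<kappa>'" "frame.infpt B' C' r = p t"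
    using frame_through[OF r z z] by metis
  moreover have "ev (p t) (\<Prod>(F - {q})) \<noteq> 0"
    using t unfolding g_def poly_pev[OF GS] p_def .
  ultimately show ?thesis using F q
    by (intro that[of A' B' C' X' Y' Z' r \<kappa>']) (auto simp: arr_frame_def arr_frame_axioms_def)
qed

section \<open>The number of points in deletion and addition\<close>

locale good_arr_frame = arr_frame +
  assumes inf: "ev infpt G \<noteq> 0"
    and qh: "\<And>v. is_singular_pt (\<Prod>F) v \<Longrightarrow> qh_point (\<Prod>F) v"
begin

lemma count_points: "npoints (\<lambda>v. mp_eval G v = 0 \<and> mp_eval q v = 0) = card {t. poly gam t = 0}"
proof -
  define p where "p = (\<lambda>t i. poly (phi i) t)"
  define P where "P = (\<lambda>v. mp_eval G v = 0 \<and> mp_eval q v = 0)"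
  have gp: "poly gam t = ev (p t) G" for t unfolding gam_def p_def by (rule poly_pev) simp
  have qp: "ev (p t) q = 0" for t using poly_pev[OF inS_q, of phi t] by (simp add: p_def)
  have "proj_points P = (\<lambda>t. proj_class (trip (p t))) ` {t. poly gam t = 0}"
  proof (intro equalityI subsetI)
    fix c assume "c \<in> proj_points P"
    then obtain v where v: "c = proj_class v" "v \<noteq> (0,0,0)" "P v" by (auto simp: proj_points_def)
    define x where "x = coord v"
    have vx: "v = trip x" by (simp add: x_def trip_coord)
    have nz: "nz x" using v(2) trip_nz unfolding vx by simp
    have z: "ev x G = 0" "ev x q = 0" using v(3) by (simp_all add: P_def mp_eval_ev x_def)
    have scale: "ev x G = a ^ dG * ev y G" if "\<And>i. i < 3 \<Longrightarrow> x i = a * y i" for a y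
      using ev_cong[OF G_inS, of x "\<lambda>i. a * y i"] that ev_scale[OF G_inS G_homog, of a y] by simp
    have Xx: "dot X x \<noteq> 0"
    proof
      assume "dot X x = 0"
      then obtain a where a: "\<And>i. i < 3 \<Longrightarrow> x i = a * infpt i" using points_infinite z by metis
      then have "a \<noteq> 0" using nz by (auto simp: nz_def)
      then show False using scale[OF a] z inf by simp
    qed
    define t where "t = dot Y x / dot X x"
    have xt: "x i = dot X x * p t i" if "i < 3" for i
      using points_finite[OF z(2) Xx that] by (simp add: p_def t_def)
    have "poly gam t = 0" using scale[OF xt] z Xx by (simp add: gp)
    moreover have "c = proj_class (trip (p t))" unfolding v(1) vx by (rule proj_class_scale[OF Xx xt])
    ultimately show "c \<in> (\<lambda>t. proj_class (trip (p t))) ` {t. poly gam t = 0}" by blast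
  next
    fix c assume "c \<in> (\<lambda>t. proj_class (trip (p t))) ` {t. poly gam t = 0}"
    then obtain t where t: "c = proj_class (trip (p t))" "poly gam t = 0" by blast
    have "P (trip (p t))" using t(2) qp gp by (simp add: P_def mp_eval_ev ev_coord_trip)
    moreover have "trip (p t) \<noteq> (0,0,0)" using trip_nz nz_phi by (simp add: p_def)
    ultimately show "c \<in> proj_points P" using t(1) unfolding proj_points_def by blast
  qed
  moreover have "inj_on (\<lambda>t. proj_class (trip (p t))) {t. poly gam t = 0}"
  proof (rule inj_onI)
    fix s t assume "proj_class (trip (p s)) = proj_class (trip (p t))"
    then obtain c where "\<And>i. i < 3 \<Longrightarrow> p s i = c * p t i" using proj_class_eqD by blast
    then show "s = t" unfolding p_def by (rule phi_proportional_eq)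
  qed
  ultimately show ?thesis unfolding npoints_def P_def[symmetric] by (simp add: card_image)
qed

text \<open>At each parameter the \<open>Wt\<close> of some local generator is a multiple of
  \<open>W\<close>, so \<open>W\<close> vanishes there only if \<open>gam\<close> does, and then
  simply. All its zeros being simple, their number is its degree.\<close>

lemma card_eq_degree:
  assumes van: "\<And>t. poly gam t = 0 \<Longrightarrow> poly W t = 0"
    and gen: "\<And>\<theta> K e. (\<And>k. k < 3 \<Longrightarrow> inS (\<theta> k)) \<Longrightarrow> (\<And>k. k < 3 \<Longrightarrow> homog e (\<theta> k)) \<Longrightarrow> inS K \<Longrightarrow>
      act \<theta> (\<Prod>F) = K * \<Prod>F \<Longrightarrow> \<exists>s. Wt \<theta> = s * W"
  shows "card {t. poly gam t = 0} = degree W"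
proof -
  have loc: "poly gam t = 0 \<Longrightarrow> poly (pderiv W) t \<noteq> 0" "poly gam t \<noteq> 0 \<Longrightarrow> poly W t \<noteq> 0" for t
  proof -
    obtain \<theta> K e where \<theta>: "\<forall>k<3. inS (\<theta> k) \<and> homog e (\<theta> k)" "inS K" "act \<theta> (\<Prod>F) = K * \<Prod>F"
      "if poly gam t = 0 then poly (pderiv (Wt \<theta>)) t \<noteq> 0 else poly (Wt \<theta>) t \<noteq> 0"
      using local_generator[OF qh] by blast
    obtain s where "Wt \<theta> = s * W" using gen[of \<theta> e K] \<theta> by blast
    then show "poly gam t = 0 \<Longrightarrow> poly (pderiv W) t \<noteq> 0" "poly gam t \<noteq> 0 \<Longrightarrow> poly W t \<noteq> 0"
      using \<theta>(4) van[of t] by (auto simp: pderiv_mult)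
  qed
  have e: "{t. poly gam t = 0} = {t. poly W t = 0}" using loc(2) van by blast
  moreover have "W \<noteq> 0"
    using loc[of 0] by (cases "poly gam 0 = 0") auto
  moreover have "poly (pderiv W) t \<noteq> 0" if "poly W t = 0" for t using loc(1)[of t] that e by blast
  ultimately show ?thesis using card_simple_roots[of W] by simp
qed

text \<open>The test element for lower bounds: its \<open>Wt\<close> has the largest degree possible
  for a derivation of its degree. If a factor coming from a homogeneous coefficient has bounded
  degree, the complementary factor must be large.\<close>

lemma koszul_infinity:
  obtains \<theta> K where "\<And>k. k < 3 \<Longrightarrow> inS (\<theta> k)" "\<And>k. k < 3 \<Longrightarrow> homog (dG + (r - 1)) (\<theta> k)" "inS K"
    "act \<theta> G = K * G" "act \<theta> (\<Prod>F) = K * \<Prod>F" "Wt \<theta> \<noteq> 0" "degree (Wt \<theta>) = r + r * dG"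
proof -
  obtain c n where cn: "c \<noteq> 0" "wt (\<lambda>i. pev phi (koszul n G i)) = smult c ([:0, 1:] ^ r * pev phi G)"
    using koszul_wt_infinite by blast
  define K where "K = act (cr (\<lambda>i. Const (n i)) (\<lambda>i. pd i q)) G"
  have K: "act (koszul n G) G = K * G" "act (koszul n G) (\<Prod>F) = K * \<Prod>F"
    by (simp_all add: f_eq act_mult koszul_q koszul_G K_def algebra_simps)
  have KS: "inS K" unfolding K_def by (intro inS_act inS_cr) auto
  have S: "inS (koszul n G k)" "homog (dG + (r - 1)) (koszul n G k)" if "k < 3" for k
    unfolding koszul_def using that inS_cr homog_cr G_homog by (auto intro!: homog_mult)
  have "degree gam = r * dG" unfolding gam_def by (rule degree_pev_eq[OF G_inS G_homog inf])
  then have "degree (Wt (koszul n G)) = r + r * dG" "Wt (koszul n G) \<noteq> 0"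
    unfolding cn(2) using cn(1) gam_nz by (auto simp: gam_def[symmetric] degree_mult_eq degree_power_eq)
  then show ?thesis using that S KS K by blast
qed

text \<open>Here \<open>d\<close> is the degree of the factor of the Koszul vector field coming from
  a coefficient, and \<open>w\<close> that of the complementary factor. The constant arises as 2 r -
  r^2, which is 2 - r for r = 1 and r = 2.\<close>

lemma degree_arith: assumes "d + r * b \<le> r * (dG + (r - 1))" "r + r * dG = d + w"
  shows "r * b + 2 - r \<le> w"
proof -
  consider "r = 1" | "r = 2" using q_cases by auto
  then show ?thesis using assms by cases (auto simp: algebra_simps)
qed

lemma Wt_comb:
  assumes "\<And>k. k < 3 \<Longrightarrow> \<theta> k = h1 * \<theta>1 k + h2 * \<theta>2 k + l * Var k"
  shows "Wt \<theta> = pev phi h1 * Wt \<theta>1 + pev phi h2 * Wt \<theta>2"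
proof -
  have "Wt \<theta> = wt (\<lambda>k. (pev phi h1 * pev phi (\<theta>1 k) + pev phi h2 * pev phi (\<theta>2 k)) + pev phi l * phi k)"
    using assms by (simp add: wt_def dot_def sum_3)
  then show ?thesis unfolding wt_add wt_phi add_0_right wt_mult .
qed

lemma degree_coefficient:
  assumes "inS h" "h = 0 \<or> b \<le> e \<and> homog (e - b) h" "pev phi h \<noteq> 0"
  shows "degree (pev phi h) + r * b \<le> r * e"
proof -
  have h: "b \<le> e" "homog (e - b) h" using assms by auto
  have "degree (pev phi h) + r * b \<le> r * (e - b) + r * b"
    using degree_pev[OF assms(1) h(2), of phi r] degree_phi by simp
  then show ?thesis using h(1) by (simp flip: distrib_left)
qed

lemma degree_Wt:
  assumes "tang \<theta>" "\<And>k. k < 3 \<Longrightarrow> inS (\<theta> k) \<and> homog e (\<theta> k)"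
  shows "degree (Wt \<theta>) \<le> r * e + 2 - r"
  using assms(2) by (intro degree_wt[OF assms(1)] degree_pev degree_phi) auto

lemma deletion_count:
  assumes fg: "free_gens (\<Prod>F) a b \<theta>1 \<theta>2"
  defines "n \<equiv> npoints (\<lambda>v. mp_eval G v = 0 \<and> mp_eval q v = 0)"
  shows "n = r * b + 2 - r \<or> n \<le> r * a + 2 - r"
proof -
  have n: "n = card {t. poly gam t = 0}" unfolding n_def by (rule count_points)
  have \<theta>1: "inS (\<theta>1 k)" "homog a (\<theta>1 k)" and \<theta>2: "inS (\<theta>2 k)" "homog b (\<theta>2 k)" if "k < 3" for k
    using fg that by (auto simp: free_gens_def)
  have act0: "act \<theta>1 (\<Prod>F) = 0 * \<Prod>F" "act \<theta>2 (\<Prod>F) = 0 * \<Prod>F" using fg by (auto simp: free_gens_def)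
  have t1: "tang \<theta>1" "tang \<theta>2" using tang_of_log act0 by blast+
  obtain d where d: "homog d (\<Prod>F)" using arr_prod_homog(1)[OF F] by blast
  have fS: "inS (\<Prod>F)" by (rule arr_prod_homog(2)[OF F]) simp
  have dpos: "d > 0" by (rule arr_degree_pos[OF F d])
  show ?thesis
  proof (cases "Wt \<theta>1 = 0")
    case False
    have "{t. poly gam t = 0} \<subseteq> {t. poly (Wt \<theta>1) t = 0}" using Wt_root[OF \<theta>1 act0(1)] by blast
    then have "n \<le> card {t. poly (Wt \<theta>1) t = 0}" unfolding n by (intro card_mono poly_roots_finite False)
    also have "\<dots> \<le> degree (Wt \<theta>1)" by (rule card_poly_roots_bound[OF False])
    also have "\<dots> \<le> r * a + 2 - r" using \<theta>1 by (intro degree_Wt t1) auto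
    finally show ?thesis ..
  next
    case True
    have comb: "\<exists>h. inS h \<and> Wt \<theta> = pev phi h * Wt \<theta>2 \<and> (h = 0 \<or> b \<le> e \<and> homog (e - b) h)"
      if th: "\<And>k. k < 3 \<Longrightarrow> inS (\<theta> k)" "\<And>k. k < 3 \<Longrightarrow> homog e (\<theta> k)" "inS K" "act \<theta> (\<Prod>F) = K * \<Prod>F" for \<theta> K e
    proof -
      obtain h1 h2 l where h: "inS h2" "\<And>k. k < 3 \<Longrightarrow> \<theta> k = h1 * \<theta>1 k + h2 * \<theta>2 k + l * Var k"
        "h2 = 0 \<or> b \<le> e \<and> homog (e - b) h2"
        by (rule free_gens_log[OF fg fS d dpos th]; (assumption | rule that))
      then show ?thesis using Wt_comb[OF h(2)] True by auto
    qed
    have "n = degree (Wt \<theta>2)" unfolding n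
    proof (rule card_eq_degree)
      show "poly (Wt \<theta>2) t = 0" if "poly gam t = 0" for t using Wt_root[OF \<theta>2 act0(2) that] by blast
    qed (use comb in blast)
    \<comment> \<open>The Koszul vector field is a multiple of \<open>Wt \<theta>2\<close>, which
      bounds that degree from below; the general bound for tangent derivations is the reverse
      inequality.\<close>
    moreover have "r * b + 2 - r \<le> degree (Wt \<theta>2)"
    proof -
      obtain \<theta> K where k: "\<And>k. k < 3 \<Longrightarrow> inS (\<theta> k)" "\<And>k. k < 3 \<Longrightarrow> homog (dG + (r - 1)) (\<theta> k)" "inS K"
        "act \<theta> (\<Prod>F) = K * \<Prod>F" "Wt \<theta> \<noteq> 0" "degree (Wt \<theta>) = r + r * dG"
        using koszul_infinity by metis
      obtain h where h: "inS h" "Wt \<theta> = pev phi h * Wt \<theta>2" "h = 0 \<or> b \<le> dG + (r - 1) \<and> homog (dG + (r - 1) - b) h"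
        using comb[OF k(1-4)] by blast
      then have "degree (pev phi h) + r * b \<le> r * (dG + (r - 1))" using k(5) by (intro degree_coefficient) auto
      moreover have "r + r * dG = degree (pev phi h) + degree (Wt \<theta>2)"
        using k(5,6) h(2) by (simp add: degree_mult_eq)
      ultimately show ?thesis by (rule degree_arith)
    qed
    moreover have "degree (Wt \<theta>2) \<le> r * b + 2 - r" using \<theta>2 by (intro degree_Wt t1) auto
    ultimately show ?thesis by simp
  qed
qed

lemma addition_count:
  assumes fg: "free_gens G a b \<theta>1 \<theta>2" and dpos: "dG > 0"
  defines "n \<equiv> npoints (\<lambda>v. mp_eval G v = 0 \<and> mp_eval q v = 0)"
  shows "n = r * a + 2 - r \<or> r * b + 2 - r \<le> n"
proof -
  have n: "n = card {t. poly gam t = 0}" unfolding n_def by (rule count_points)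
  have \<theta>1: "inS (\<theta>1 k)" "homog a (\<theta>1 k)" and \<theta>2: "inS (\<theta>2 k)" "homog b (\<theta>2 k)" if "k < 3" for k
    using fg that by (auto simp: free_gens_def)
  have act0: "act \<theta>1 G = 0" "act \<theta>2 G = 0" using fg by (auto simp: free_gens_def)
  define v1 v2 where "v1 = pev phi (act \<theta>1 q)" and "v2 = pev phi (act \<theta>2 q)"
  have vcomb: "pev phi (act \<theta> q) = pev phi h1 * v1 + pev phi h2 * v2"
    if "\<And>k. k < 3 \<Longrightarrow> \<theta> k = h1 * \<theta>1 k + h2 * \<theta>2 k + l * Var k" for \<theta> h1 h2 l
  proof -
    have "act \<theta> q = h1 * act \<theta>1 q + h2 * act \<theta>2 q + l * (\<Sum>k<3. Var k * pd k q)"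
      using that by (simp add: act_def sum_3 algebra_simps)
    then show ?thesis unfolding euler[OF inS_q homog_q] v1_def v2_def by simp
  qed
  \<comment> \<open>The derivations G d/dx_i all preserve \<open>G\<close>. If both generators were
    tangent to \<open>q\<close>, so would these be, and the gradient of \<open>q\<close> would
    vanish along the curve.\<close>
  have not_both: "v1 \<noteq> 0 \<or> v2 \<noteq> 0"
  proof (rule ccontr)
    assume "\<not> ?thesis"
    have z: "pev phi (pd i q) = 0" if i: "i < 3" for i
    proof -
      define \<theta> where "\<theta> = (\<lambda>k. if k = i then G else 0)"
      have a: "act \<theta> p = G * pd i p" for p
      proof -
        have "act \<theta> p = (\<Sum>k<3. if k = i then G * pd i p else 0)"
          unfolding act_def \<theta>_def by (intro sum.cong) auto
        then show ?thesis using i by simp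
      qed
      have "act \<theta> G = pd i G * G" unfolding a by simp
      moreover have "inS (\<theta> k)" "homog dG (\<theta> k)" for k using G_homog by (auto simp: \<theta>_def)
      ultimately obtain h1 h2 l where "\<And>k. k < 3 \<Longrightarrow> \<theta> k = h1 * \<theta>1 k + h2 * \<theta>2 k + l * Var k"
        using free_gens_log[OF fg G_inS G_homog dpos _ _ inS_pd[OF G_inS i], of \<theta> dG] by metis
      from vcomb[OF this] have "gam * pev phi (pd i q) = 0" using \<open>\<not> _\<close> by (simp add: a gam_def)
      then show ?thesis using gam_nz by simp
    qed
    have "ev (\<lambda>k. poly (phi k) 0) (pd i q) = 0" if "i < 3" for i
      using poly_pev[OF inS_pd[OF inS_q that], of phi 0] z[OF that] by simp
    moreover have "ev (\<lambda>k. poly (phi k) 0) q = 0" using poly_pev[OF inS_q, of phi 0] by simp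
    ultimately show False using comp nz_phi unfolding component_def nosing_def by metis
  qed
  \<comment> \<open>Stated for vector fields given only along the curve, since the generator built
    from a syzygy over C[t] need not be the restriction of a derivation.\<close>
  have van: "poly (wt U) t = 0"
    if U: "tangent U" "(\<Sum>k<3. pev phi (pd k G) * U k) = 0" and t: "poly gam t = 0" for U t
  proof (rule root_residue(1)[OF _ gam_nz t])
    show "wt U * pderiv gam = (- of_nat dG * bt U) * gam"
      using tangent_chain[OF U(1) G_inS G_homog] U(2) by (simp add: gam_def eq_neg_iff_add_eq_0)
  qed
  \<comment> \<open>A derivation preserving the full curve preserves \<open>G\<close> up to a power
    of \<open>lf X\<close>. Multiplying by that power changes nothing on the curve and lets the
    generators for \<open>G\<close> be used; tangency to \<open>q\<close> makes the restricted
    coefficients a syzygy.\<close>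
  have log: "\<exists>h1 h2. Wt \<theta> = h1 * Wt \<theta>1 + h2 * Wt \<theta>2 \<and> h1 * v1 + h2 * v2 = 0"
    if \<theta>: "\<And>k. k < 3 \<Longrightarrow> inS (\<theta> k)" "\<And>k. k < 3 \<Longrightarrow> homog e (\<theta> k)" "inS K" "act \<theta> (\<Prod>F) = K * \<Prod>F" for \<theta> K e
  proof -
    obtain K1 m where K1: "inS K1" "lf X ^ m * act \<theta> G = (lf X ^ m * K - K1) * G"
      using log_relation[OF \<theta>(1,2,4)] by metis
    define \<theta>' where "\<theta>' = (\<lambda>k. lf X ^ m * \<theta> k)"
    have "act \<theta>' p = lf X ^ m * act \<theta> p" for p
      by (simp add: \<theta>'_def act_def sum_distrib_left mult.assoc)
    then have "act \<theta>' G = (lf X ^ m * K - K1) * G" using K1(2) by simp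
    moreover have "inS (\<theta>' k)" "homog (m + e) (\<theta>' k)" if "k < 3" for k
      using \<theta>(1,2)[OF that] homog_power[OF homog_lf, of m X] by (auto simp: \<theta>'_def intro!: homog_mult)
    moreover have "inS (lf X ^ m * K - K1)" using K1 \<theta>(3) by auto
    ultimately obtain h1 h2 l where h: "\<And>k. k < 3 \<Longrightarrow> \<theta>' k = h1 * \<theta>1 k + h2 * \<theta>2 k + l * Var k"
      using free_gens_log[OF fg G_inS G_homog dpos, of \<theta>' "m + e" "lf X ^ m * K - K1"] by metis
    have "Wt \<theta> = Wt \<theta>'" by (simp add: \<theta>'_def)
    also have "\<dots> = pev phi h1 * Wt \<theta>1 + pev phi h2 * Wt \<theta>2" by (rule Wt_comb[OF h])
    finally have "Wt \<theta> = pev phi h1 * Wt \<theta>1 + pev phi h2 * Wt \<theta>2" .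
    moreover have "pev phi h1 * v1 + pev phi h2 * v2 = 0"
    proof -
      have "pev phi (act \<theta>' q) = pev phi (act \<theta> q)"
        by (simp add: \<theta>'_def act_def)
      also have "\<dots> = 0" using tang_of_log[OF \<theta>(4)] unfolding tangent_def pev_act .
      finally show ?thesis using vcomb[OF h] by simp
    qed
    ultimately show ?thesis by blast
  qed
  obtain \<theta> K where k: "\<And>k. k < 3 \<Longrightarrow> inS (\<theta> k)" "\<And>k. k < 3 \<Longrightarrow> homog (dG + (r - 1)) (\<theta> k)" "inS K"
    "act \<theta> G = K * G" "act \<theta> (\<Prod>F) = K * \<Prod>F" "Wt \<theta> \<noteq> 0" "degree (Wt \<theta>) = r + r * dG"
    using koszul_infinity by metis
  obtain h1 h2 l where h: "inS h1" "inS h2" "\<And>k. k < 3 \<Longrightarrow> \<theta> k = h1 * \<theta>1 k + h2 * \<theta>2 k + l * Var k"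
    "h1 = 0 \<or> a \<le> dG + (r - 1) \<and> homog (dG + (r - 1) - a) h1"
    "h2 = 0 \<or> b \<le> dG + (r - 1) \<and> homog (dG + (r - 1) - b) h2"
    by (rule free_gens_log[OF fg G_inS G_homog dpos k(1-4)]; (assumption | rule that))
  have Wk: "Wt \<theta> = pev phi h1 * Wt \<theta>1 + pev phi h2 * Wt \<theta>2" by (rule Wt_comb[OF h(3)])
  have vk: "pev phi h1 * v1 + pev phi h2 * v2 = 0"
    using vcomb[OF h(3)] tang_of_log[OF k(5)] unfolding tangent_def pev_act by simp
  show ?thesis
  proof (cases "v1 = 0")
    case True
    then have v2: "v2 \<noteq> 0" using not_both by simp
    have t1: "tang \<theta>1" using True unfolding v1_def pev_act tangent_def .
    have "n = degree (Wt \<theta>1)" unfolding n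
    proof (rule card_eq_degree)
      show "poly (Wt \<theta>1) t = 0" if "poly gam t = 0" for t
        using van[OF t1 _ that] act0(1) arg_cong[OF act0(1), of "pev phi"] unfolding pev_act by simp
      show "\<exists>s. Wt \<theta> = s * Wt \<theta>1"
        if "\<And>k. k < 3 \<Longrightarrow> inS (\<theta> k)" "\<And>k. k < 3 \<Longrightarrow> homog e (\<theta> k)" "inS K" "act \<theta> (\<Prod>F) = K * \<Prod>F" for \<theta> K e
        using log[OF that] True v2 by auto
    qed
    moreover have "r * a + 2 - r \<le> degree (Wt \<theta>1)"
    proof (rule degree_arith)
      have "pev phi h2 = 0" using vk True v2 by simp
      then have W: "Wt \<theta> = pev phi h1 * Wt \<theta>1" using Wk by simp
      then show "degree (pev phi h1) + r * a \<le> r * (dG + (r - 1))"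
        using k(6) h by (intro degree_coefficient) auto
      show "r + r * dG = degree (pev phi h1) + degree (Wt \<theta>1)"
        using k(6,7) W by (simp add: degree_mult_eq)
    qed
    moreover have "degree (Wt \<theta>1) \<le> r * a + 2 - r" using \<theta>1 by (intro degree_Wt t1) auto
    ultimately show ?thesis by simp
  next
    case False
    \<comment> \<open>Since \<open>v1\<close> is nonzero, the syzygies over C[t] form a free module
      of rank one. A generator is a syzygy whose second entry is nonzero of least degree; (v2, -v1)
      shows that there is a candidate.\<close>
    define syz where "syz = (\<lambda>h. fst h * v1 + snd h * v2 = 0)"
    have "syz (v2, - v1) \<and> snd (v2, - v1) \<noteq> 0" using False by (simp add: syz_def algebra_simps)
    from ex_has_least_nat[where P = "\<lambda>h. syz h \<and> snd h \<noteq> 0" and m = "\<lambda>h. degree (snd h)", OF this]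
    obtain u where u: "syz u" "snd u \<noteq> 0" and least: "\<And>h. syz h \<Longrightarrow> snd h \<noteq> 0 \<Longrightarrow> degree (snd u) \<le> degree (snd h)"
      by blast
    define p1 p2 where "p1 = fst u" and "p2 = snd u"
    have p: "p1 * v1 + p2 * v2 = 0" "p2 \<noteq> 0" using u by (simp_all add: p1_def p2_def syz_def)
    define U where "U = (\<lambda>k. p1 * pev phi (\<theta>1 k) + p2 * pev phi (\<theta>2 k))"
    define W where "W = p1 * Wt \<theta>1 + p2 * Wt \<theta>2"
    have WU: "wt U = W" unfolding U_def W_def wt_add wt_mult ..
    have actU: "(\<Sum>k<3. pev phi (pd k g) * U k) = p1 * pev phi (act \<theta>1 g) + p2 * pev phi (act \<theta>2 g)" for g
      by (simp add: U_def act_def sum_3 algebra_simps)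
    have tU: "tangent U"
      unfolding tangent_def actU v1_def[symmetric] v2_def[symmetric] by (rule p(1))
    \<comment> \<open>Reducing the second entry modulo \<open>p2\<close> leaves a syzygy whose
      second entry has smaller degree, hence is 0; cancelling \<open>v1\<close> then settles the
      first entry.\<close>
    have quot: "\<exists>s. h1' = s * p1 \<and> h2' = s * p2" if h': "h1' * v1 + h2' * v2 = 0" for h1' h2'
    proof -
      define s where "s = h2' div p2"
      have rem: "h2' mod p2 = h2' - s * p2" by (simp add: s_def minus_div_mult_eq_mod)
      have "(h1' - s * p1) * v1 + (h2' - s * p2) * v2 = (h1' * v1 + h2' * v2) - s * (p1 * v1 + p2 * v2)"
        by (simp only: algebra_simps)
      also have "\<dots> = 0" unfolding h' p(1) by simp
      finally have sz: "(h1' - s * p1) * v1 + (h2' - s * p2) * v2 = 0" .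
      have "h2' mod p2 = 0"
      proof (rule ccontr)
        assume "h2' mod p2 \<noteq> 0"
        moreover from this have "degree p2 \<le> degree (h2' mod p2)"
          using least[of "(h1' - s * p1, h2' mod p2)"] sz unfolding rem by (simp add: syz_def p2_def)
        ultimately show False using degree_mod_less[OF p(2), of h2'] by simp
      qed
      then have "h2' = s * p2" using rem by simp
      moreover from this have "h1' = s * p1" using sz False by simp
      ultimately show ?thesis by blast
    qed
    have "n = degree W" unfolding n
    proof (rule card_eq_degree)
      show "poly W t = 0" if "poly gam t = 0" for t
        unfolding WU[symmetric] by (rule van[OF tU _ that]) (simp add: actU act0)
      show "\<exists>s. Wt \<theta> = s * W"
        if th: "\<And>k. k < 3 \<Longrightarrow> inS (\<theta> k)" "\<And>k. k < 3 \<Longrightarrow> homog e (\<theta> k)" "inS K" "act \<theta> (\<Prod>F) = K * \<Prod>F" for \<theta> K e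
      proof -
        obtain h1' h2' where h': "Wt \<theta> = h1' * Wt \<theta>1 + h2' * Wt \<theta>2" "h1' * v1 + h2' * v2 = 0" using log[OF th] by blast
        obtain s where s: "h1' = s * p1" "h2' = s * p2" using quot[OF h'(2)] by blast
        have "Wt \<theta> = s * W" unfolding h'(1) s W_def by (simp add: algebra_simps)
        then show ?thesis ..
      qed
    qed
    moreover have "r * b + 2 - r \<le> degree W"
    proof -
      obtain s where s: "pev phi h1 = s * p1" "pev phi h2 = s * p2" using quot[OF vk] by blast
      have W: "Wt \<theta> = s * W" unfolding Wk s W_def by (simp add: algebra_simps)
      then have s0: "s \<noteq> 0" "W \<noteq> 0" using k(6) by auto
      \<comment> \<open>This is where \<open>b\<close> enters instead of \<open>a\<close>: the
        coefficient of \<open>\<theta>2\<close> is s p2, nonzero whatever the first coefficient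
        is.\<close>
      then have "pev phi h2 \<noteq> 0" using s(2) p(2) by simp
      from degree_coefficient[OF h(2,5) this] have "degree s + degree p2 + r * b \<le> r * (dG + (r - 1))"
        unfolding s(2) using s0 p(2) by (simp add: degree_mult_eq)
      moreover have "r + r * dG = degree s + degree W" using k(7) W s0 by (simp add: degree_mult_eq)
      ultimately show ?thesis by (intro degree_arith[of "degree s"]) auto
    qed
    ultimately show ?thesis by simp
  qed
qed

end

section \<open>Return to lines, smooth conics and the four counts\<close>

lemma line_component: assumes "is_line L" shows "component L 1"
proof -
  obtain N where N: "L = lf N" using homog_low[of L 1] assms by (auto simp: is_line_def)
  have "nz N" using assms unfolding is_line_def N nz_iff by (auto simp: lf_def sum_3)
  then have "nosing L" unfolding nosing_def N nz_def by (auto simp: pd_lf)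
  then show ?thesis using assms by (simp add: component_def is_line_def)
qed

lemma conic_component: assumes "is_smooth_conic Q" shows "component Q 2"
proof -
  have S: "inS Q" "homog 2 Q" "Q \<noteq> 0" and ns: "\<And>v. \<not> is_singular_pt Q v"
    using assms by (auto simp: is_smooth_conic_def)
  have "nosing Q" unfolding nosing_def
  proof (intro allI impI)
    fix x assume x: "nz x" "ev x Q = 0"
    have "ev (coord (trip x)) Q = 0" using x ev_coord_trip[OF S(1)] by simp
    moreover have "ev (coord (trip x)) (pd i Q) = ev x (pd i Q)" if "i < 3" for i
      using ev_coord_trip[OF inS_pd[OF S(1) that]] by simp
    ultimately show "\<exists>i<3. ev x (pd i Q) \<noteq> 0"
      using ns[of "trip x"] x trip_nz unfolding is_singular_pt_def mp_eval_ev by auto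
  qed
  then show ?thesis using S by (simp add: component_def)
qed

lemma CL_arr_arr: "CL_arr A \<Longrightarrow> arr A"
  unfolding CL_arr_def arr_def using line_component conic_component by blast

lemma proportional_sym: assumes "proportional p q" "p \<noteq> 0" shows "proportional q p"
proof -
  obtain c where c: "p = Const c * q" using assms by (auto simp: proportional_def)
  then have "c \<noteq> 0" using assms(2) by auto
  then have "q = Const (1 / c) * p" unfolding c by (simp flip: mult.assoc Const_mult)
  then show ?thesis by (auto simp: proportional_def)
qed

lemma proportional_refl: "proportional p p"
  unfolding proportional_def by (rule exI[of _ 1]) simp

lemma arr_insert:
  assumes "arr A" "component q r" "\<forall>p\<in>A. \<not> proportional q p"
  shows "arr (insert q A)" "insert q A - {q} = A"
proof -
  have "\<not> proportional p q" if "p \<in> A" for p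
    using that assms proportional_sym[of p q] unfolding arr_def component_def by blast
  then show "arr (insert q A)" using assms unfolding arr_def by blast
  show "insert q A - {q} = A" using assms(3) proportional_refl by blast
qed

lemma deletion:
  assumes A: "arr A" and q: "q \<in> A" "component q r" and fr: "free_exps (\<Prod>A) a b" and qh: "only_qh (\<Prod>A)"
  defines "n \<equiv> npoints (\<lambda>v. mp_eval (\<Prod>(A - {q})) v = 0 \<and> mp_eval q v = 0)"
  shows "n = r * b + 2 - r \<or> n \<le> r * a + 2 - r"
proof -
  obtain A' B C X Y Z r' \<kappa> where f: "arr_frame A' B C X Y Z q r' \<kappa> A"
    "ev (frame.infpt B C r') (\<Prod>(A - {q})) \<noteq> 0" using good_frame[OF A q(1)] .
  interpret arr_frame A' B C X Y Z q r' \<kappa> A by (rule f(1))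
  interpret good_arr_frame A' B C X Y Z q r' \<kappa> A
    using f(2) qh by unfold_locales (auto simp: G_def only_qh_def)
  obtain \<theta>1 \<theta>2 where "free_gens (\<Prod>A) a b \<theta>1 \<theta>2" using free_exps_gens[OF fr] .
  from deletion_count[OF this] show ?thesis using component_q[OF q(2)] by (simp add: n_def G_def)
qed

lemma addition:
  assumes A: "arr A" and q: "component q r" "\<forall>p\<in>A. \<not> proportional q p"
    and fr: "free_exps (\<Prod>A) a b" and qh: "only_qh (\<Prod>(insert q A))"
  defines "n \<equiv> npoints (\<lambda>v. mp_eval (\<Prod>A) v = 0 \<and> mp_eval q v = 0)"
  shows "n = r * a + 2 - r \<or> r * b + 2 - r \<le> n"
proof -
  note ins = arr_insert[OF A q]
  obtain A' B C X Y Z r' \<kappa> where f: "arr_frame A' B C X Y Z q r' \<kappa> (insert q A)"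
    "ev (frame.infpt B C r') (\<Prod>(insert q A - {q})) \<noteq> 0" using good_frame[OF ins(1)] by blast
  interpret arr_frame A' B C X Y Z q r' \<kappa> "insert q A" by (rule f(1))
  have G: "G = \<Prod>A" unfolding G_def ins(2) ..
  interpret good_arr_frame A' B C X Y Z q r' \<kappa> "insert q A"
  proof
    show "ev infpt G \<noteq> 0" using f(2) unfolding ins(2) G .
    show "qh_point (\<Prod>(insert q A)) v" if "is_singular_pt (\<Prod>(insert q A)) v" for v
      using qh that unfolding only_qh_def by blast
  qed
  obtain \<theta>1 \<theta>2 where "free_gens (\<Prod>A) a b \<theta>1 \<theta>2" using free_exps_gens[OF fr] .
  then have fg: "free_gens G a b \<theta>1 \<theta>2" unfolding G .
  have "dG > 0" using arr_degree_pos[OF A] G_homog unfolding G .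
  from addition_count[OF fg this] show ?thesis using component_q[OF q(1)] by (simp only: n_def G)
qed

text \<open>At a point of \<open>q\<close> the gradient of the product is the value of the other
  factor times the gradient of \<open>q\<close>, which is nonzero by smoothness.\<close>

lemma singular_on_component:
  assumes A: "arr A" and q: "q \<in> A" "component q r" and v: "v \<noteq> (0,0,0)" "mp_eval q v = 0"
  shows "is_singular_pt (\<Prod>A) v \<longleftrightarrow> mp_eval (\<Prod>(A - {q})) v = 0"
proof -
  have f: "\<Prod>A = q * \<Prod>(A - {q})" using A q(1) prod.remove[of A q "\<lambda>x. x"] by (simp add: arr_def)
  define G where "G = \<Prod>(A - {q})"
  have "nz (coord v)" using v(1) trip_nz[of "coord v"] by (simp add: trip_coord)
  then obtain i where "i < 3" "ev (coord v) (pd i q) \<noteq> 0"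
    using q(2) v(2) unfolding component_def nosing_def mp_eval_ev by blast
  then show ?thesis unfolding is_singular_pt_def f G_def[symmetric] mp_eval_ev
    using v by (auto simp: mp_eval_ev pd_mult)
qed

theorem theorem3p7:
  fixes A :: "mpoly set" and a b :: nat
  assumes "CL_arr A" and "free_exps (\<Prod>A) a b" and "a \<le> b" and "only_qh (\<Prod>A)"
  shows
   "(\<forall>L\<in>A. is_line L \<longrightarrow> only_qh (\<Prod>(A - {L})) \<longrightarrow>
       (let n = npoints (\<lambda>v. mp_eval (\<Prod>(A - {L})) v = 0 \<and> mp_eval L v = 0)
        in n = b + 1 \<or> n \<le> a + 1))
  \<and> (\<forall>L. is_line L \<longrightarrow> (\<forall>p\<in>A. \<not> proportional L p) \<longrightarrow> only_qh (\<Prod>(insert L A)) \<longrightarrow>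
       (let n = npoints (\<lambda>v. mp_eval (\<Prod>A) v = 0 \<and> mp_eval L v = 0)
        in n = a + 1 \<or> n \<ge> b + 1))
  \<and> (\<forall>Q\<in>A. is_smooth_conic Q \<longrightarrow> only_qh (\<Prod>(A - {Q})) \<longrightarrow>
       (let k = npoints (\<lambda>v. mp_eval Q v = 0 \<and> is_singular_pt (\<Prod>A) v)
        in (\<forall>m. k = 2 * m \<longrightarrow> m = b \<or> m \<le> a) \<and>
           (\<forall>m. k = 2 * m + 1 \<longrightarrow> (int m = int a - 1 \<and> int m = int b - 1) \<or> int m \<le> int a - 1)))
  \<and> (\<forall>Q. is_smooth_conic Q \<longrightarrow> (\<forall>p\<in>A. \<not> proportional Q p) \<longrightarrow> only_qh (\<Prod>(insert Q A)) \<longrightarrow>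
       (let k = npoints (\<lambda>v. mp_eval (\<Prod>A) v = 0 \<and> mp_eval Q v = 0)
        in (\<forall>m. k = 2 * m \<longrightarrow> m = a \<or> m \<ge> b) \<and>
           (\<forall>m. k = 2 * m + 1 \<longrightarrow> (m = a \<and> m = b) \<or> m \<ge> b)))"
proof -
  have A: "arr A" by (rule CL_arr_arr[OF assms(1)])
  show ?thesis
  proof (intro conjI ballI allI impI)
    fix L assume L: "L \<in> A" "is_line L"
    from deletion[OF A L(1) line_component[OF L(2)] assms(2,4)]
    show "let n = npoints (\<lambda>v. mp_eval (\<Prod>(A - {L})) v = 0 \<and> mp_eval L v = 0) in n = b + 1 \<or> n \<le> a + 1"
      by (simp add: Let_def)
  next
    fix L assume L: "is_line L" "\<forall>p\<in>A. \<not> proportional L p" "only_qh (\<Prod>(insert L A))"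
    from addition[OF A line_component[OF L(1)] L(2) assms(2) L(3)]
    show "let n = npoints (\<lambda>v. mp_eval (\<Prod>A) v = 0 \<and> mp_eval L v = 0) in n = a + 1 \<or> n \<ge> b + 1"
      by (simp add: Let_def)
  next
    fix Q assume Q: "Q \<in> A" "is_smooth_conic Q"
    have "proj_points (\<lambda>v. mp_eval Q v = 0 \<and> is_singular_pt (\<Prod>A) v) =
        proj_points (\<lambda>v. mp_eval (\<Prod>(A - {Q})) v = 0 \<and> mp_eval Q v = 0)"
      unfolding proj_points_def using singular_on_component[OF A Q(1) conic_component[OF Q(2)]] by blast
    then have e: "npoints (\<lambda>v. mp_eval Q v = 0 \<and> is_singular_pt (\<Prod>A) v) =
        npoints (\<lambda>v. mp_eval (\<Prod>(A - {Q})) v = 0 \<and> mp_eval Q v = 0)" by (simp only: npoints_def)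
    define k where "k = npoints (\<lambda>v. mp_eval (\<Prod>(A - {Q})) v = 0 \<and> mp_eval Q v = 0)"
    \<comment> \<open>For r = 2 both bounds are even: an odd k = 2 m + 1 is not 2 b, and k \<le> 2 a
      then gives m \<le> a - 1.\<close>
    have "k = 2 * b \<or> k \<le> 2 * a"
      using deletion[OF A Q(1) conic_component[OF Q(2)] assms(2,4)] by (simp add: k_def)
    then show "let k = npoints (\<lambda>v. mp_eval Q v = 0 \<and> is_singular_pt (\<Prod>A) v)
        in (\<forall>m. k = 2 * m \<longrightarrow> m = b \<or> m \<le> a) \<and>
           (\<forall>m. k = 2 * m + 1 \<longrightarrow> (int m = int a - 1 \<and> int m = int b - 1) \<or> int m \<le> int a - 1)"
      unfolding Let_def e k_def[symmetric] by presburger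
  next
    fix Q assume Q: "is_smooth_conic Q" "\<forall>p\<in>A. \<not> proportional Q p" "only_qh (\<Prod>(insert Q A))"
    define k where "k = npoints (\<lambda>v. mp_eval (\<Prod>A) v = 0 \<and> mp_eval Q v = 0)"
    \<comment> \<open>Again an odd k is not 2 a, and 2 b \<le> 2 m + 1 gives b \<le> m.\<close>
    have "k = 2 * a \<or> 2 * b \<le> k"
      using addition[OF A conic_component[OF Q(1)] Q(2) assms(2) Q(3)] by (simp add: k_def)
    then show "let k = npoints (\<lambda>v. mp_eval (\<Prod>A) v = 0 \<and> mp_eval Q v = 0)
        in (\<forall>m. k = 2 * m \<longrightarrow> m = a \<or> m \<ge> b) \<and>
           (\<forall>m. k = 2 * m + 1 \<longrightarrow> (m = a \<and> m = b) \<or> m \<ge> b)"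
      unfolding Let_def k_def[symmetric] by presburger
  qed
qed

end
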